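(* For all $n \in \mathbb{N}$, $f(n) \leq 4$, where $$f(n) = \min\{\chi(G \times H) : G, H \text{ finite simple graphs with } \chi(G) \geq n \text{ and } \chi(H) \geq n\}.$$
   Context: $\chi$ denotes the chromatic number. The tensor product $G \times H$ of graphs $G$ and $H$ is the graph with vertex set $V(G \times H) = V(G) \times V(H)$ in which $(g,h) \sim (g',h')$ if $g \sim g'$ in $G$ and $h \sim h'$ in $H$. The function $f$ is the undirected Poljak–Rödl function. *)

theory Defs
  imports "Graph_Theory.Pair_Digraph"
begin

(* A finite simple graph is a pair_graph: a finite vertex set pverts G together with a
   symmetric, irreflexive adjacency relation parcs G on it. The null graph is allowed. *)

definition proper_colouring :: "'a pair_pre_digraph \<Rightarrow> nat \<Rightarrow> ('a \<Rightarrow> nat) \<Rightarrow> bool" where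
  "proper_colouring G k c \<longleftrightarrow>
     (\<forall>v \<in> pverts G. c v < k) \<and> (\<forall>(u, v) \<in> parcs G. c u \<noteq> c v)"

definition chromatic_number :: "'a pair_pre_digraph \<Rightarrow> nat" where
  "chromatic_number G = (LEAST k. \<exists>c. proper_colouring G k c)"

definition tensor_product ::
  "'a pair_pre_digraph \<Rightarrow> 'b pair_pre_digraph \<Rightarrow> ('a \<times> 'b) pair_pre_digraph" where
  "tensor_product G H =
     \<lparr> pverts = pverts G \<times> pverts H,
       parcs = {((g, h), (g', h')) | g h g' h'. (g, g') \<in> parcs G \<and> (h, h') \<in> parcs H} \<rparr>"

(* Every finite graph is isomorphic to one with vertices in nat, so the quantification
   over all finite simple graphs is rendered with the vertex type nat. The lemmas
   poljak_rodl_attained and poljak_rodl_le below show that this is indeed the minimum over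
   graphs on arbitrary vertex types. *)

definition poljak_rodl :: "nat \<Rightarrow> nat" where
  "poljak_rodl n =
     (LEAST m. \<exists>(G :: nat pair_pre_digraph) (H :: nat pair_pre_digraph).
        pair_graph G \<and> pair_graph H \<and>
        chromatic_number G \<ge> n \<and> chromatic_number H \<ge> n \<and>
        m = chromatic_number (tensor_product G H))"

lemma pair_graph_iff:
  "pair_graph G \<longleftrightarrow>
     finite (pverts G) \<and> parcs G \<subseteq> pverts G \<times> pverts G \<and> sym (parcs G) \<and> irrefl (parcs G)"
  (is "?L \<longleftrightarrow> ?R")
proof
  assume ?L
  then interpret pair_graph G .
  show ?R
    using pair_finite_verts pair_sym_arcs pair_no_loops arc_fst_in_verts arc_snd_in_verts
    by (fastforce simp: symmetric_def irrefl_def)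
next
  assume R: ?R
  then have "finite (parcs G)"
    by (meson finite_SigmaI finite_subset)
  with R show ?L
    by unfold_locales (auto simp: symmetric_def irrefl_def)
qed

lemma pair_graph_tensor_product:
  assumes "pair_graph G" "pair_graph H"
  shows "pair_graph (tensor_product G H)"
proof -
  have fin: "finite (pverts G)" "finite (pverts H)"
    and wf: "parcs G \<subseteq> pverts G \<times> pverts G" "parcs H \<subseteq> pverts H \<times> pverts H"
    and sym: "sym (parcs G)" "sym (parcs H)" and irr: "irrefl (parcs G)"
    using assms by (simp_all add: pair_graph_iff)
  show ?thesis
    unfolding pair_graph_iff
  proof (intro conjI)
    show "finite (pverts (tensor_product G H))"
      using fin by (simp add: tensor_product_def)
    show "parcs (tensor_product G H) \<subseteq>
        pverts (tensor_product G H) \<times> pverts (tensor_product G H)"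
      using wf by (auto simp: tensor_product_def)
    show "sym (parcs (tensor_product G H))"
      by (rule symI) (auto simp: tensor_product_def intro: symD[OF sym(1)] symD[OF sym(2)])
    show "irrefl (parcs (tensor_product G H))"
      using irr by (auto simp: tensor_product_def irrefl_def)
  qed
qed

lemma proper_colouring_chromatic_number:
  assumes "pair_graph G"
  shows "\<exists>c. proper_colouring G (chromatic_number G) c"
proof -
  have fin: "finite (pverts G)" and wf: "parcs G \<subseteq> pverts G \<times> pverts G"
    and irr: "irrefl (parcs G)"
    using assms by (simp_all add: pair_graph_iff)
  obtain c :: "'a \<Rightarrow> nat" and k where c: "c ` pverts G = {i. i < k}" "inj_on c (pverts G)"
    using finite_imp_inj_to_nat_seg[OF fin] by blast
  have "proper_colouring G k c"
    unfolding proper_colouring_def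
    using c wf irr by (auto simp: irrefl_def dest: inj_onD)
  then show ?thesis
    unfolding chromatic_number_def by - (rule LeastI_ex, blast)
qed

lemma chromatic_number_le: "proper_colouring G k c \<Longrightarrow> chromatic_number G \<le> k"
  unfolding chromatic_number_def by (auto intro: Least_le)

lemma chromatic_number_le_hom:
  assumes "pair_graph G'"
    and "\<And>v. v \<in> pverts G \<Longrightarrow> \<phi> v \<in> pverts G'"
    and "\<And>u v. (u, v) \<in> parcs G \<Longrightarrow> (\<phi> u, \<phi> v) \<in> parcs G'"
  shows "chromatic_number G \<le> chromatic_number G'"
proof -
  obtain c where "proper_colouring G' (chromatic_number G') c"
    using proper_colouring_chromatic_number[OF assms(1)] by blast
  then have "proper_colouring G (chromatic_number G') (c \<circ> \<phi>)"
    using assms(2,3) unfolding proper_colouring_def by fastforce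
  then show ?thesis
    by (rule chromatic_number_le)
qed

lemma exists_chromatic_number_ge:
  "\<exists>G :: nat pair_pre_digraph. pair_graph G \<and> n \<le> chromatic_number G"
proof -
  define K :: "nat pair_pre_digraph" where
    "K = \<lparr> pverts = {..<n}, parcs = {(i, j). i < n \<and> j < n \<and> i \<noteq> j} \<rparr>"
  have K: "pair_graph K"
    unfolding pair_graph_iff K_def sym_def irrefl_def by auto
  then obtain c where c: "proper_colouring K (chromatic_number K) c"
    using proper_colouring_chromatic_number by blast
  then have "inj_on c {..<n}" "c ` {..<n} \<subseteq> {..<chromatic_number K}"
    unfolding proper_colouring_def K_def by (auto simp: inj_on_def)
  then have "n \<le> chromatic_number K"
    using card_inj_on_le[of c "{..<n}" "{..<chromatic_number K}"] by simp
  with K show ?thesis by blast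
qed

lemma poljak_rodl_attained:
  "\<exists>(G :: nat pair_pre_digraph) (H :: nat pair_pre_digraph).
     pair_graph G \<and> pair_graph H \<and>
     chromatic_number G \<ge> n \<and> chromatic_number H \<ge> n \<and>
     poljak_rodl n = chromatic_number (tensor_product G H)"
proof -
  obtain G :: "nat pair_pre_digraph" where "pair_graph G" "n \<le> chromatic_number G"
    using exists_chromatic_number_ge by blast
  then show ?thesis
    unfolding poljak_rodl_def
    by - (rule LeastI_ex, blast)
qed

lemma exists_nat_copy:
  fixes G :: "'a pair_pre_digraph"
  assumes "pair_graph G"
  shows "\<exists>(G' :: nat pair_pre_digraph) \<phi> \<psi>. pair_graph G' \<and>
    (\<forall>v \<in> pverts G. \<phi> v \<in> pverts G') \<and> (\<forall>(u, v) \<in> parcs G. (\<phi> u, \<phi> v) \<in> parcs G') \<and>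
    (\<forall>v \<in> pverts G'. \<psi> v \<in> pverts G) \<and> (\<forall>(u, v) \<in> parcs G'. (\<psi> u, \<psi> v) \<in> parcs G)"
proof -
  have G: "finite (pverts G)" "parcs G \<subseteq> pverts G \<times> pverts G" "sym (parcs G)" "irrefl (parcs G)"
    using assms by (simp_all add: pair_graph_iff)
  obtain \<phi> :: "'a \<Rightarrow> nat" where inj: "inj_on \<phi> (pverts G)"
    using finite_imp_inj_to_nat_seg[OF G(1)] by blast
  define \<psi> where "\<psi> = inv_into (pverts G) \<phi>"
  have \<psi>: "\<psi> (\<phi> v) = v" if "v \<in> pverts G" for v
    using that inj by (simp add: \<psi>_def)
  define G' where "G' = \<lparr> pverts = \<phi> ` pverts G, parcs = map_prod \<phi> \<phi> ` parcs G \<rparr>"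
  have arc: "u \<in> pverts G" "v \<in> pverts G" if "(u, v) \<in> parcs G" for u v
    using that G(2) by auto
  have "pair_graph G'"
    unfolding pair_graph_iff
  proof (intro conjI)
    show "finite (pverts G')" "parcs G' \<subseteq> pverts G' \<times> pverts G'"
      using G(1,2) by (auto simp: G'_def)
    show "sym (parcs G')"
      using G(3) by (force simp: G'_def sym_def)
    show "irrefl (parcs G')"
      using G(4) arc inj by (auto simp: G'_def irrefl_def dest: inj_onD)
  qed
  moreover have "\<forall>v \<in> pverts G. \<phi> v \<in> pverts G'" "\<forall>(u, v) \<in> parcs G. (\<phi> u, \<phi> v) \<in> parcs G'"
    by (auto simp: G'_def)
  moreover have "\<forall>v \<in> pverts G'. \<psi> v \<in> pverts G" "\<forall>(u, v) \<in> parcs G'. (\<psi> u, \<psi> v) \<in> parcs G"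
    using arc by (auto simp: G'_def \<psi>)
  ultimately show ?thesis by blast
qed

lemma poljak_rodl_le:
  fixes G :: "'a pair_pre_digraph" and H :: "'b pair_pre_digraph"
  assumes G: "pair_graph G" "n \<le> chromatic_number G"
    and H: "pair_graph H" "n \<le> chromatic_number H"
  shows "poljak_rodl n \<le> chromatic_number (tensor_product G H)"
proof -
  obtain G' :: "nat pair_pre_digraph" and \<phi> \<psi> where G': "pair_graph G'"
    "\<forall>v \<in> pverts G. \<phi> v \<in> pverts G'" "\<forall>(u, v) \<in> parcs G. (\<phi> u, \<phi> v) \<in> parcs G'"
    "\<forall>v \<in> pverts G'. \<psi> v \<in> pverts G" "\<forall>(u, v) \<in> parcs G'. (\<psi> u, \<psi> v) \<in> parcs G"
    using exists_nat_copy[OF G(1)] by blast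
  obtain H' :: "nat pair_pre_digraph" and \<phi>' \<psi>' where H': "pair_graph H'"
    "\<forall>v \<in> pverts H. \<phi>' v \<in> pverts H'" "\<forall>(u, v) \<in> parcs H. (\<phi>' u, \<phi>' v) \<in> parcs H'"
    "\<forall>v \<in> pverts H'. \<psi>' v \<in> pverts H" "\<forall>(u, v) \<in> parcs H'. (\<psi>' u, \<psi>' v) \<in> parcs H"
    using exists_nat_copy[OF H(1)] by blast
  have "n \<le> chromatic_number G'"
    using chromatic_number_le_hom[of G' G \<phi>] G' G(2) by fastforce
  moreover have "n \<le> chromatic_number H'"
    using chromatic_number_le_hom[of H' H \<phi>'] H' H(2) by fastforce
  ultimately have "poljak_rodl n \<le> chromatic_number (tensor_product G' H')"
    unfolding poljak_rodl_def using G'(1) H'(1) by (intro Least_le) blast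
  also have "\<dots> \<le> chromatic_number (tensor_product G H)"
    using G' H' pair_graph_tensor_product[OF G(1) H(1)]
    by (intro chromatic_number_le_hom[of _ _ "map_prod \<psi> \<psi>'"]) (auto simp: tensor_product_def)
  finally show ?thesis .
qed

end

theory Submission
  imports
    Defs
    "HOL-Analysis.Analysis"
    "HOL-Computational_Algebra.Primes"
    "HOL-Number_Theory.Cong"
    "HOL-Library.Nat_Bijection"
    "HOL-Library.Numeral_Type"
begin

text \<open>For a prime \<open>p\<close> consider the words over \<open>\<int>/p\<close> with at most \<open>m\<close> jumps, with an arc from \<open>x\<close> to
  every word close to \<open>x + 1\<close> in Hamming distance. Erasing the letters of a word one by one contracts
  this space of words, so an argument in the style of Dold's theorem shows that \<open>C\<close> colours do not
  suffice once \<open>C\<^sup>p \<le> m\<close>.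

  The products for \<open>p = 2\<close> and odd \<open>q\<close> nevertheless have a colouring with a number of colours that does not
  depend on \<open>m\<close>. Taking majority letters in windows turns a pair of words into a point of a join of many
  copies of \<open>\<int>/2 \<times> \<int>/q\<close>. On the unit sphere of \<open>\<complex>\<^sup>2\<close>, where \<open>\<int>/2\<close> acts by the sign on the first and
  \<open>\<int>/q\<close> by a root of unity on the second coordinate, there is an equivariant self-map of degree zero
  (Conner and Floyd). It extends over the cone, and iterating this extension maps the join equivariantly to the
  sphere. Elements that are nontrivial in both factors act freely there, so a partition of the sphere
  into small cells is the required colouring.

  Finally, replace both digraphs by the graphs of their walks of length \<open>2r + 1\<close>. This decreases
  the chromatic number at most by \<open>2r\<close> iterated logarithms, but now a vertex of the product sees a
  large window of a colouring of the grid \<open>\<int> \<times> \<int>\<close> in which positions differing by \<open>\<plusminus>1\<close> or \<open>\<plusminus>3\<close> in each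
  coordinate have different colours; steps by 3 force \<open>q = 5\<close> instead of \<open>q = 3\<close>. Such a
  colouring is transformed by a local rule into one with four colours in which diagonal neighbours differ.\<close>

section \<open>An equivariant self-map of the 3-sphere of degree zero\<close>

text \<open>The group has order 2q on purpose: for a group of prime power order acting without a
  common fixed point, an equivariant self-map of the sphere cannot have degree zero. Each factor
  alone fixes a circle of the sphere, so the obstruction that makes each factor of the product hard
  to colour says nothing against a map to this sphere. An arc of the product moves both words at
  once, so only elements nontrivial in both factors have to move points.

  The order of choices carries the proof. The number C of cells of the sphere is found before m; C
  determines the radius of the local rule, the radius determines the length of the walks, and this
  length determines the tower of exponentials of n that m has to exceed.

  Greedy recolouring of a grid of degree four stops at five colours. The fifth is removed by
  recolouring whole 4-cycles at once, and those recoloured simultaneously must be kept apart by what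
  is visible nearby. This is the origin of the labels and of the steps by 3.\<close>

type_synonym quat = "complex \<times> complex"

text \<open>The pair \<open>(u, v)\<close> stands for the quaternion u + v j, where j u =
  \<open>cnj u\<close> j.\<close>

definition qmul :: "quat \<Rightarrow> quat \<Rightarrow> quat" where
  "qmul z w = (fst z * fst w - snd z * cnj (snd w), fst z * snd w + snd z * cnj (fst w))"

lemma qmul_assoc: "qmul (qmul a b) c = qmul a (qmul b c)"
  by (simp add: qmul_def algebra_simps)

lemma qmul_one [simp]: "qmul (1, 0) z = z" "qmul z (1, 0) = z"
  by (simp_all add: qmul_def)

lemma qmul_conj: "qmul (cnj (fst z), - snd z) z = (complex_of_real ((norm z)\<^sup>2), 0)"
  by (cases z) (auto simp: qmul_def norm_Pair complex_norm_square[symmetric] mult.commute simp del: of_real_power)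

lemma qmul_conj': "qmul z (cnj (fst z), - snd z) = (complex_of_real ((norm z)\<^sup>2), 0)"
  by (cases z) (auto simp: qmul_def norm_Pair complex_norm_square[symmetric] mult.commute simp del: of_real_power)

lemma qmul_eq_0D:
  assumes "qmul z w = 0" shows "z = 0 \<or> w = 0"
proof -
  have "qmul (qmul (cnj (fst z), - snd z) z) w = qmul (cnj (fst z), - snd z) 0"
    using assms by (simp add: qmul_assoc)
  then have "qmul (complex_of_real ((norm z)\<^sup>2), 0) w = 0"
    by (simp add: qmul_conj) (simp add: qmul_def zero_prod_def)
  then show ?thesis
    by (cases w) (auto simp: qmul_def zero_prod_def)
qed

fun qpow :: "quat \<Rightarrow> nat \<Rightarrow> quat" where
  "qpow z 0 = (1, 0)"
| "qpow z (Suc n) = qmul (qpow z n) z"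

lemma qpow_commute: "qmul z (qpow z n) = qmul (qpow z n) z"
  by (induction n) (simp_all add: qmul_assoc[symmetric])

lemma qpow_mult_inverse:
  assumes "qmul z w = (1, 0)" shows "qmul (qpow z n) (qpow w n) = (1, 0)"
proof (induction n)
  case (Suc n)
  have "qmul (qpow z (Suc n)) (qpow w (Suc n)) = qmul (qmul z (qmul (qpow z n) (qpow w n))) w"
    by (simp add: qmul_assoc) (simp add: qmul_assoc[symmetric] qpow_commute)
  then show ?case by (simp add: Suc assms)
qed simp

lemma qpow_nonzero: "z \<noteq> 0 \<Longrightarrow> qpow z n \<noteq> 0"
  by (induction n) (auto simp: zero_prod_def dest: qmul_eq_0D[unfolded zero_prod_def])

lemma continuous_on_qmul [continuous_intros]:
  "continuous_on S f \<Longrightarrow> continuous_on S g \<Longrightarrow> continuous_on S (\<lambda>x. qmul (f x) (g x))"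
  unfolding qmul_def by (intro continuous_intros)

lemma continuous_on_qpow [continuous_intros]:
  "continuous_on S f \<Longrightarrow> continuous_on S (\<lambda>x. qpow (f x) n)"
  by (induction n) (auto intro!: continuous_intros)

text \<open>For \<rho> of modulus 1 this is conjugation by a complex square root of \<rho>, hence an
  automorphism of the quaternions.\<close>

definition qrot :: "complex \<Rightarrow> quat \<Rightarrow> quat" where
  "qrot \<rho> z = (fst z, \<rho> * snd z)"

lemma qrot_qmul: "cnj \<rho> * \<rho> = 1 \<Longrightarrow> qmul (qrot \<rho> z) (qrot \<rho> w) = qrot \<rho> (qmul z w)"
  by (simp add: qmul_def qrot_def algebra_simps)

lemma qrot_qpow: "cnj \<rho> * \<rho> = 1 \<Longrightarrow> qpow (qrot \<rho> z) n = qrot \<rho> (qpow z n)"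
  by (induction n) (simp_all add: qrot_qmul, simp add: qrot_def)

lemma qpow_minus: "odd n \<Longrightarrow> qpow (- z) n = - qpow z n"
proof -
  have "qpow (- z) n = (if even n then qpow z n else - qpow z n)" for n
    by (induction n) (auto simp: qmul_def minus_prod_def prod_eq_iff)
  then show "odd n \<Longrightarrow> ?thesis" by simp
qed

text \<open>By Cayley-Hamilton the powers of \<open>w\<close> lie in the real span of \<open>w\<close> and 1.\<close>

fun qcoef :: "nat \<Rightarrow> quat \<Rightarrow> real \<times> real" where
  "qcoef 0 w = (0, 1)"
| "qcoef (Suc n) w = (2 * Re (fst w) * fst (qcoef n w) + snd (qcoef n w), - (fst (qcoef n w)) * (norm w)\<^sup>2)"

text \<open>The induction rests on w^2 = 2 Re(w) w - |w|^2. What matters later is that the second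
  coordinate of the power is a real multiple of \<open>snd w\<close>, since a real factor can be
  deformed.\<close>

lemma qpow_qcoef:
  "qpow w n = (of_real (fst (qcoef n w)) * fst w + of_real (snd (qcoef n w)), of_real (fst (qcoef n w)) * snd w)"
proof (induction n)
  case (Suc n)
  obtain u v where w: "w = (u, v)" by (cases w)
  define a b where "a = fst (qcoef n w)" and "b = snd (qcoef n w)"
  have n: "complex_of_real ((norm w)\<^sup>2) = u * cnj u + v * cnj v"
    by (simp add: w norm_Pair complex_norm_square[symmetric] del: of_real_power)
  have r: "complex_of_real (2 * Re u) = u + cnj u"
    by (simp add: complex_eq_iff)
  have "of_real (2 * Re u * a + b) * u + of_real (- a * (norm w)\<^sup>2) =
      (of_real a * u + of_real b) * u - of_real a * v * cnj v"
    unfolding of_real_add of_real_mult[of "2 * Re u"] of_real_mult[of "- a"] n r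
    by (simp add: algebra_simps)
  moreover have "of_real (2 * Re u * a + b) * v =
      (of_real a * u + of_real b) * v + of_real a * v * cnj u"
    unfolding of_real_add of_real_mult[of "2 * Re u"] r by (simp add: algebra_simps)
  moreover have "qpow w (Suc n) = qmul (of_real a * u + of_real b, of_real a * v) (u, v)"
    using Suc by (simp add: a_def b_def w)
  moreover have "qcoef (Suc n) w = (2 * Re u * a + b, - a * (norm w)\<^sup>2)"
    by (simp add: a_def b_def w)
  ultimately show ?case
    by (simp only: qmul_def w fst_conv snd_conv)
qed simp

lemma continuous_on_qcoef [continuous_intros]:
  "continuous_on S f \<Longrightarrow> continuous_on S (\<lambda>x. fst (qcoef n (f x)))"
  "continuous_on S f \<Longrightarrow> continuous_on S (\<lambda>x. snd (qcoef n (f x)))"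
proof -
  have "continuous_on S (\<lambda>x. fst (qcoef n (f x))) \<and> continuous_on S (\<lambda>x. snd (qcoef n (f x)))"
    if "continuous_on S f"
    using that by (induction n) (auto intro!: continuous_intros)
  then show "continuous_on S f \<Longrightarrow> continuous_on S (\<lambda>x. fst (qcoef n (f x)))"
  "continuous_on S f \<Longrightarrow> continuous_on S (\<lambda>x. snd (qcoef n (f x)))" by auto
qed

section \<open>Homotopies through nonzero quaternions\<close>

lemma homotopic_nonzeroI:
  fixes h :: "real \<Rightarrow> quat \<Rightarrow> quat"
  assumes "continuous_on UNIV (\<lambda>p. h (fst p) (snd p))"
    and "\<And>(t :: real) z. 0 \<le> t \<Longrightarrow> t \<le> 1 \<Longrightarrow> norm z = 1 \<Longrightarrow> h t z \<noteq> 0"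
    and "\<And>z. norm z = 1 \<Longrightarrow> h 0 z = f z" "\<And>z. norm z = 1 \<Longrightarrow> h 1 z = g z"
  shows "homotopic_with_canon (\<lambda>_. True) (sphere 0 1) (- {0}) f g"
proof -
  have "homotopic_with_canon (\<lambda>_. True) (sphere 0 1) (- {0}) (h 0) (h 1)"
    unfolding homotopic_with_def
    by (rule exI[of _ "\<lambda>p. h (fst p) (snd p)"])
      (use assms(1,2) in \<open>auto intro: continuous_on_subset\<close>)
  then show ?thesis
    by (rule homotopic_with_eq) (use assms(3,4) in auto)
qed

text \<open>A map of degree \<open>-q\<close>, homotopic to the \<open>q\<close>-th power of the conjugate quaternion, which
  commutes with \<open>qrot \<rho>\<close> if \<open>\<rho> ^ q = 1\<close>. Its product with the \<open>q\<close>-th power thus has degree zero.\<close>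

definition qbubble :: "nat \<Rightarrow> quat \<Rightarrow> quat" where
  "qbubble q z = (cnj (snd z) ^ q - of_real ((cmod (fst z))\<^sup>2), fst z * snd z)"

definition qnull :: "nat \<Rightarrow> quat \<Rightarrow> quat" where
  "qnull q z = qmul (qpow z q) (qbubble q z)"

lemma qnull_tau:
  assumes "\<rho> ^ q = 1" "cnj \<rho> * \<rho> = 1"
  shows "qnull q (qrot \<rho> z) = qrot \<rho> (qnull q z)"
proof -
  have "cnj \<rho> ^ q = 1"
    using assms(1) by (metis complex_cnj_one complex_cnj_power)
  then have "qbubble q (qrot \<rho> z) = qrot \<rho> (qbubble q z)"
    by (simp add: qbubble_def qrot_def power_mult_distrib)
  then show ?thesis
    by (simp add: qnull_def qrot_qpow qrot_qmul assms)
qed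

text \<open>The reflection is minus the automorphism \<open>qrot (-1)\<close>. The odd power passes
  the minus sign on, whereas \<open>qbubble q\<close> turns the reflection into
  \<open>qrot (-1)\<close> without a sign, so exactly one minus sign survives in the
  product.\<close>

lemma qnull_sigma:
  assumes "odd q"
  shows "qnull q (- fst z, snd z) = (- fst (qnull q z), snd (qnull q z))"
proof -
  have 1: "(- fst z, snd z) = - qrot (-1) z"
    by (simp add: qrot_def)
  have "qbubble q (- fst z, snd z) = qrot (-1) (qbubble q z)"
    by (simp add: qbubble_def qrot_def)
  then have "qnull q (- fst z, snd z) = qmul (- qrot (-1) (qpow z q)) (qrot (-1) (qbubble q z))"
    using assms by (simp add: qnull_def 1 qpow_minus qrot_qpow)
  also have "\<dots> = - qmul (qrot (-1) (qpow z q)) (qrot (-1) (qbubble q z))"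
    by (simp add: qmul_def)
  also have "\<dots> = - qrot (-1) (qnull q z)"
    by (simp add: qnull_def qrot_qmul)
  finally show ?thesis by (simp add: qrot_def)
qed

lemma norm_quat_1: "norm (z :: quat) = 1 \<longleftrightarrow> (cmod (fst z))\<^sup>2 + (cmod (snd z))\<^sup>2 = 1"
  by (cases z) (simp add: norm_Pair)

lemma homotopic_qmul:
  fixes h :: "real \<Rightarrow> quat \<Rightarrow> quat"
  assumes "continuous_on UNIV (\<lambda>p. h (fst p) (snd p))"
    and "\<And>(t :: real) z. 0 \<le> t \<Longrightarrow> t \<le> 1 \<Longrightarrow> norm z = 1 \<Longrightarrow> h t z \<noteq> 0"
    and "\<And>z. norm z = 1 \<Longrightarrow> h 0 z = f z" "\<And>z. norm z = 1 \<Longrightarrow> h 1 z = g z"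
  shows "homotopic_with_canon (\<lambda>_. True) (sphere 0 1) (- {0})
    (\<lambda>z. qmul (qpow z q) (f z)) (\<lambda>z. qmul (qpow z q) (g z))"
proof (rule homotopic_nonzeroI[where h = "\<lambda>t z. qmul (qpow z q) (h t z)"])
  show "continuous_on UNIV (\<lambda>p. qmul (qpow (snd p) q) (h (fst p) (snd p)))"
    by (intro continuous_intros assms(1))
  fix t :: real and z :: quat assume t: "0 \<le> t" "t \<le> 1" "norm z = 1"
  then have "z \<noteq> 0" by auto
  then show "qmul (qpow z q) (h t z) \<noteq> 0"
    using assms(2)[OF t] qpow_nonzero[of z q] by (auto dest!: qmul_eq_0D)
qed (use assms(3,4) in auto)

text \<open>The factor \<open>qpow z q\<close> stays fixed while the other one is deformed without
  zeros into the q-th power of the conjugate quaternion, which is its inverse on the unit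
  sphere.\<close>

lemma qnull_nullhomotopic:
  assumes "odd q"
  shows "homotopic_with_canon (\<lambda>_. True) (sphere 0 1) (- {0}) (qnull q) (\<lambda>_. (1, 0))"
proof -
  let ?H = "homotopic_with_canon (\<lambda>_. True) (sphere 0 1) (- {0 :: quat})"
  let ?m = "\<lambda>f z. qmul (qpow z q) (f z)"
  define w :: "quat \<Rightarrow> quat" where "w z = (cnj (snd z), fst z)" for z
  define A where "A z = fst (qcoef q (w z))" for z
  define B where "B z = snd (qcoef q (w z))" for z
  have contAB: "continuous_on UNIV (\<lambda>p :: real \<times> quat. A (snd p))"
      "continuous_on UNIV (\<lambda>p :: real \<times> quat. B (snd p))"
    unfolding A_def B_def w_def by (intro continuous_intros)+
  have wq: "qpow (w z) q = (of_real (A z) * cnj (snd z) + of_real (B z), of_real (A z) * fst z)" for z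
    by (simp add: qpow_qcoef A_def B_def w_def)
  have wq0: "qpow (w (0, v)) n = (cnj v ^ n, 0)" for v n
    by (induction n) (simp_all add: w_def qmul_def)
  have norm_w: "norm (w z) = norm z" for z
    by (cases z) (simp add: w_def norm_Pair add.commute)
  define b1 where "b1 z = (cnj (snd z) ^ q - of_real ((cmod (fst z))\<^sup>2), fst z)" for z :: quat
  define b2 where "b2 z = (of_real (A z) * cnj (snd z) + of_real (B z), fst z)" for z :: quat
  \<comment> \<open>The factor v in the second coordinate is deformed to 1. A zero would force v to
    be a nonpositive real; as q is odd, the first coordinate then equates a nonpositive number with
    |u|^2 > 0.\<close>
  have "?H (?m (qbubble q)) (?m b1)"
  proof (rule homotopic_qmul[where h = "\<lambda>t z. (cnj (snd z) ^ q - of_real ((cmod (fst z))\<^sup>2),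
        fst z * (of_real (1 - t) * snd z + of_real t))"])
    show "continuous_on UNIV (\<lambda>p :: real \<times> quat. (cnj (snd (snd p)) ^ q - of_real ((cmod (fst (snd p)))\<^sup>2),
        fst (snd p) * (of_real (1 - fst p) * snd (snd p) + of_real (fst p))))"
      by (intro continuous_intros)
    fix t :: real and z :: quat assume t: "0 \<le> t" "t \<le> 1" "norm z = 1"
    obtain u v where z: "z = (u, v)" by (cases z)
    have uv: "(cmod u)\<^sup>2 + (cmod v)\<^sup>2 = 1" using t(3) by (simp add: norm_quat_1 z)
    show "(cnj (snd z) ^ q - of_real ((cmod (fst z))\<^sup>2), fst z * (of_real (1 - t) * snd z + of_real t)) \<noteq> 0"
    proof
      assume "(cnj (snd z) ^ q - of_real ((cmod (fst z))\<^sup>2), fst z * (of_real (1 - t) * snd z + of_real t)) = 0"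
      then have X: "cnj v ^ q = of_real ((cmod u)\<^sup>2)" and Y: "u = 0 \<or> of_real (1 - t) * v + of_real t = 0"
        by (auto simp: z zero_prod_def)
      have "u \<noteq> 0"
        using X uv by auto
      with Y have e: "of_real (1 - t) * v = - of_real t" by (simp add: add_eq_0_iff2)
      then have "t \<noteq> 1" by auto
      with t have t1: "1 - t > 0" by simp
      have "v = of_real (- t / (1 - t))"
        using e t1 by (simp add: field_simps)
      moreover define x where "x = - t / (1 - t)"
      ultimately have v: "v = of_real x" by simp
      have "x \<le> 0" using t t1 by (simp add: x_def divide_nonneg_pos)
      then have "x ^ q \<le> 0" using assms by (simp add: power_le_zero_eq odd_pos)
      moreover have "x ^ q = (cmod u)\<^sup>2"
        using X unfolding v complex_cnj_complex_of_real of_real_power[symmetric] of_real_eq_iff .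
      ultimately show False using \<open>u \<noteq> 0\<close> by simp
    qed
  qed (simp_all add: qbubble_def b1_def)
  \<comment> \<open>The second coordinate is u throughout, so only u = 0 matters, and there both
    first coordinates equal \<open>cnj v ^ q\<close>.\<close>
  moreover have "?H (?m b1) (?m b2)"
  proof (rule homotopic_qmul[where h = "\<lambda>t z. (of_real (1 - t) * (cnj (snd z) ^ q - of_real ((cmod (fst z))\<^sup>2)) +
        of_real t * (of_real (A z) * cnj (snd z) + of_real (B z)), fst z)"])
    show "continuous_on UNIV (\<lambda>p. (of_real (1 - fst p) * (cnj (snd (snd p)) ^ q - of_real ((cmod (fst (snd p)))\<^sup>2)) +
        of_real (fst p) * (of_real (A (snd p)) * cnj (snd (snd p)) + of_real (B (snd p))), fst (snd p)))"
      by (intro continuous_intros contAB)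
    fix t :: real and z :: quat assume t: "0 \<le> t" "t \<le> 1" "norm z = 1"
    show "(of_real (1 - t) * (cnj (snd z) ^ q - of_real ((cmod (fst z))\<^sup>2)) +
        of_real t * (of_real (A z) * cnj (snd z) + of_real (B z)), fst z) \<noteq> 0"
    proof (cases "fst z = 0")
      case True
      then obtain v where z: "z = (0, v)" by (cases z) auto
      have "of_real (A z) * cnj v + of_real (B z) = cnj v ^ q"
        using wq[of z] wq0[of v q] by (simp add: z)
      then have "of_real (1 - t) * (cnj v ^ q) + of_real t * (of_real (A z) * cnj v + of_real (B z)) = cnj v ^ q"
        by (simp add: algebra_simps)
      moreover have "v \<noteq> 0" using t(3) by (auto simp: z)
      ultimately show ?thesis by (simp add: z zero_prod_def)
    qed (simp add: zero_prod_def)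
  qed (simp_all add: b1_def b2_def)
  \<comment> \<open>The real factor \<open>A z\<close> may be negative, so the segment from 1 to
    \<open>A z\<close> is pushed off 0 by an imaginary term that vanishes only at its ends. At t = 1
    the factor is nonzero wherever the first coordinate vanishes, because
    \<open>qpow (w z) q\<close> is nonzero.\<close>
  moreover have "?H (?m b2) (?m (\<lambda>z. qpow (w z) q))"
  proof (rule homotopic_qmul[where h = "\<lambda>t z. (of_real (A z) * cnj (snd z) + of_real (B z),
        (of_real (1 - t + t * A z) + \<i> * of_real (t * (1 - t))) * fst z)"])
    show "continuous_on UNIV (\<lambda>p. (of_real (A (snd p)) * cnj (snd (snd p)) + of_real (B (snd p)),
        (of_real (1 - fst p + fst p * A (snd p)) + \<i> * of_real (fst p * (1 - fst p))) * fst (snd p)))"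
      by (intro continuous_intros contAB)
    fix t :: real and z :: quat assume t: "0 \<le> t" "t \<le> 1" "norm z = 1"
    have nz: "qpow (w z) q \<noteq> 0"
      using t(3) norm_w[of z] by (intro qpow_nonzero) auto
    show "(of_real (A z) * cnj (snd z) + of_real (B z),
        (of_real (1 - t + t * A z) + \<i> * of_real (t * (1 - t))) * fst z) \<noteq> 0"
    proof
      assume "(of_real (A z) * cnj (snd z) + of_real (B z),
        (of_real (1 - t + t * A z) + \<i> * of_real (t * (1 - t))) * fst z) = 0"
      then have X: "of_real (A z) * cnj (snd z) + of_real (B z) = 0"
        and Y: "of_real (1 - t + t * A z) + \<i> * of_real (t * (1 - t)) = 0 \<or> fst z = 0"
        by (auto simp: zero_prod_def)
      have "of_real (A z) * fst z \<noteq> 0"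
        using nz X by (simp add: wq zero_prod_def)
      then have "fst z \<noteq> 0" "A z \<noteq> 0" by auto
      with Y have "1 - t + t * A z = 0" "t * (1 - t) = 0"
        by (auto simp: complex_eq_iff)
      with \<open>A z \<noteq> 0\<close> show False by auto
    qed
  qed (simp_all add: b2_def wq)
  moreover have "?H (?m (\<lambda>z. qpow (w z) q)) (\<lambda>_. (1, 0))"
  proof -
    \<comment> \<open>A quarter turn through injective real-linear maps leads from \<open>w\<close>
      to the conjugation.\<close>
    have "?H (?m (\<lambda>z. qpow (w z) q)) (?m (\<lambda>z. qpow (cnj (fst z), - snd z) q))"
    proof (rule homotopic_qmul[where h = "\<lambda>t z. qpow
        (of_real (cos (t * pi / 2)) * cnj (snd z) + of_real (sin (t * pi / 2)) * cnj (fst z),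
         of_real (cos (t * pi / 2)) * fst z - of_real (sin (t * pi / 2)) * snd z) q"])
      show "continuous_on UNIV (\<lambda>p. qpow
        (of_real (cos (fst p * pi / 2)) * cnj (snd (snd p)) + of_real (sin (fst p * pi / 2)) * cnj (fst (snd p)),
         of_real (cos (fst p * pi / 2)) * fst (snd p) - of_real (sin (fst p * pi / 2)) * snd (snd p)) q)"
        by (intro continuous_intros) auto
      fix t :: real and z :: quat assume "norm z = 1"
      then have "z \<noteq> 0" by auto
      define c s where "c = cos (t * pi / 2)" and "s = sin (t * pi / 2)"
      have cs: "c * c + s * s = 1"
        using sin_cos_squared_add[of "t * pi / 2"] by (simp add: c_def s_def power2_eq_square add.commute)
      obtain u v where z: "z = (u, v)" by (cases z)
      have "(of_real c * cnj v + of_real s * cnj u, of_real c * u - of_real s * v) \<noteq> 0"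
      proof
        assume "(of_real c * cnj v + of_real s * cnj u, of_real c * u - of_real s * v) = 0"
        then have 1: "of_real c * cnj v + of_real s * cnj u = 0" and 2: "of_real c * u - of_real s * v = 0"
          by (auto simp: zero_prod_def)
        have 1: "of_real c * v + of_real s * u = 0"
          using arg_cong[OF 1, of cnj] by simp
        have "of_real (c * c + s * s) * u = of_real s * (of_real c * v + of_real s * u) + of_real c * (of_real c * u - of_real s * v)"
          by (simp add: algebra_simps)
        then have "u = 0" using 1 2 cs by simp
        have "of_real (c * c + s * s) * v = of_real c * (of_real c * v + of_real s * u) - of_real s * (of_real c * u - of_real s * v)"
          by (simp add: algebra_simps)
        then have "v = 0" using 1 2 cs by simp
        with \<open>u = 0\<close> \<open>z \<noteq> 0\<close> show False by (simp add: z zero_prod_def)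
      qed
      then show "qpow (of_real (cos (t * pi / 2)) * cnj (snd z) + of_real (sin (t * pi / 2)) * cnj (fst z),
         of_real (cos (t * pi / 2)) * fst z - of_real (sin (t * pi / 2)) * snd z) q \<noteq> 0"
        unfolding c_def[symmetric] s_def[symmetric] by (intro qpow_nonzero) (simp add: z)
    qed (simp_all add: w_def)
    then show ?thesis
    proof (rule homotopic_with_eq)
      fix z :: quat assume "z \<in> topspace (top_of_set (sphere 0 1))"
      then have "qmul z (cnj (fst z), - snd z) = (1, 0)"
        by (simp add: qmul_conj')
      then show "(1, 0) = qmul (qpow z q) (qpow (cnj (fst z), - snd z) q)"
        by (simp add: qpow_mult_inverse)
    qed auto
  qed
  ultimately have "?H (?m (qbubble q)) (\<lambda>_. (1, 0))"
    by (blast intro: homotopic_with_trans)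
  then show ?thesis
    by (simp add: qnull_def[abs_def])
qed

text \<open>Being null-homotopic away from 0, \<open>qnull q\<close> extends over the ball without
  zeros. Normalising keeps the equivariance on the sphere because both actions preserve the
  norm.\<close>

lemma equivariant_extension:
  assumes "odd q" "\<zeta> ^ q = 1" "cnj \<zeta> * \<zeta> = 1"
  shows "\<exists>F :: quat \<Rightarrow> quat. continuous_on (cball 0 1) F \<and> (\<forall>z \<in> cball 0 1. norm (F z) = 1) \<and>
    (\<forall>z. norm z = 1 \<longrightarrow> F (- fst z, snd z) = (- fst (F z), snd (F z)) \<and>
      F (fst z, \<zeta> * snd z) = (fst (F z), \<zeta> * snd (F z)))"
proof -
  have "\<exists>c. homotopic_with_canon (\<lambda>_. True) (sphere 0 1) (- {0}) (qnull q) (\<lambda>_. c)"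
    using qnull_nullhomotopic[OF assms(1)] by blast
  then obtain G where G: "continuous_on (cball 0 1) G" "G ` cball 0 1 \<subseteq> - {0}"
      "\<forall>z \<in> sphere 0 1. G z = qnull q z"
    unfolding nullhomotopic_from_sphere_extension by blast
  define F where "F z = G z /\<^sub>R norm (G z)" for z
  have nz: "norm (G z) \<noteq> 0" if "z \<in> cball 0 1" for z
    using G(2) that by auto
  have "continuous_on (cball 0 1) F"
    unfolding F_def using nz by (intro continuous_intros G(1)) auto
  moreover have "\<forall>z \<in> cball 0 1. norm (F z) = 1"
    using nz by (simp add: F_def)
  moreover have "F (- fst z, snd z) = (- fst (F z), snd (F z)) \<and>
      F (fst z, \<zeta> * snd z) = (fst (F z), \<zeta> * snd (F z))" if z: "norm z = 1" for z
  proof -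
    have cz: "cmod \<zeta> = 1"
      using assms(3) by (metis complex_mod_cnj norm_mult norm_one abs_norm_cancel power2_eq_1_iff power2_eq_square
          abs_of_nonneg norm_ge_zero real_sqrt_abs real_sqrt_one)
    have n1: "norm (- fst z, snd z) = 1" "norm (fst z, \<zeta> * snd z) = 1"
      using z by (simp_all add: norm_quat_1 norm_mult cz)
    have n2: "norm (- a, b) = norm (a, b)" "norm (a, \<zeta> * b) = norm (a, b)" for a b :: complex
      by (simp_all add: norm_Pair norm_mult cz)
    obtain a b where ab: "qnull q z = (a, b)" by (cases "qnull q z")
    have "qnull q (fst z, \<zeta> * snd z) = (a, \<zeta> * b)"
      using qnull_tau[OF assms(2,3), of z] ab by (simp add: qrot_def)
    moreover have "qnull q (- fst z, snd z) = (- a, b)"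
      using qnull_sigma[OF assms(1), of z] ab by simp
    ultimately show ?thesis
      using G(3) n1 z by (simp add: F_def ab n2)
  qed
  ultimately show ?thesis by blast
qed

section \<open>Cochains and contractions\<close>

text \<open>Ordered simplices are arbitrary lists, repetitions included, and cochains are total
  functions; membership in a complex enters only through congruence lemmas. On a single vertex the
  recursion reads \<open>\<phi> []\<close>, so the complex is augmented.\<close>

fun cobound :: "('a list \<Rightarrow> 'r::comm_ring_1) \<Rightarrow> 'a list \<Rightarrow> 'r" where
  "cobound \<phi> [] = 0"
| "cobound \<phi> (x # t) = \<phi> t - cobound (\<lambda>l. \<phi> (x # l)) t"

text \<open>Unrolled, this is the alternating sum of \<phi> over the simplices a x0, ..., a xi, b
  xi, ..., b xn that triangulate a prism.\<close>

fun prism :: "('a \<Rightarrow> 'a) \<Rightarrow> ('a \<Rightarrow> 'a) \<Rightarrow> ('a list \<Rightarrow> 'r::comm_ring_1) \<Rightarrow> 'a list \<Rightarrow> 'r" where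
  "prism a b \<phi> [] = 0"
| "prism a b \<phi> (x # t) = \<phi> (a x # b x # map b t) - prism a b (\<lambda>l. \<phi> (a x # l)) t"

lemma cobound_diff: "cobound (\<lambda>l. \<phi> l - \<psi> l) t = cobound \<phi> t - cobound \<psi> t"
  by (induction t arbitrary: \<phi> \<psi>) simp_all

lemma cobound_sum: "cobound (\<lambda>l. \<Sum>i\<in>I. \<phi> i l) t = (\<Sum>i\<in>I. cobound (\<phi> i) t)"
  by (induction t arbitrary: \<phi>) (simp_all add: sum_subtractf)

lemma cobound_map: "cobound (\<lambda>l. \<phi> (map f l)) t = cobound \<phi> (map f t)"
proof (induction t arbitrary: \<phi>)
  case (Cons x t)
  show ?case using Cons[of "\<lambda>l. \<phi> (f x # l)"] by simp
qed simp

lemma cobound_cobound: "cobound (cobound \<phi>) t = 0"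
  by (induction t arbitrary: \<phi>) (simp_all add: cobound_diff)

lemma prism_diff: "prism a b (\<lambda>l. \<phi> l - \<psi> l) t = prism a b \<phi> t - prism a b \<psi> t"
  by (induction t arbitrary: \<phi> \<psi>) simp_all

lemma prism_homotopy:
  "prism a b (cobound \<phi>) t + cobound (prism a b \<phi>) t = \<phi> (map b t) - \<phi> (map a t)"
proof (induction t arbitrary: \<phi>)
  case (Cons x t)
  have "prism a b (cobound \<phi>) (x # t) = \<phi> (b x # map b t) - \<phi> (a x # map b t)
      + cobound (\<lambda>l. \<phi> (a x # b x # l)) (map b t) - prism a b \<phi> t
      + prism a b (cobound (\<lambda>l. \<phi> (a x # l))) t"
    by (simp add: prism_diff)
  moreover have "cobound (prism a b \<phi>) (x # t) = prism a b \<phi> t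
      - cobound (\<lambda>l. \<phi> (a x # b x # l)) (map b t) + cobound (prism a b (\<lambda>l. \<phi> (a x # l))) t"
    by (simp add: cobound_diff cobound_map[where \<phi> = "\<lambda>l. \<phi> (a x # b x # l)"])
  ultimately show ?case
    using Cons[of "\<lambda>l. \<phi> (a x # l)"] by (simp add: algebra_simps)
qed simp

lemma cobound_cong:
  assumes "\<And>l. set l \<subseteq> set t \<Longrightarrow> Suc (length l) = length t \<Longrightarrow> \<phi> l = \<psi> l"
  shows "cobound \<phi> t = cobound \<psi> t"
  using assms
proof (induction t arbitrary: \<phi> \<psi>)
  case (Cons x t)
  have "\<phi> t = \<psi> t" by (rule Cons.prems) auto
  moreover have "cobound (\<lambda>l. \<phi> (x # l)) t = cobound (\<lambda>l. \<psi> (x # l)) t"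
    by (rule Cons.IH, rule Cons.prems) auto
  ultimately show ?case by simp
qed simp

lemma prism_cong:
  assumes "\<And>l. set l \<subseteq> a ` set t \<union> b ` set t \<Longrightarrow> length l = Suc (length t) \<Longrightarrow> \<phi> l = \<psi> l"
  shows "prism a b \<phi> t = prism a b \<psi> t"
  using assms
proof (induction t arbitrary: \<phi> \<psi>)
  case (Cons x t)
  have "\<phi> (a x # b x # map b t) = \<psi> (a x # b x # map b t)" by (rule Cons.prems) auto
  moreover have "prism a b (\<lambda>l. \<phi> (a x # l)) t = prism a b (\<lambda>l. \<psi> (a x # l)) t"
    by (rule Cons.IH, rule Cons.prems) auto
  ultimately show ?case by simp
qed simp

text \<open>The differentials of the minimal resolution of the cyclic group of order \<open>p\<close> alternate between
  \<open>\<sigma> - 1\<close> and the norm.\<close>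

definition resol :: "nat \<Rightarrow> ('a \<Rightarrow> 'a) \<Rightarrow> nat \<Rightarrow> ('a list \<Rightarrow> 'r::comm_ring_1) \<Rightarrow> 'a list \<Rightarrow> 'r" where
  "resol p \<sigma> k \<phi> t = (if even k then \<phi> (map \<sigma> t) - \<phi> t else (\<Sum>j<p. \<phi> (map (\<sigma> ^^ j) t)))"

lemma resol_diff: "resol p \<sigma> k (\<lambda>l. \<phi> l - \<psi> l) t = resol p \<sigma> k \<phi> t - resol p \<sigma> k \<psi> t"
  by (simp add: resol_def sum_subtractf)

lemma cobound_resol: "cobound (resol p \<sigma> k \<phi>) t = resol p \<sigma> k (cobound \<phi>) t"
proof -
  have "resol p \<sigma> k \<phi> = (if even k then (\<lambda>t. \<phi> (map \<sigma> t) - \<phi> t) else (\<lambda>t. \<Sum>j<p. \<phi> (map (\<sigma> ^^ j) t)))"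
    by (auto simp: resol_def fun_eq_iff)
  then show ?thesis
    by (simp add: resol_def cobound_diff cobound_sum cobound_map)
qed

lemma resol_const: "of_nat p = (0 :: 'r) \<Longrightarrow> resol p \<sigma> k (\<lambda>_. \<kappa> :: 'r::comm_ring_1) t = 0"
  by (simp add: resol_def)

lemma sum_telescope_cyclic:
  fixes g :: "nat \<Rightarrow> 'r::comm_ring_1"
  assumes "g p = g 0"
  shows "(\<Sum>j<p. g (Suc j)) = (\<Sum>j<p. g j)"
  using assms sum_lessThan_telescope[of g p] by (simp add: sum_subtractf)

lemma resol_resol:
  fixes \<phi> :: "'a list \<Rightarrow> 'r::comm_ring_1"
  assumes "\<And>x. x \<in> set t \<Longrightarrow> (\<sigma> ^^ p) x = x"
  shows "resol p \<sigma> k (resol p \<sigma> (Suc k) \<phi>) t = 0"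
proof -
  have "(\<Sum>j<p. \<phi> (map (\<sigma> ^^ Suc j) t)) = (\<Sum>j<p. \<phi> (map (\<sigma> ^^ j) t))"
    using sum_telescope_cyclic[of "\<lambda>j. \<phi> (map (\<sigma> ^^ j) t)" p] map_idI[of t "\<sigma> ^^ p"] assms
    by simp
  moreover have "map (\<sigma> ^^ j) (map \<sigma> t) = map (\<sigma> ^^ Suc j) t" for j
    by (simp add: funpow_swap1)
  moreover have "map \<sigma> (map (\<sigma> ^^ j) t) = map (\<sigma> ^^ Suc j) t" for j
    by simp
  ultimately show ?thesis
    by (simp add: resol_def sum_subtractf del: map_map funpow.simps)
qed

text \<open>The elements of \<open>S k\<close> are the simplices of the \<open>k\<close>-th complex in an increasing sequence, each
  contractible in the next one through the contiguous maps \<open>H 0, \<dots>, H n\<close>.\<close>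

locale contraction =
  fixes p n :: nat and \<sigma> :: "'x \<Rightarrow> 'x" and H :: "nat \<Rightarrow> 'x \<Rightarrow> 'x" and z :: 'x
    and S :: "nat \<Rightarrow> 'x set set" and ring :: "'r::comm_ring_1 itself"
  assumes char: "of_nat p = (0 :: 'r)"
    and base: "{z} \<in> S 0"
    and S_mono: "A \<in> S k \<Longrightarrow> B \<subseteq> A \<Longrightarrow> B \<in> S k"
    and order: "A \<in> S k \<Longrightarrow> x \<in> A \<Longrightarrow> (\<sigma> ^^ p) x = x"
    and S_\<sigma>: "A \<in> S k \<Longrightarrow> \<sigma> ` A \<in> S k"
    and H_0: "A \<in> S k \<Longrightarrow> x \<in> A \<Longrightarrow> H 0 x = x"
    and H_n: "A \<in> S k \<Longrightarrow> x \<in> A \<Longrightarrow> H n x = z"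
    and S_H: "A \<in> S k \<Longrightarrow> s < n \<Longrightarrow> H s ` A \<union> H (Suc s) ` A \<in> S (Suc k)"
begin

section \<open>Chains built from the contractions\<close>

definition sweep :: "('x list \<Rightarrow> 'r) \<Rightarrow> 'x list \<Rightarrow> 'r" where
  "sweep \<phi> t = (\<Sum>s<n. prism (H s) (H (Suc s)) \<phi> t)"

lemma sweep_homotopy:
  assumes "set t \<in> S k"
  shows "sweep (cobound \<phi>) t + cobound (sweep \<phi>) t = \<phi> (replicate (length t) z) - \<phi> t"
proof -
  have "sweep (cobound \<phi>) t + cobound (sweep \<phi>) t =
      (\<Sum>s<n. \<phi> (map (H (Suc s)) t) - \<phi> (map (H s) t))"
    by (simp add: sweep_def[abs_def] cobound_sum sum.distrib[symmetric] prism_homotopy)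
  also have "\<dots> = \<phi> (map (H n) t) - \<phi> (map (H 0) t)"
    by (rule sum_lessThan_telescope)
  also have "map (H n) t = replicate (length t) z"
    using H_n[OF assms] by (simp add: map_replicate_const[symmetric])
  also have "map (H 0) t = t"
    using H_0[OF assms] by (simp add: map_idI)
  finally show ?thesis .
qed

text \<open>A chain is represented by the functional it defines on cochains. The next chain is the
  resolution differential of the previous one, coned off to z by \<open>sweep\<close>; the sign
  compensates for the negative sign of the identity in \<open>sweep_homotopy\<close>.\<close>

fun chain :: "nat \<Rightarrow> ('x list \<Rightarrow> 'r) \<Rightarrow> 'r" where
  "chain 0 \<phi> = \<phi> [z]"
| "chain (Suc k) \<phi> = - chain k (resol p \<sigma> k (sweep \<phi>))"

lemma S_funpow: "A \<in> S k \<Longrightarrow> (\<sigma> ^^ j) ` A \<in> S k"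
proof (induction j)
  case (Suc j)
  then have "\<sigma> ` (\<sigma> ^^ j) ` A \<in> S k" by (intro S_\<sigma>) simp
  then show ?case by (simp add: image_comp)
qed simp

lemma resol_cong:
  assumes "\<And>j. \<phi> (map (\<sigma> ^^ j) t) = \<psi> (map (\<sigma> ^^ j) t)"
  shows "resol p \<sigma> k \<phi> t = resol p \<sigma> k \<psi> t"
  using assms[of 0] assms[of 1] assms by (simp add: resol_def)

text \<open>One sweep turns a simplex of \<open>S k\<close> into simplices of
  \<open>S (Suc k)\<close> with one more vertex, so the chain of degree k lives in the k-th
  complex.\<close>

lemma chain_cong:
  assumes "\<And>t. set t \<in> S k \<Longrightarrow> length t = Suc k \<Longrightarrow> \<phi> t = \<psi> t"
  shows "chain k \<phi> = chain k \<psi>"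
  using assms
proof (induction k arbitrary: \<phi> \<psi>)
  case 0
  then show ?case using base by simp
next
  case (Suc k)
  have "sweep \<phi> t = sweep \<psi> t" if t: "set t \<in> S k" "length t = Suc k" for t
    unfolding sweep_def
  proof (intro sum.cong refl prism_cong)
    fix s l assume s: "s \<in> {..<n}"
      and l: "set l \<subseteq> H s ` set t \<union> H (Suc s) ` set t" "length l = Suc (length t)"
    show "\<phi> l = \<psi> l"
      using S_mono[OF S_H[OF t(1)] l(1)] s l(2) t(2) by (intro Suc.prems) auto
  qed
  then have "resol p \<sigma> k (sweep \<phi>) t = resol p \<sigma> k (sweep \<psi>) t"
    if "set t \<in> S k" "length t = Suc k" for t
    using that S_funpow by (intro resol_cong) simp
  then have "chain k (resol p \<sigma> k (sweep \<phi>)) = chain k (resol p \<sigma> k (sweep \<psi>))"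
    by (rule Suc.IH)
  then show ?case by simp
qed

lemma chain_diff: "chain k (\<lambda>t. \<phi> t - \<psi> t) = chain k \<phi> - chain k \<psi>"
proof (induction k arbitrary: \<phi> \<psi>)
  case (Suc k)
  have 1: "sweep (\<lambda>t. \<phi> t - \<psi> t) = (\<lambda>t. sweep \<phi> t - sweep \<psi> t)"
    by (simp add: fun_eq_iff sweep_def prism_diff sum_subtractf)
  have 2: "resol p \<sigma> k (\<lambda>t. sweep \<phi> t - sweep \<psi> t) = (\<lambda>t. resol p \<sigma> k (sweep \<phi>) t - resol p \<sigma> k (sweep \<psi>) t)"
    by (simp add: fun_eq_iff resol_diff)
  show ?case
    by (simp add: 1 2 Suc)
qed simp

lemma chain_zero: "chain k (\<lambda>_. 0) = 0"
  using chain_diff[of k "\<lambda>_. 0" "\<lambda>_. 0"] by simp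

text \<open>In the language of chains, the boundary of the chain of degree \<open>k + 1\<close> is \<open>\<sigma> - 1\<close>
  or the norm applied to the chain of degree \<open>k\<close>.\<close>

lemma chain_cobound: "chain (Suc k) (cobound \<phi>) = chain k (resol p \<sigma> k \<phi>)"
proof (induction k arbitrary: \<phi>)
  case 0
  have sweep: "sweep (cobound \<phi>) [x] = \<phi> [z] - \<phi> [x]" if "{x} \<in> S 0" for x
    using sweep_homotopy[of "[x]" 0 \<phi>] that by (simp add: sweep_def)
  have "{\<sigma> z} \<in> S 0"
    using S_\<sigma>[OF base] by simp
  then show ?case
    using base by (simp add: resol_def sweep)
next
  case (Suc k)
  let ?D = "resol p \<sigma> (Suc k)"
  have "sweep (cobound \<phi>) t = (\<phi> (replicate (Suc (Suc k)) z) - \<phi> t) - cobound (sweep \<phi>) t"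
    if "set t \<in> S (Suc k)" "length t = Suc (Suc k)" for t
    using sweep_homotopy[OF that(1), of \<phi>] that(2) by (simp add: algebra_simps)
  then have "resol p \<sigma> (Suc k) (sweep (cobound \<phi>)) t =
      ?D (\<lambda>t. (\<phi> (replicate (Suc (Suc k)) z) - \<phi> t) - cobound (sweep \<phi>) t) t"
    if "set t \<in> S (Suc k)" "length t = Suc (Suc k)" for t
    using that S_funpow by (intro resol_cong) simp
  \<comment> \<open>The term at the constant list drops out: the difference along \<sigma> kills
    constants, and the norm multiplies them by p, which is 0 in the ring.\<close>
  then have "resol p \<sigma> (Suc k) (sweep (cobound \<phi>)) t = (0 - ?D \<phi> t) - cobound (?D (sweep \<phi>)) t"
    if "set t \<in> S (Suc k)" "length t = Suc (Suc k)" for t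
    using that by (simp add: resol_diff resol_const[OF char] cobound_resol)
  then have "chain (Suc (Suc k)) (cobound \<phi>) = - chain (Suc k) (\<lambda>t. (0 - ?D \<phi> t) - cobound (?D (sweep \<phi>)) t)"
    using chain_cong[of "Suc k" "?D (sweep (cobound \<phi>))"] by simp
  also have "\<dots> = chain (Suc k) (?D \<phi>) + chain (Suc k) (cobound (?D (sweep \<phi>)))"
    by (simp only: chain_diff chain_zero) simp
  also have "chain (Suc k) (cobound (?D (sweep \<phi>))) = chain k (resol p \<sigma> k (?D (sweep \<phi>)))"
    by (rule Suc)
  also have "\<dots> = chain k (\<lambda>_. 0)"
    using order by (intro chain_cong resol_resol) auto
  finally show ?case
    by (simp only: chain_zero add_0_right)
qed

end

section \<open>Equivariant maps into sets with a rotation of prime order\<close>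

text \<open>Vanishing on repetitions is a separate clause because for p = 2 the coefficients have
  characteristic 2, where the change of sign does not imply it.\<close>

definition alternating :: "('t list \<Rightarrow> 'r::comm_ring_1) \<Rightarrow> bool" where
  "alternating \<psi> \<longleftrightarrow> (\<forall>a x y b. \<psi> (a @ x # y # b) = - \<psi> (a @ y # x # b)) \<and> (\<forall>a x b. \<psi> (a @ x # x # b) = 0)"

lemma alternatingI:
  "(\<And>a x y b. \<psi> (a @ x # y # b) = - \<psi> (a @ y # x # b)) \<Longrightarrow> (\<And>a x b. \<psi> (a @ x # x # b) = 0)
    \<Longrightarrow> alternating \<psi>"
  unfolding alternating_def by (intro conjI allI)

lemma alternating_swap: "alternating \<psi> \<Longrightarrow> \<psi> (a @ x # y # b) = - \<psi> (a @ y # x # b)"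
  unfolding alternating_def by (elim conjE allE)

lemma alternating_repeat: "alternating \<psi> \<Longrightarrow> \<psi> (a @ x # x # b) = 0"
  unfolding alternating_def by (elim conjE allE)

lemma alternating_not_distinct:
  assumes "alternating \<psi>" "\<not> distinct l"
  shows "\<psi> l = 0"
proof -
  have "\<psi> (a @ [x] @ b @ [x] @ c) = 0" for a x b c
  proof (induction b arbitrary: a)
    case Nil
    then show ?case using alternating_repeat[OF assms(1)] by simp
  next
    case (Cons y b)
    have "\<psi> (a @ [x] @ (y # b) @ [x] @ c) = - \<psi> (a @ y # x # b @ [x] @ c)"
      using alternating_swap[OF assms(1), of a x y "b @ [x] @ c"] by simp
    also have "\<dots> = 0" using Cons[of "a @ [y]"] by simp
    finally show ?case .
  qed
  then show ?thesis
    using not_distinct_decomp[OF assms(2)] by auto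
qed

lemma alternating_Cons:
  assumes "alternating \<psi>" shows "alternating (\<lambda>l. \<psi> (x # l))"
proof (rule alternatingI)
  show "\<psi> (x # a @ y # z # b) = - \<psi> (x # a @ z # y # b)" for a y z b
    using alternating_swap[OF assms, of "x # a" y z b] by simp
  show "\<psi> (x # a @ y # y # b) = 0" for a y b
    using alternating_repeat[OF assms, of "x # a" y b] by simp
qed

lemma cobound_zero: "cobound (\<lambda>_. 0) t = 0"
  by (induction t) simp_all

lemma cobound_uminus: "cobound (\<lambda>l. - \<phi> l) t = - cobound \<phi> t"
  using cobound_diff[of "\<lambda>_. 0" \<phi> t] cobound_diff[of \<phi> \<phi> t] by simp

lemma alternating_cobound:
  assumes "alternating \<psi>"
  shows "alternating (cobound \<psi>)"
proof -
  have "cobound \<psi> (a @ x # y # b) = - cobound \<psi> (a @ y # x # b)" for a x y b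
    using assms
  proof (induction a arbitrary: \<psi>)
    case Nil
    have "(\<lambda>l. \<psi> (x # y # l)) = (\<lambda>l. - \<psi> (y # x # l))"
      using alternating_swap[OF Nil, of "[]" x y] by (simp add: fun_eq_iff)
    then show ?case by (simp add: cobound_uminus)
  next
    case (Cons c a)
    show ?case
      using Cons.IH[OF alternating_Cons[OF Cons.prems, of c]] alternating_swap[OF Cons.prems, of a x y b]
      by simp
  qed
  moreover have "cobound \<psi> (a @ x # x # b) = 0" for a x b
    using assms
  proof (induction a arbitrary: \<psi>)
    case Nil
    have "(\<lambda>l. \<psi> (x # x # l)) = (\<lambda>_. 0)"
      using alternating_repeat[OF Nil, of "[]"] by (simp add: fun_eq_iff)
    then show ?case by (simp add: cobound_zero)
  next
    case (Cons c a)
    show ?case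
      using Cons.IH[OF alternating_Cons[OF Cons.prems, of c]] alternating_repeat[OF Cons.prems, of a x b]
      by simp
  qed
  ultimately show ?thesis
    by (rule alternatingI)
qed

section \<open>Free faces and exactness of the resolution\<close>

locale rotation =
  fixes p :: nat and T :: "'t set" and \<rho> :: "'t \<Rightarrow> 't"
  assumes prime: "prime p" and closed: "w \<in> T \<Longrightarrow> \<rho> w \<in> T" and order: "w \<in> T \<Longrightarrow> (\<rho> ^^ p) w = w"
begin

definition admissible :: "'t set \<Rightarrow> bool" where
  "admissible F \<longleftrightarrow> F \<noteq> {} \<and> F \<subseteq> T \<and> (\<forall>w \<in> F. \<rho> w \<notin> F)"

lemma p_pos: "0 < p"
  using prime by (simp add: prime_gt_0_nat)

lemma funpow_mult_p: "w \<in> T \<Longrightarrow> (\<rho> ^^ (p * k)) w = w"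
  by (induction k) (simp_all add: funpow_add order)

lemma inj_on_T: "inj_on \<rho> T"
proof (rule inj_onI)
  fix v w assume vw: "v \<in> T" "w \<in> T" "\<rho> v = \<rho> w"
  have "(\<rho> ^^ (p - 1)) (\<rho> u) = (\<rho> ^^ p) u" for u
    using p_pos by (metis Suc_diff_1 comp_apply funpow_Suc_right)
  then show "v = w"
    using vw by (metis order)
qed

lemma admissible_image:
  assumes "admissible F" shows "admissible (\<rho> ` F)"
proof -
  have F: "F \<noteq> {}" "F \<subseteq> T" "\<And>w. w \<in> F \<Longrightarrow> \<rho> w \<notin> F"
    using assms by (simp_all add: admissible_def)
  have "\<rho> (\<rho> w) \<noteq> \<rho> v" if "w \<in> F" "v \<in> F" for v w
  proof
    assume "\<rho> (\<rho> w) = \<rho> v"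
    then have "\<rho> w = v"
      using inj_onD[OF inj_on_T, of "\<rho> w" v] closed F(2) that by blast
    then show False using F(3) that by blast
  qed
  then show ?thesis
    unfolding admissible_def using F(1,2) closed by blast
qed

lemma admissible_funpow: "admissible F \<Longrightarrow> admissible ((\<rho> ^^ j) ` F)"
proof (induction j)
  case (Suc j)
  then have "admissible (\<rho> ` (\<rho> ^^ j) ` F)" by (intro admissible_image) simp
  then show ?case by (simp add: image_comp)
qed simp

lemma image_funpow_add: "(\<rho> ^^ i) ` (\<rho> ^^ j) ` F = (\<rho> ^^ (i + j)) ` F"
  by (simp add: funpow_add image_comp)

lemma image_funpow_mult_p: "F \<subseteq> T \<Longrightarrow> (\<rho> ^^ (p * k)) ` F = F"
  using image_cong[of F F "\<rho> ^^ (p * k)" "\<lambda>x. x"] funpow_mult_p by (simp add: subset_iff)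

text \<open>If the d-th power of the rotation fixes F and d is invertible modulo the prime p, then
  the rotation itself fixes F. But an admissible set is disjoint from its rotation.\<close>

lemma image_funpow_free:
  assumes F: "admissible F" and eq: "(\<rho> ^^ d) ` F = F" and "d < p"
  shows "d = 0"
proof (rule ccontr)
  assume "d \<noteq> 0"
  then have "coprime d p"
    using prime \<open>d < p\<close> by (metis coprime_commute nat_dvd_not_less neq0_conv prime_imp_coprime)
  then obtain k where "[d * k = 1] (mod p)"
    using cong_solve_coprime_nat by auto
  moreover have "(1 :: nat) mod p = 1"
    using prime_gt_1_nat[OF prime] by simp
  ultimately have dk: "d * k = p * (d * k div p) + 1"
    by (metis cong_def mult_div_mod_eq)
  have sub: "F \<subseteq> T" using F by (simp add: admissible_def)
  have "(\<rho> ^^ (d * j)) ` F = F" for j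
    by (induction j) (simp_all add: eq image_funpow_add[symmetric])
  then have "F = (\<rho> ^^ 1) ` (\<rho> ^^ (p * (d * k div p))) ` F"
    unfolding image_funpow_add using dk by (metis add.commute)
  then have "\<rho> ` F = F"
    by (simp only: image_funpow_mult_p[OF sub]) simp
  then show False
    using F by (auto simp: admissible_def)
qed

text \<open>By freeness every orbit of faces becomes a copy of the integers modulo p once a
  representative is chosen, and \<iota> is the position in it.\<close>

lemma ex_index:
  "\<exists>\<iota>. \<forall>F. admissible F \<longrightarrow> \<iota> F < p \<and> \<iota> (\<rho> ` F) = (\<iota> F + 1) mod p"
proof -
  define orb where "orb F = range (\<lambda>j. (\<rho> ^^ j) ` F)" for F
  \<comment> \<open>Choosing from the orbit as a set gives a face and its rotation the same
    representative.\<close>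
  define rep where "rep F = (SOME E. E \<in> orb F)" for F
  define \<iota> where "\<iota> F = (LEAST j. F = (\<rho> ^^ j) ` rep F)" for F
  have rep: "rep F \<in> orb F" for F
    unfolding rep_def by (rule someI[of _ F]) (auto simp: orb_def intro: range_eqI[of _ _ 0])
  have orb_image: "orb (\<rho> ` F) = orb F" if "F \<subseteq> T" for F
  proof -
    have "(\<rho> ^^ j) ` \<rho> ` F = (\<rho> ^^ Suc j) ` F" for j
      by (simp add: funpow_swap1 image_comp comp_def)
    moreover have "(\<rho> ^^ j) ` F = (\<rho> ^^ (p * 1 - 1 + j)) ` \<rho> ` F" for j
    proof -
      have "(\<rho> ^^ (p * 1 - 1 + j)) ` \<rho> ` F = (\<rho> ^^ (p * 1 - 1 + j)) ` (\<rho> ^^ 1) ` F" by simp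
      also have "\<dots> = (\<rho> ^^ (p * 1 - 1 + j + 1)) ` F"
        by (rule image_funpow_add)
      also have "p * 1 - 1 + j + 1 = j + p * 1" using p_pos by simp
      also have "(\<rho> ^^ (j + p * 1)) ` F = (\<rho> ^^ j) ` (\<rho> ^^ (p * 1)) ` F"
        by (rule image_funpow_add[symmetric])
      finally show ?thesis by (simp only: image_funpow_mult_p[OF that])
    qed
    ultimately show ?thesis
      unfolding orb_def by blast
  qed
  have ex: "\<exists>j<p. F = (\<rho> ^^ j) ` rep F" if F: "admissible F" for F
  proof -
    have sub: "F \<subseteq> T" using F by (simp add: admissible_def)
    obtain i where i: "rep F = (\<rho> ^^ i) ` F"
      using rep[of F] by (auto simp: orb_def)
    define j where "j = (p - i mod p) mod p"
    have "(j + i) mod p = 0"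
    proof -
      have "(j + i) mod p = (p - i mod p + i mod p) mod p"
        by (simp add: j_def mod_simps)
      also have "p - i mod p + i mod p = p" using p_pos by (simp add: less_imp_le)
      finally show ?thesis by simp
    qed
    then obtain k where "j + i = p * k" by (auto simp: mod_eq_0_iff_dvd dvd_def)
    then have "(\<rho> ^^ j) ` rep F = F"
      by (simp add: i image_funpow_add image_funpow_mult_p[OF sub])
    then show ?thesis
      using p_pos by (intro exI[of _ j]) (simp add: j_def)
  qed
  have adm_rep: "admissible (rep F)" if "admissible F" for F
    using rep[of F] admissible_funpow[OF that] by (auto simp: orb_def)
  have uniq: "i = j" if F: "admissible R" and ij: "(\<rho> ^^ i) ` R = (\<rho> ^^ j) ` R" "i < p" "j < p" for R i j
  proof -
    have sub: "R \<subseteq> T" using F by (simp add: admissible_def)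
    have "i = j" if "i \<le> j" and ij: "(\<rho> ^^ i) ` R = (\<rho> ^^ j) ` R" "i < p" "j < p" for i j
    proof -
      have "(\<rho> ^^ (p - i)) ` (\<rho> ^^ i) ` R = (\<rho> ^^ (p - i)) ` (\<rho> ^^ j) ` R"
        by (simp add: ij)
      then have "(\<rho> ^^ (p * 1)) ` R = (\<rho> ^^ ((j - i) + p * 1)) ` R"
        unfolding image_funpow_add using ij(2) \<open>i \<le> j\<close> by (simp add: add.commute)
      then have "R = (\<rho> ^^ (j - i)) ` R"
        by (simp only: image_funpow_add[symmetric] image_funpow_mult_p[OF sub])
      then have "j - i = 0"
        using ij by (intro image_funpow_free[OF F]) auto
      then show ?thesis using \<open>i \<le> j\<close> by simp
    qed
    from this[of i j] this[of j i] show ?thesis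
      using ij by (cases "i \<le> j") auto
  qed
  have \<iota>: "F = (\<rho> ^^ \<iota> F) ` rep F \<and> \<iota> F < p" if F: "admissible F" for F
  proof -
    obtain j where j: "j < p" "F = (\<rho> ^^ j) ` rep F" using ex[OF F] by blast
    have "F = (\<rho> ^^ \<iota> F) ` rep F" unfolding \<iota>_def by (rule LeastI) (rule j(2))
    moreover have "\<iota> F \<le> j" unfolding \<iota>_def by (rule Least_le) (rule j(2))
    ultimately show ?thesis using j(1) by simp
  qed
  have "\<iota> F < p \<and> \<iota> (\<rho> ` F) = (\<iota> F + 1) mod p" if F: "admissible F" for F
  proof -
    have sub: "F \<subseteq> T" using F by (simp add: admissible_def)
    have R: "rep (\<rho> ` F) = rep F"
      by (simp add: rep_def orb_image[OF sub])
    have subR: "rep F \<subseteq> T" using adm_rep[OF F] by (simp add: admissible_def)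
    have "(\<rho> ^^ \<iota> (\<rho> ` F)) ` rep F = \<rho> ` F"
      using \<iota>[OF admissible_image[OF F]] R by simp
    also have "\<dots> = (\<rho> ^^ 1) ` (\<rho> ^^ \<iota> F) ` rep F"
      using \<iota>[OF F] by simp
    also have "\<dots> = (\<rho> ^^ (\<iota> F + 1)) ` rep F"
      unfolding image_funpow_add by simp
    also have "\<iota> F + 1 = (\<iota> F + 1) mod p + p * ((\<iota> F + 1) div p)"
      by simp
    also have "(\<rho> ^^ ((\<iota> F + 1) mod p + p * ((\<iota> F + 1) div p))) ` rep F = (\<rho> ^^ ((\<iota> F + 1) mod p)) ` rep F"
      by (simp only: image_funpow_add[symmetric] image_funpow_mult_p[OF subR])
    finally have "\<iota> (\<rho> ` F) = (\<iota> F + 1) mod p"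
      using \<iota>[OF admissible_image[OF F]] p_pos by (intro uniq[OF adm_rep[OF F]]) auto
    then show ?thesis using \<iota>[OF F] by simp
  qed
  then show ?thesis by blast
qed

lemma map_funpow_p: "set t \<subseteq> T \<Longrightarrow> map (\<rho> ^^ p) t = t"
  using order by (intro map_idI) auto

text \<open>Freeness makes the periodic resolution exact. The index provides explicit primitives,
  either supported on the faces of index 0 or obtained by summing along the orbit from
  there.\<close>

lemma resol_exact:
  fixes \<phi> :: "'t list \<Rightarrow> 'r::comm_ring_1"
  assumes alt: "alternating \<phi>" and zero: "\<And>t. admissible (set t) \<Longrightarrow> resol p \<rho> k \<phi> t = 0"
  shows "\<exists>\<psi>. alternating \<psi> \<and> \<psi> [] = 0 \<and> (\<forall>t. admissible (set t) \<longrightarrow> \<phi> t = resol p \<rho> (Suc k) \<psi> t)"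
proof -
  obtain \<iota> where \<iota>: "\<And>F. admissible F \<Longrightarrow> \<iota> F < p" "\<And>F. admissible F \<Longrightarrow> \<iota> (\<rho> ` F) = (\<iota> F + 1) mod p"
    using ex_index by blast
  \<comment> \<open>The index depends only on the set of vertices, so primitives built from it
    inherit the alternation of \<phi>.\<close>
  have altI: "alternating (\<lambda>t. if admissible (set t) then \<Sum>j\<in>J (set t). \<phi> (map (f (set t) j) t) else 0)"
    for J :: "'t set \<Rightarrow> nat set" and f
  proof -
    let ?\<psi> = "\<lambda>t. if admissible (set t) then \<Sum>j\<in>J (set t). \<phi> (map (f (set t) j) t) else 0"
    have "?\<psi> (a @ x # y # b) = - ?\<psi> (a @ y # x # b)" for a x y b
    proof -
      define F where "F = set (a @ x # y # b)"
      have F: "set (a @ x # y # b) = F" "set (a @ y # x # b) = F" by (auto simp: F_def)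
      have "(\<Sum>j\<in>J F. \<phi> (map (f F j) (a @ x # y # b))) = - (\<Sum>j\<in>J F. \<phi> (map (f F j) (a @ y # x # b)))"
        unfolding sum_negf[symmetric] map_append list.map
        by (intro sum.cong refl alternating_swap[OF alt])
      then show ?thesis unfolding F by (cases "admissible F") simp_all
    qed
    moreover have "?\<psi> (a @ x # x # b) = 0" for a x b
      using alternating_repeat[OF alt] by simp
    ultimately show ?thesis
      by (rule alternatingI)
  qed
  show ?thesis
  proof (cases "even k")
    case True
    \<comment> \<open>For even k the cochain \<phi> is invariant. Restricted to index 0 it is
      recovered by the norm, which meets index 0 exactly once.\<close>
    define \<psi> where "\<psi> t = (if admissible (set t) then \<Sum>j\<in>(if \<iota> (set t) = 0 then {0} else {}). \<phi> (map (\<rho> ^^ j) t) else 0)"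
      for t
    have inv: "\<phi> (map (\<rho> ^^ j) t) = \<phi> t" if "admissible (set t)" for t j
    proof (induction j)
      case (Suc j)
      have "\<phi> (map \<rho> (map (\<rho> ^^ j) t)) = \<phi> (map (\<rho> ^^ j) t)"
        using zero[of "map (\<rho> ^^ j) t"] True admissible_funpow[OF that] by (simp add: resol_def)
      then show ?case by (simp add: Suc comp_def)
    qed simp
    have "\<phi> t = (\<Sum>j<p. \<psi> (map (\<rho> ^^ j) t))" if t: "admissible (set t)" for t
    proof -
      have index: "\<iota> ((\<rho> ^^ j) ` set t) = (\<iota> (set t) + j) mod p" for j
      proof (induction j)
        case (Suc j)
        have "(\<rho> ^^ Suc j) ` set t = \<rho> ` (\<rho> ^^ j) ` set t" by (simp add: image_comp)
        then show ?case
          using \<iota>(2)[OF admissible_funpow[OF t, of j]] Suc by (simp add: mod_simps)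
      qed (use \<iota>(1)[OF t] in simp)
      have "\<psi> (map (\<rho> ^^ j) t) = (if (\<iota> (set t) + j) mod p = 0 then \<phi> t else 0)" for j
        using admissible_funpow[OF t, of j] by (simp add: \<psi>_def index inv[OF t])
      then have "(\<Sum>j<p. \<psi> (map (\<rho> ^^ j) t)) = (\<Sum>j<p. if j = (p - \<iota> (set t)) mod p then \<phi> t else 0)"
      proof (simp only:, intro sum.cong refl if_cong)
        fix j assume "j \<in> {..<p}"
        moreover note \<iota>(1)[OF t]
        moreover have "(\<iota> (set t) + j) mod p = 0 \<longleftrightarrow> \<iota> (set t) + j = 0 \<or> \<iota> (set t) + j = p"
          if "\<iota> (set t) < p" "j < p"
          using that by (cases "\<iota> (set t) + j < p") (auto simp: mod_if)
        ultimately show "((\<iota> (set t) + j) mod p = 0) = (j = (p - \<iota> (set t)) mod p)"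
          by (cases "\<iota> (set t) = 0") auto
      qed
      also have "\<dots> = \<phi> t" using p_pos by simp
      finally show ?thesis by simp
    qed
    then show ?thesis
      using True altI[of "\<lambda>F j. \<rho> ^^ j" "\<lambda>F :: 't set. if \<iota> F = 0 then {0} else {}"]
      by (intro exI[of _ \<psi>]) (simp add: \<psi>_def[abs_def] resol_def admissible_def)
  next
    case False
    \<comment> \<open>For odd k the norm of \<phi> is 0. The sum runs over the rotations of t from
      index 0 up to the one just before t, so the difference along \<rho> is a single term; where
      the index wraps around, this uses the vanishing norm.\<close>
    define \<psi> where "\<psi> t = (if admissible (set t) then \<Sum>j<\<iota> (set t). \<phi> (map (\<rho> ^^ (p - \<iota> (set t) + j)) t) else 0)"
      for t
    have "\<phi> t = \<psi> (map \<rho> t) - \<psi> t" if t: "admissible (set t)" for t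
    proof -
      define i where "i = \<iota> (set t)"
      have i: "i < p" using \<iota>(1)[OF t] by (simp add: i_def)
      have sub: "set t \<subseteq> T" using t by (simp add: admissible_def)
      define g where "g j = \<phi> (map (\<rho> ^^ j) t)" for j
      have gp: "g p = g 0"
        by (simp add: g_def map_funpow_p[OF sub])
      have g0: "(\<Sum>j<p. g j) = 0"
        using zero[OF t] False by (simp add: resol_def g_def)
      have psi: "\<psi> t = (\<Sum>j<i. g (p - i + j))"
        using t by (simp add: \<psi>_def i_def g_def)
      have "admissible (set (map \<rho> t))" using admissible_image[OF t] by simp
      moreover have "map (\<rho> ^^ j) (map \<rho> t) = map (\<rho> ^^ Suc j) t" for j
        by (simp add: funpow_swap1)
      ultimately have psi': "\<psi> (map \<rho> t) = (\<Sum>j<(i + 1) mod p. g (p - (i + 1) mod p + j + 1))"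
        using \<iota>(2)[OF t] by (simp add: \<psi>_def i_def g_def del: map_map funpow.simps)
      show ?thesis
      proof (cases "i + 1 < p")
        case True
        then have "\<psi> (map \<rho> t) = (\<Sum>j<Suc i. g (p - i + j))"
          unfolding psi' by (intro sum.cong) (auto simp: algebra_simps intro!: arg_cong[of _ _ g])
        also have "\<dots> = \<psi> t + g p" using i by (simp add: psi)
        finally show ?thesis by (simp add: gp) (simp add: g_def)
      next
        case False
        then have "i + 1 = p" using i by simp
        then have "p - i + j = Suc j" for j by simp
        then have "\<psi> (map \<rho> t) = 0" "\<psi> t = (\<Sum>j<i. g (Suc j))"
          using \<open>i + 1 = p\<close> by (simp_all add: psi' psi)
        moreover have "(\<Sum>j<Suc i. g j) = 0" using g0 \<open>i + 1 = p\<close> by simp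
        then have "g 0 + (\<Sum>j<i. g (Suc j)) = 0"
          by (simp only: sum.lessThan_Suc_shift)
        ultimately have "\<psi> (map \<rho> t) - \<psi> t = g 0"
          by (simp add: add_eq_0_iff2)
        then show ?thesis by (simp add: g_def)
      qed
    qed
    then show ?thesis
      using False altI[of "\<lambda>F j. \<rho> ^^ (p - \<iota> F + j)" "\<lambda>F. {..<\<iota> F}"]
      by (intro exI[of _ \<psi>]) (simp add: \<psi>_def[abs_def] resol_def admissible_def)
  qed
qed

lemma admissible_subset: "admissible A \<Longrightarrow> B \<subseteq> A \<Longrightarrow> B \<noteq> {} \<Longrightarrow> admissible B"
  by (auto simp: admissible_def)

lemma cobound_cong_admissible:
  assumes "admissible (set t)" "\<And>l. admissible (set l) \<Longrightarrow> \<phi> l = \<psi> l" "\<phi> [] = \<psi> []"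
  shows "cobound \<phi> t = cobound \<psi> t"
proof (rule cobound_cong)
  fix l assume "set l \<subseteq> set t"
  then show "\<phi> l = \<psi> l"
    using assms admissible_subset by (cases "l = []") auto
qed

text \<open>A zigzag between coboundary and resolution that starts with the constant 1 on vertices,
  whose norm is p = 0. The coboundary of \<open>\<Psi> k\<close> is killed by the k-th differential,
  so \<open>resol_exact\<close> yields \<open>\<Psi> (Suc k)\<close>.\<close>

lemma ex_cochains:
  assumes char: "of_nat p = (0 :: 'r::comm_ring_1)"
  shows "\<exists>\<Psi> :: nat \<Rightarrow> 't list \<Rightarrow> 'r. (\<forall>k. alternating (\<Psi> k)) \<and>
    (\<forall>w \<in> T. \<rho> w \<noteq> w \<longrightarrow> resol p \<rho> 0 (\<Psi> 0) [w] = 1) \<and>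
    (\<forall>k t. admissible (set t) \<longrightarrow> cobound (\<Psi> k) t = resol p \<rho> (Suc k) (\<Psi> (Suc k)) t)"
proof -
  \<comment> \<open>The value at the empty list is kept 0 because coboundaries at single vertices
    read it.\<close>
  define Inv where "Inv k \<psi> \<longleftrightarrow> alternating \<psi> \<and> \<psi> [] = 0 \<and>
    (\<forall>t. admissible (set t) \<longrightarrow> cobound (resol p \<rho> k \<psi>) t = 0)" for k and \<psi> :: "'t list \<Rightarrow> 'r"
  define \<phi>0 where "\<phi>0 t = (if length t = 1 then 1 else (0 :: 'r))" for t :: "'t list"
  have "alternating \<phi>0" by (rule alternatingI) (simp_all add: \<phi>0_def)
  moreover have "resol p \<rho> 1 \<phi>0 t = 0" for t
    using char by (simp add: resol_def \<phi>0_def)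
  ultimately obtain \<psi>0 where \<psi>0: "alternating \<psi>0" "\<psi>0 [] = 0"
      "\<And>t. admissible (set t) \<Longrightarrow> \<phi>0 t = resol p \<rho> 2 \<psi>0 t"
    using resol_exact[of \<phi>0 1] by (auto simp: numeral_2_eq_2)
  have c0: "cobound \<phi>0 t = 0" for t
  proof (cases t rule: remdups_adj.cases)
    case (3 x y l)
    have "(\<lambda>l. \<phi>0 (x # y # l)) = (\<lambda>_. 0)"
      by (simp add: \<phi>0_def)
    then have "cobound (\<lambda>l. \<phi>0 (x # y # l)) l = 0" by (simp add: cobound_zero)
    then show ?thesis by (simp add: 3) (simp add: \<phi>0_def)
  qed (simp_all add: \<phi>0_def)
  have r2: "resol p \<rho> 2 \<psi>0 = resol p \<rho> 0 \<psi>0"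
    by (simp add: resol_def fun_eq_iff)
  have "cobound (resol p \<rho> 0 \<psi>0) t = cobound \<phi>0 t" if "admissible (set t)" for t
    using \<psi>0(2,3) r2 by (intro cobound_cong_admissible[OF that]) (simp_all add: resol_def \<phi>0_def)
  then have Inv0: "Inv 0 \<psi>0"
    using \<psi>0 c0 by (simp add: Inv_def)
  have "\<exists>\<psi>'. Inv (Suc k) \<psi>' \<and> (\<forall>t. admissible (set t) \<longrightarrow> cobound \<psi> t = resol p \<rho> (Suc k) \<psi>' t)"
    if \<psi>: "Inv k \<psi>" for k \<psi>
  proof -
    have "resol p \<rho> k (cobound \<psi>) t = 0" if "admissible (set t)" for t
      using \<psi> that by (simp add: Inv_def cobound_resol)
    then obtain \<psi>' where \<psi>': "alternating \<psi>'" "\<psi>' [] = 0"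
        "\<forall>t. admissible (set t) \<longrightarrow> cobound \<psi> t = resol p \<rho> (Suc k) \<psi>' t"
      using resol_exact[of "cobound \<psi>" k] \<psi> by (auto simp: Inv_def intro: alternating_cobound)
    have "cobound (resol p \<rho> (Suc k) \<psi>') t = cobound (cobound \<psi>) t" if "admissible (set t)" for t
      using \<psi>' by (intro cobound_cong_admissible[OF that]) (simp_all add: resol_def)
    then have "Inv (Suc k) \<psi>'"
      using \<psi>' by (simp add: Inv_def cobound_cobound)
    with \<psi>'(3) show ?thesis by blast
  qed
  then have "\<exists>\<Psi>. \<forall>k. (Inv k (\<Psi> k) \<and> (k = 0 \<longrightarrow> \<Psi> k = \<psi>0)) \<and>
      (\<forall>t. admissible (set t) \<longrightarrow> cobound (\<Psi> k) t = resol p \<rho> (Suc k) (\<Psi> (Suc k)) t)"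
    using Inv0 by (intro dependent_nat_choice) auto
  then obtain \<Psi> where \<Psi>: "\<Psi> 0 = \<psi>0" "\<And>k. Inv k (\<Psi> k)"
      "\<And>k t. admissible (set t) \<Longrightarrow> cobound (\<Psi> k) t = resol p \<rho> (Suc k) (\<Psi> (Suc k)) t"
    by blast
  have "resol p \<rho> 0 (\<Psi> 0) [w] = 1" if "w \<in> T" "\<rho> w \<noteq> w" for w
    using \<psi>0(3)[of "[w]"] that r2 by (auto simp: \<Psi>(1) admissible_def \<phi>0_def)
  then show ?thesis
    using \<Psi>(2,3) by (intro exI[of _ \<Psi>]) (simp add: Inv_def)
qed

end

text \<open>As in Dold's theorem, the pulled back cochains evaluate to 1 on the chains of every degree, but
  alternating cochains vanish in degrees from the number of points on.\<close>

context contraction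
begin

lemma no_equivariant_map:
  fixes T :: "'t set" and \<rho> :: "'t \<Rightarrow> 't" and lam :: "'x \<Rightarrow> 't" and m :: nat
  assumes rot: "rotation p T \<rho>" and T: "finite T" "card T \<le> m"
    and lam: "\<And>A k. A \<in> S k \<Longrightarrow> k \<le> m \<Longrightarrow> A \<noteq> {} \<Longrightarrow> rotation.admissible T \<rho> (lam ` A)"
    and equiv: "\<And>A k x. A \<in> S k \<Longrightarrow> x \<in> A \<Longrightarrow> lam (\<sigma> x) = \<rho> (lam x)"
  shows False
proof -
  interpret rotation p T \<rho> by (rule rot)
  obtain \<Psi> :: "nat \<Rightarrow> 't list \<Rightarrow> 'r" where \<Psi>: "\<And>k. alternating (\<Psi> k)"
      "\<And>w. w \<in> T \<Longrightarrow> \<rho> w \<noteq> w \<Longrightarrow> resol p \<rho> 0 (\<Psi> 0) [w] = 1"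
      "\<And>k t. admissible (set t) \<Longrightarrow> cobound (\<Psi> k) t = resol p \<rho> (Suc k) (\<Psi> (Suc k)) t"
    using ex_cochains[OF char] by blast
  define \<Phi> where "\<Phi> k t = \<Psi> k (map lam t)" for k t
  have lam_funpow: "lam ((\<sigma> ^^ j) x) = (\<rho> ^^ j) (lam x)" if "A \<in> S k" "x \<in> A" for j A k x
  proof (induction j)
    case (Suc j)
    have "lam (\<sigma> ((\<sigma> ^^ j) x)) = \<rho> (lam ((\<sigma> ^^ j) x))"
      using that by (intro equiv[OF S_funpow[OF that(1), of j]]) auto
    then show ?case by (simp add: Suc)
  qed simp
  have res: "resol p \<sigma> k' (\<Phi> k) t = resol p \<rho> k' (\<Psi> k) (map lam t)" if "set t \<in> S i" for k k' t i
  proof -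
    have "map lam (map (\<sigma> ^^ j) t) = map (\<rho> ^^ j) (map lam t)" for j
      using lam_funpow[OF that] by simp
    from this this[of 1] show ?thesis
      by (simp add: resol_def \<Phi>_def del: map_map)
  qed
  have "chain k (resol p \<sigma> k (\<Phi> k)) = 1" if "k \<le> m" for k
    using that
  proof (induction k)
    case 0
    have "admissible (lam ` {z})" using lam[OF base] by simp
    then show ?case
      using base \<Psi>(2)[of "lam z"] by (auto simp: res[of "[z]" 0] admissible_def)
  next
    case (Suc k)
    have "chain (Suc k) (resol p \<sigma> (Suc k) (\<Phi> (Suc k))) = chain (Suc k) (cobound (\<Phi> k))"
    proof (rule chain_cong)
      fix t assume t: "set t \<in> S (Suc k)" "length t = Suc (Suc k)"
      have "admissible (set (map lam t))"
        using lam[OF t(1) Suc.prems] t(2) by (cases t) auto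
      moreover have "cobound (\<Phi> k) t = cobound (\<Psi> k) (map lam t)"
        by (simp add: \<Phi>_def[abs_def] cobound_map)
      ultimately show "resol p \<sigma> (Suc k) (\<Phi> (Suc k)) t = cobound (\<Phi> k) t"
        using \<Psi>(3) by (simp add: res[OF t(1)])
    qed
    also have "\<dots> = 1"
      unfolding chain_cobound using Suc by simp
    finally show ?case .
  qed
  then have "chain m (resol p \<sigma> m (\<Phi> m)) = 1" by simp
  moreover have "chain m (resol p \<sigma> m (\<Phi> m)) = chain m (\<lambda>_. 0)"
  proof (rule chain_cong)
    fix t assume t: "set t \<in> S m" "length t = Suc m"
    have adm: "admissible (set (map lam t))"
      using lam[OF t(1)] t(2) by (cases t) auto
    have "\<Psi> m (map (\<rho> ^^ j) (map lam t)) = 0" for j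
    proof -
      have "set (map (\<rho> ^^ j) (map lam t)) \<subseteq> T"
        using admissible_funpow[OF adm, of j] by (simp add: admissible_def image_comp)
      then have "\<not> distinct (map (\<rho> ^^ j) (map lam t))"
        using T t(2) by (metis card_mono distinct_card length_map not_less_eq_eq order.trans)
      then show ?thesis by (rule alternating_not_distinct[OF \<Psi>(1)])
    qed
    from this this[of 0] this[of 1] show "resol p \<sigma> m (\<Phi> m) t = 0"
      unfolding res[OF t(1)] by (simp add: resol_def)
  qed
  ultimately show False by (simp add: chain_zero)
qed

end

section \<open>Words with few jumps\<close>

definition words :: "nat \<Rightarrow> nat \<Rightarrow> (nat \<Rightarrow> nat) set" where
  "words p n = {x. (\<forall>i<n. x i < p) \<and> (\<forall>i\<ge>n. x i = 0)}"

definition shift :: "nat \<Rightarrow> nat \<Rightarrow> (nat \<Rightarrow> nat) \<Rightarrow> nat \<Rightarrow> nat" where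
  "shift p n x = (\<lambda>i. if i < n then (x i + 1) mod p else 0)"

definition jumps :: "nat \<Rightarrow> (nat \<Rightarrow> nat) \<Rightarrow> nat set" where
  "jumps n x = {i. Suc i < n \<and> x i \<noteq> x (Suc i)}"

definition hamming :: "nat \<Rightarrow> (nat \<Rightarrow> nat) \<Rightarrow> (nat \<Rightarrow> nat) \<Rightarrow> nat" where
  "hamming n x y = card {i. i < n \<and> x i \<noteq> y i}"

definition base_verts :: "nat \<Rightarrow> nat \<Rightarrow> nat \<Rightarrow> (nat \<Rightarrow> nat) set" where
  "base_verts p n m = {x \<in> words p n. card (jumps n x) \<le> m}"

definition base_arc :: "nat \<Rightarrow> nat \<Rightarrow> nat \<Rightarrow> (nat \<Rightarrow> nat) \<Rightarrow> (nat \<Rightarrow> nat) \<Rightarrow> bool" where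
  "base_arc p n m x y \<longleftrightarrow> x \<in> base_verts p n m \<and> y \<in> base_verts p n m \<and> hamming n y (shift p n x) \<le> m"

lemma finite_base_verts: "finite (base_verts p n m)"
proof -
  have "words p n \<subseteq> {x. \<forall>i. (i \<in> {..<n} \<longrightarrow> x i \<in> {..<p}) \<and> (i \<notin> {..<n} \<longrightarrow> x i = 0)}"
    by (auto simp: words_def)
  then have "finite (words p n)"
    by (rule finite_subset) (intro finite_set_of_finite_funs finite_lessThan)
  then show ?thesis
    by (simp add: base_verts_def)
qed

lemma finite_jumps [simp]: "finite (jumps n x)"
  by (rule finite_subset[of _ "{..<n}"]) (auto simp: jumps_def)

lemma mod_Suc_inj: "a < p \<Longrightarrow> b < p \<Longrightarrow> Suc a mod p = Suc b mod p \<longleftrightarrow> a = b"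
  by (auto simp: mod_Suc)

lemma shift_words: "x \<in> words p n \<Longrightarrow> shift p n x \<in> words p n"
  by (cases "p = 0") (auto simp: words_def shift_def)

lemma jumps_shift: "x \<in> words p n \<Longrightarrow> jumps n (shift p n x) = jumps n x"
  by (auto simp: words_def shift_def jumps_def mod_Suc_inj)

lemma hamming_shift:
  "x \<in> words p n \<Longrightarrow> y \<in> words p n \<Longrightarrow> hamming n (shift p n x) (shift p n y) = hamming n x y"
  unfolding hamming_def by (rule arg_cong[of _ _ card]) (auto simp: words_def shift_def mod_Suc_inj)

lemma hamming_commute: "hamming n x y = hamming n y x"
  unfolding hamming_def by (rule arg_cong[of _ _ card]) auto

lemma hamming_self [simp]: "hamming n x x = 0"
  by (simp add: hamming_def)

lemma hamming_triangle: "hamming n x z \<le> hamming n x y + hamming n y z"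
proof -
  have "hamming n x z \<le> card ({i. i < n \<and> x i \<noteq> y i} \<union> {i. i < n \<and> y i \<noteq> z i})"
    unfolding hamming_def by (rule card_mono) auto
  also have "\<dots> \<le> hamming n x y + hamming n y z"
    unfolding hamming_def by (rule card_Un_le)
  finally show ?thesis .
qed

lemma shift_funpow:
  assumes "x \<in> words p n"
  shows "(shift p n ^^ j) x = (\<lambda>i. if i < n then (x i + j) mod p else 0)"
proof (induction j)
  case 0
  then show ?case using assms by (auto simp: words_def fun_eq_iff)
next
  case (Suc j)
  then show ?case by (auto simp: shift_def fun_eq_iff mod_simps)
qed

lemma shift_funpow_p: "x \<in> words p n \<Longrightarrow> (shift p n ^^ p) x = x"
  by (auto simp: shift_funpow words_def fun_eq_iff)

lemma shift_funpow_words: "x \<in> words p n \<Longrightarrow> (shift p n ^^ j) x \<in> words p n"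
  by (induction j) (simp_all add: shift_words)

lemma shift_base_verts: "x \<in> base_verts p n m \<Longrightarrow> shift p n x \<in> base_verts p n m"
  by (simp add: base_verts_def shift_words jumps_shift)

lemma shift_funpow_base_verts: "x \<in> base_verts p n m \<Longrightarrow> (shift p n ^^ j) x \<in> base_verts p n m"
  by (induction j) (simp_all add: shift_base_verts)

section \<open>Contracting the space of words\<close>

definition erase :: "nat \<Rightarrow> (nat \<Rightarrow> nat) \<Rightarrow> nat \<Rightarrow> nat" where
  "erase s x = (\<lambda>i. if i < s then 0 else x i)"

definition close_sets :: "nat \<Rightarrow> nat \<Rightarrow> nat \<Rightarrow> (nat \<Rightarrow> nat) set set" where
  "close_sets p n k = {A. A \<subseteq> base_verts p n k \<and> (\<forall>x \<in> A. \<forall>y \<in> A. hamming n x y \<le> k)}"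

lemma erase_words: "0 < p \<Longrightarrow> x \<in> words p n \<Longrightarrow> erase s x \<in> words p n"
  by (auto simp: words_def erase_def)

lemma card_jumps_erase: "card (jumps n (erase s x)) \<le> Suc (card (jumps n x))"
proof -
  have "jumps n (erase s x) \<subseteq> insert (s - 1) (jumps n x)"
    by (auto simp: jumps_def erase_def split: if_splits)
  then have "card (jumps n (erase s x)) \<le> card (insert (s - 1) (jumps n x))"
    by (intro card_mono) auto
  then show ?thesis
    by (simp add: card_insert_if split: if_splits)
qed

lemma hamming_erase: "hamming n (erase s x) (erase s' y) \<le> hamming n x y + (if s = s' then 0 else card {min s s'..<max s s'})"
proof -
  have "hamming n (erase s x) (erase s' y) \<le> card ({i. i < n \<and> x i \<noteq> y i} \<union> {min s s'..<max s s'})"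
    unfolding hamming_def by (rule card_mono) (auto simp: erase_def split: if_splits)
  also have "\<dots> \<le> hamming n x y + card {min s s'..<max s s'}"
    unfolding hamming_def by (rule card_Un_le)
  finally show ?thesis by auto
qed

text \<open>However many letters of a word are erased, at most one jump is new, and erasing one
  letter more changes a single position. The whole contraction therefore costs 1 in both bounds of
  \<open>close_sets\<close>, independently of n.\<close>

lemma contraction_words:
  assumes "0 < p" "of_nat p = (0 :: 'r::comm_ring_1)"
  shows "contraction TYPE('r) p n (shift p n) erase (\<lambda>_. 0) (close_sets p n)"
proof
  show "of_nat p = (0 :: 'r)" by (rule assms)
  show "{\<lambda>_. 0} \<in> close_sets p n 0"
    using assms(1) by (simp add: close_sets_def base_verts_def words_def jumps_def)
  show "B \<in> close_sets p n k" if "A \<in> close_sets p n k" "B \<subseteq> A" for A B k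
    using that unfolding close_sets_def by blast
  show "(shift p n ^^ p) x = x" if "A \<in> close_sets p n k" "x \<in> A" for A k x
    using that by (intro shift_funpow_p) (auto simp: close_sets_def base_verts_def)
  show "shift p n ` A \<in> close_sets p n k" if "A \<in> close_sets p n k" for A k
    using that shift_base_verts hamming_shift by (auto simp: close_sets_def base_verts_def subset_iff)
  show "erase 0 x = x" for x by (simp add: erase_def)
  show "erase n x = (\<lambda>_. 0)" if "A \<in> close_sets p n k" "x \<in> A" for A k x
    using that by (auto simp: close_sets_def base_verts_def words_def erase_def fun_eq_iff)
  show "erase s ` A \<union> erase (Suc s) ` A \<in> close_sets p n (Suc k)"
    if A: "A \<in> close_sets p n k" and "s < n" for A k s
  proof -
    have "erase s' x \<in> base_verts p n (Suc k)" if "x \<in> A" for s' x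
      using A that card_jumps_erase[of n s' x] erase_words[OF assms(1)]
      by (fastforce simp: close_sets_def base_verts_def)
    moreover have "hamming n (erase s1 x) (erase s2 y) \<le> Suc k"
      if "x \<in> A" "y \<in> A" "s1 \<in> {s, Suc s}" "s2 \<in> {s, Suc s}" for x y s1 s2
    proof -
      have "hamming n x y \<le> k" using A that by (auto simp: close_sets_def)
      moreover have "(if s1 = s2 then 0 else card {min s1 s2..<max s1 s2}) \<le> 1"
        using that(3,4) by auto
      ultimately show ?thesis using hamming_erase[of n s1 x s2 y] by linarith
    qed
    ultimately show ?thesis
      unfolding close_sets_def by auto
  qed
qed

text \<open>A word is mapped to the p-tuple of colours along its shift orbit. Shifting the word
  rotates the tuple, and the arcs make the tuples of a close set admissible. There are C^p such
  tuples, at most m, so \<open>no_equivariant_map\<close> applies.\<close>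

theorem base_not_colourable:
  assumes "prime p" "of_nat p = (0 :: 'r::comm_ring_1)" "C ^ p \<le> m"
    and c: "\<And>x. x \<in> base_verts p n m \<Longrightarrow> c x < C"
      "\<And>x y. base_arc p n m x y \<Longrightarrow> c x \<noteq> c y"
  shows False
proof -
  have p: "0 < p" using assms(1) by (simp add: prime_gt_0_nat)
  interpret contraction p n "shift p n" erase "\<lambda>_. 0" "close_sets p n" "TYPE('r)"
    by (rule contraction_words[OF p assms(2)])
  define T where "T = {w. set w \<subseteq> {..<C} \<and> length w = p}"
  define lam where "lam x = map (\<lambda>j. c ((shift p n ^^ j) x)) [0..<p]" for x
  have T: "finite T" "card T = C ^ p"
    unfolding T_def using finite_lists_length_eq[of "{..<C}" p] card_lists_length_eq[of "{..<C}" p] by simp_all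
  have "(rotate1 ^^ p) w = w" if "w \<in> T" for w
    using that rotate_id[of p w] by (simp add: T_def rotate_def)
  then have rot: "rotation p T rotate1"
    using assms(1) by unfold_locales (auto simp: T_def)
  have equiv: "lam (shift p n x) = rotate1 (lam x)" if "x \<in> words p n" for x
  proof (rule nth_equalityI)
    fix i assume "i < length (lam (shift p n x))"
    then have i: "i < p" by (simp add: lam_def)
    have "lam (shift p n x) ! i = c ((shift p n ^^ Suc i) x)"
      using i by (simp add: lam_def funpow_swap1)
    also have "\<dots> = rotate1 (lam x) ! i"
    proof (cases "Suc i = p")
      case True
      then show ?thesis
        using i shift_funpow_p[OF that] by (simp add: nth_rotate1 lam_def del: funpow.simps)
    next
      case False
      then show ?thesis
        using i by (simp add: nth_rotate1 lam_def)
    qed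
    finally show "lam (shift p n x) ! i = rotate1 (lam x) ! i" .
  qed (simp add: lam_def)
  show False
  proof (rule no_equivariant_map[OF rot T(1), of m lam])
    show "card T \<le> m" using T(2) assms(3) by simp
    show "lam (shift p n x) = rotate1 (lam x)" if "A \<in> close_sets p n k" "x \<in> A" for A k x
      using that by (intro equiv) (auto simp: close_sets_def base_verts_def)
    show "rotation.admissible T rotate1 (lam ` A)"
      if A: "A \<in> close_sets p n k" "k \<le> m" "A \<noteq> {}" for A k
      unfolding rotation.admissible_def[OF rot]
    proof (intro conjI ballI)
      have V: "x \<in> base_verts p n m" if "x \<in> A" for x
        using A that by (auto simp: close_sets_def base_verts_def)
      show "lam ` A \<noteq> {}" using A by simp
      show "lam ` A \<subseteq> T"
        using V shift_funpow_base_verts c(1) by (auto simp: T_def lam_def)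
      fix w assume "w \<in> lam ` A"
      then obtain x where x: "x \<in> A" "w = lam x" by auto
      have "rotate1 w \<noteq> lam y" if "y \<in> A" for y
      proof
        assume "rotate1 w = lam y"
        then have "lam (shift p n x) = lam y"
          using V[OF x(1)] by (simp add: x(2) equiv base_verts_def)
        then have "c (shift p n x) = c y"
          using arg_cong[of "lam (shift p n x)" "lam y" "\<lambda>w. w ! 0"] p by (simp add: lam_def)
        moreover have "base_arc p n m y (shift p n x)"
        proof -
          have "hamming n (shift p n x) (shift p n y) = hamming n x y"
            using V x(1) \<open>y \<in> A\<close> by (intro hamming_shift) (auto simp: base_verts_def)
          also have "\<dots> \<le> m" using A x(1) \<open>y \<in> A\<close> by (fastforce simp: close_sets_def)
          finally show ?thesis
            using V x(1) \<open>y \<in> A\<close> shift_base_verts by (simp add: base_arc_def)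
        qed
        ultimately show False using c(2) by metis
      qed
      then show "rotate1 w \<notin> lam ` A" by auto
    qed
  qed
qed

section \<open>Iterated equivariant extension\<close>

locale equivariant_filling =
  fixes F :: "quat \<Rightarrow> quat" and \<zeta> :: complex and q :: nat
  assumes cont_F: "continuous_on (cball 0 1) F"
    and norm_F: "norm z \<le> 1 \<Longrightarrow> norm (F z) = 1"
    and F_sigma: "norm z = 1 \<Longrightarrow> F (- fst z, snd z) = (- fst (F z), snd (F z))"
    and F_tau: "norm z = 1 \<Longrightarrow> F (fst z, \<zeta> * snd z) = (fst (F z), \<zeta> * snd (F z))"
    and norm_\<zeta>: "cmod \<zeta> = 1" and \<zeta>_power: "\<zeta> ^ q = 1"
begin

definition act :: "nat \<Rightarrow> nat \<Rightarrow> quat \<Rightarrow> quat" where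
  "act a b z = ((-1) ^ a * fst z, \<zeta> ^ b * snd z)"

definition unact :: "nat \<Rightarrow> nat \<Rightarrow> quat \<Rightarrow> quat" where
  "unact a b z = ((-1) ^ a * fst z, cnj (\<zeta> ^ b) * snd z)"

lemma cnj_\<zeta>: "cnj (\<zeta> ^ b) * \<zeta> ^ b = 1"
  using complex_norm_square[of "\<zeta> ^ b"] by (simp add: norm_power norm_\<zeta> mult.commute)

lemma norm_act [simp]: "norm (act a b z) = norm z"
  by (cases z) (simp add: act_def norm_Pair norm_mult norm_power norm_\<zeta>)

lemma norm_unact [simp]: "norm (unact a b z) = norm z"
  by (cases z) (simp add: unact_def norm_Pair norm_mult norm_power norm_\<zeta>)

lemma act_diff: "act a b z - act a b w = act a b (z - w)"
  by (simp add: act_def algebra_simps)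

lemma unact_diff: "unact a b z - unact a b w = unact a b (z - w)"
  by (simp add: unact_def algebra_simps)

lemma act_scaleR: "act a b (r *\<^sub>R z) = r *\<^sub>R act a b z"
  by (simp add: act_def)

lemma unact_scaleR: "unact a b (r *\<^sub>R z) = r *\<^sub>R unact a b z"
  by (simp add: unact_def)

lemma act_zero [simp]: "act a b 0 = 0"
  by (simp add: act_def zero_prod_def)

lemma act_act: "act c d (act a b z) = act (a + c) (b + d) z"
  by (simp add: act_def power_add mult_ac)

lemma act_unact: "act a b (unact a b z) = z"
proof -
  have "\<zeta> ^ b * (cnj (\<zeta> ^ b) * v) = (cnj (\<zeta> ^ b) * \<zeta> ^ b) * v" for v
    by (rule mult.left_commute[THEN trans]) (rule mult.assoc[symmetric])
  then have "\<zeta> ^ b * (cnj (\<zeta> ^ b) * v) = v" for v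
    by (simp only: cnj_\<zeta> mult_1)
  moreover have "(-1) ^ a * ((-1) ^ a * u) = (u :: complex)" for u
    by (simp add: mult.assoc[symmetric] power_mult_distrib[symmetric])
  ultimately show ?thesis
    by (simp only: act_def unact_def fst_conv snd_conv prod.collapse)
qed

lemma unact_act: "unact (a + c) (b + d) (act c d z) = unact a b z"
proof -
  have "cnj (\<zeta> ^ (b + d)) * (\<zeta> ^ d * v) = cnj (\<zeta> ^ b) * ((cnj (\<zeta> ^ d) * \<zeta> ^ d) * v)" for v
    by (simp only: power_add complex_cnj_mult mult.assoc)
  then have "cnj (\<zeta> ^ (b + d)) * (\<zeta> ^ d * v) = cnj (\<zeta> ^ b) * v" for v
    by (simp only: cnj_\<zeta> mult_1)
  moreover have "(-1) ^ (a + c) * ((-1) ^ c * u) = (-1) ^ a * (u :: complex)" for u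
    by (cases "even a"; cases "even c") (simp_all add: minus_one_power_iff)
  ultimately show ?thesis
    by (simp only: act_def unact_def fst_conv snd_conv)
qed

lemma act_mod: "act (a mod 2) (b mod q) = act a b" "unact (a mod 2) (b mod q) = unact a b"
proof -
  have "\<zeta> ^ (b mod q) = \<zeta> ^ b"
    by (metis \<zeta>_power mod_mult_div_eq mult.right_neutral power_add power_mult power_one)
  moreover have "(-1) ^ (a mod 2) = ((-1) ^ a :: complex)"
    by (cases "even a") (auto simp: even_iff_mod_2_eq_zero odd_iff_mod_2_eq_one)
  ultimately show "act (a mod 2) (b mod q) = act a b" "unact (a mod 2) (b mod q) = unact a b"
    by (simp_all add: act_def unact_def fun_eq_iff)
qed

lemma F_act: "norm z = 1 \<Longrightarrow> F (act a b z) = act a b (F z)"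
proof -
  have 1: "F (act (Suc a) b z) = act 1 0 (F (act a b z))" if "norm z = 1" for a b z
    using F_sigma[of "act a b z"] that norm_act[of a b z] unfolding act_def by simp
  have 2: "F (act 0 (Suc b) z) = act 0 1 (F (act 0 b z))" if "norm z = 1" for b z
    using F_tau[of "act 0 b z"] that norm_act[of 0 b z] unfolding act_def by (simp add: mult.assoc)
  assume z: "norm z = 1"
  have "F (act 0 b z) = act 0 b (F z)"
  proof (induction b)
    case 0
    then show ?case by (simp add: act_def)
  next
    case (Suc b)
    then show ?case by (simp add: 2[OF z] act_act)
  qed
  then show ?thesis
    by (induction a) (simp_all add: 1[OF z] act_act)
qed

text \<open>The homogeneous extension of \<open>F\<close> to the cone over the ball. For \<open>s = 0\<close> it only involves the
  equivariant values of \<open>F\<close> on the sphere.\<close>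

definition hom_F :: "quat \<Rightarrow> real \<Rightarrow> quat" where
  "hom_F z s = (norm z + s) *\<^sub>R F ((1 / (norm z + s)) *\<^sub>R z)"

lemma norm_scaled_le:
  assumes "0 \<le> s" shows "norm ((1 / (norm z + s)) *\<^sub>R (z :: quat)) \<le> 1"
proof -
  have "norm z / (norm z + s) \<le> 1"
    using assms norm_ge_zero[of z] unfolding divide_le_eq_1 by linarith
  then show ?thesis using assms by simp
qed

lemma norm_hom_F: "0 \<le> s \<Longrightarrow> norm (hom_F z s) = norm z + s"
  using norm_F[OF norm_scaled_le[of s z]] by (simp add: hom_F_def)

lemma continuous_on_hom_F: "continuous_on (UNIV \<times> {0..}) (\<lambda>p. hom_F (fst p) (snd p))"
  unfolding continuous_on_eq_continuous_within
proof
  fix p :: "quat \<times> real" assume p: "p \<in> UNIV \<times> {0..}"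
  show "continuous (at p within UNIV \<times> {0..}) (\<lambda>p. hom_F (fst p) (snd p))"
  proof (cases "norm (fst p) + snd p = 0")
    case True
    then have p0: "p = (0, 0)" using p by (cases p) (auto simp: add_nonneg_eq_0_iff)
    have "((\<lambda>p. hom_F (fst p) (snd p)) \<longlongrightarrow> 0) (at p within UNIV \<times> {0..})"
    proof (rule tendsto_norm_zero_cancel, rule Lim_transform_eventually)
      show "((\<lambda>p. norm (fst p) + snd p) \<longlongrightarrow> 0) (at p within UNIV \<times> {0 :: real..})"
        unfolding p0 by (rule tendsto_eq_intros refl | simp)+
      show "\<forall>\<^sub>F x in at p within UNIV \<times> {0..}. norm (fst x) + snd x = norm (hom_F (fst x) (snd x))"
        by (auto simp: eventually_at_filter norm_hom_F intro!: always_eventually)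
    qed
    moreover have "hom_F (fst p) (snd p) = 0" by (simp add: hom_F_def True)
    ultimately show ?thesis by (simp add: continuous_within)
  next
    case False
    define U where "U = {p :: quat \<times> real. norm (fst p) + snd p > 0}"
    have "open U" unfolding U_def by (intro open_Collect_less continuous_intros)
    have "continuous_on (U \<inter> UNIV \<times> {0..}) (\<lambda>p. F ((1 / (norm (fst p) + snd p)) *\<^sub>R fst p))"
    proof (rule continuous_on_compose2[OF cont_F])
      show "continuous_on (U \<inter> UNIV \<times> {0..}) (\<lambda>p. (1 / (norm (fst p) + snd p)) *\<^sub>R fst p)"
        by (intro continuous_intros) (auto simp: U_def)
      show "(\<lambda>p. (1 / (norm (fst p) + snd p)) *\<^sub>R fst p) ` (U \<inter> UNIV \<times> {0..}) \<subseteq> cball (0 :: quat) 1"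
      proof (rule image_subsetI)
        fix p :: "quat \<times> real" assume "p \<in> U \<inter> UNIV \<times> {0..}"
        then have "0 \<le> snd p" by auto
        then show "(1 / (norm (fst p) + snd p)) *\<^sub>R fst p \<in> cball 0 1"
          using norm_scaled_le by simp
      qed
    qed
    then have "continuous_on (U \<inter> UNIV \<times> {0..}) (\<lambda>p. hom_F (fst p) (snd p))"
      unfolding hom_F_def by (intro continuous_intros)
    moreover have pU: "p \<in> U" using p False by (auto simp: U_def less_le)
    ultimately have "continuous (at p within U \<inter> UNIV \<times> {0..}) (\<lambda>p. hom_F (fst p) (snd p))"
      using p by (simp add: continuous_on_eq_continuous_within)
    moreover have "at p within U \<inter> UNIV \<times> {0..} = at p within UNIV \<times> {0..}"
      by (rule at_within_nhd[OF pU \<open>open U\<close>]) auto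
    ultimately show ?thesis by simp
  qed
qed

text \<open>Adds one join coordinate, the group element (a, b) with weight s, to a vector z whose
  norm is the total weight so far. The cone with apex (a, b) is a translate of the one filled by
  F.\<close>

definition step :: "nat \<Rightarrow> nat \<Rightarrow> quat \<Rightarrow> real \<Rightarrow> quat" where
  "step a b z s = act a b (hom_F (unact a b z) s)"

lemma norm_step: "0 \<le> s \<Longrightarrow> norm (step a b z s) = norm z + s"
  by (simp add: step_def norm_hom_F)

text \<open>At weight 0 only the values of F on the sphere enter, where F is equivariant; hence the
  cones over different apexes fit together.\<close>

lemma step_0: "step a b z 0 = step 0 0 z 0"
proof (cases "z = 0")
  case False
  have "step a b z 0 = norm z *\<^sub>R act a b (F (unact a b ((1 / norm z) *\<^sub>R z)))" for a b
    by (simp add: step_def hom_F_def act_scaleR unact_scaleR)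
  also have "\<dots> a b = norm z *\<^sub>R F ((1 / norm z) *\<^sub>R z)" for a b
    using False F_act[of "unact a b ((1 / norm z) *\<^sub>R z)" a b] by (simp add: act_unact)
  finally show ?thesis by simp
qed (simp add: step_def hom_F_def act_def unact_def zero_prod_def)

lemma step_act: "step (a + c) (b + d) (act c d z) s = act c d (step a b z s)"
  by (simp add: step_def unact_act act_act)

lemma step_mod: "a mod 2 = a' mod 2 \<Longrightarrow> b mod q = b' mod q \<Longrightarrow> step a b = step a' b'"
  by (intro ext) (metis act_mod step_def)

text \<open>The topology of the join: group elements have to agree, modulo 2 and q, unless their
  weights are small.\<close>

definition near :: "real \<Rightarrow> nat \<Rightarrow> nat \<Rightarrow> real \<Rightarrow> nat \<Rightarrow> nat \<Rightarrow> real \<Rightarrow> bool" where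
  "near \<delta> a b s a' b' s' \<longleftrightarrow> 0 \<le> s \<and> s \<le> 1 \<and> 0 \<le> s' \<and> s' \<le> 1 \<and> \<bar>s - s'\<bar> < \<delta> \<and>
    (a mod 2 = a' mod 2 \<and> b mod q = b' mod q \<or> s < \<delta> \<and> s' < \<delta>)"

lemma near_mono: "near \<delta> a b s a' b' s' \<Longrightarrow> \<delta> \<le> \<delta>' \<Longrightarrow> near \<delta>' a b s a' b' s'"
  by (auto simp: near_def)

text \<open>Since \<open>act\<close> and \<open>unact\<close> are isometries, uniform continuity of
  \<open>hom_F\<close> on a compact set serves all exponents at once.\<close>

lemma step_uniform:
  assumes "\<epsilon> > 0"
  shows "\<exists>\<delta>>0. \<forall>a b a' b' (z :: quat) z' s s'. norm z \<le> M \<longrightarrow> norm z' \<le> M \<longrightarrow> norm (z - z') < \<delta> \<longrightarrow>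
    near \<delta> a b s a' b' s' \<longrightarrow> norm (step a b z s - step a' b' z' s') < \<epsilon>"
proof -
  let ?K = "cball (0 :: quat) M \<times> {0..1 :: real}"
  have "continuous_on ?K (\<lambda>p. hom_F (fst p) (snd p))"
    by (rule continuous_on_subset[OF continuous_on_hom_F]) auto
  moreover have "compact ?K" by (intro compact_Times) auto
  ultimately have "uniformly_continuous_on ?K (\<lambda>p. hom_F (fst p) (snd p))"
    by (rule compact_uniformly_continuous)
  then obtain \<delta> where \<delta>: "\<delta> > 0" "\<And>p p'. p \<in> ?K \<Longrightarrow> p' \<in> ?K \<Longrightarrow> dist p' p < \<delta> \<Longrightarrow>
      dist (hom_F (fst p') (snd p')) (hom_F (fst p) (snd p)) < \<epsilon> / 3"
    using assms unfolding uniformly_continuous_on_def by (metis divide_pos_pos zero_less_numeral)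
  have *: "norm (step a b z s - step a b z' s') < \<epsilon> / 3"
    if "norm z \<le> M" "norm z' \<le> M" "norm (z - z') < \<delta> / 2" "\<bar>s - s'\<bar> < \<delta> / 2" "0 \<le> s" "s \<le> 1" "0 \<le> s'" "s' \<le> 1"
    for a b and z z' :: quat and s s'
  proof -
    have "dist (unact a b z, s) (unact a b z', s') \<le> norm (z - z') + \<bar>s - s'\<bar>"
      using norm_Pair_le[of "unact a b z - unact a b z'" "s - s'"] by (simp add: dist_norm unact_diff)
    also have "\<dots> < \<delta>" using that by simp
    finally have "dist (hom_F (unact a b z) s) (hom_F (unact a b z') s') < \<epsilon> / 3"
      using \<delta>(2)[of "(unact a b z', s')" "(unact a b z, s)"] that by simp
    then show ?thesis by (simp add: step_def act_diff dist_norm)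
  qed
  show ?thesis
  proof (intro exI[of _ "\<delta> / 2"] conjI allI impI)
    show "\<delta> / 2 > 0" using \<delta>(1) by simp
    fix a b a' b' s s' and z z' :: quat
    assume z: "norm z \<le> M" "norm z' \<le> M" "norm (z - z') < \<delta> / 2" and near: "near (\<delta> / 2) a b s a' b' s'"
    show "norm (step a b z s - step a' b' z' s') < \<epsilon>"
    proof (cases "a mod 2 = a' mod 2 \<and> b mod q = b' mod q")
      case True
      then have "step a' b' = step a b" using step_mod by metis
      moreover have "norm (step a b z s - step a b z' s') < \<epsilon> / 3"
        using near by (intro * z) (auto simp: near_def)
      ultimately show ?thesis using assms by simp
    next
      case False
      \<comment> \<open>With different group elements both weights are small: go to weight 0,
        exchange the element and the vector there, and return, each at the cost of a third of
        \<epsilon>.\<close>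
      have "norm (step a b z s - step a b z 0) < \<epsilon> / 3"
        using near False \<delta>(1) z by (intro *) (auto simp: near_def)
      moreover have "norm (step 0 0 z 0 - step 0 0 z' 0) < \<epsilon> / 3"
        using near False \<delta>(1) z by (intro *) (auto simp: near_def)
      moreover have "norm (step a' b' z' 0 - step a' b' z' s') < \<epsilon> / 3"
        using near False \<delta>(1) z by (intro *) (auto simp: near_def)
      ultimately show ?thesis
        unfolding step_0[of a b] step_0[of a' b'] by norm
    qed
  qed
qed

fun steps :: "('i \<Rightarrow> nat) \<Rightarrow> ('i \<Rightarrow> nat) \<Rightarrow> ('i \<Rightarrow> real) \<Rightarrow> 'i list \<Rightarrow> quat \<Rightarrow> quat" where
  "steps a b s [] z = z"
| "steps a b s (i # L) z = steps a b s L (step (a i) (b i) z (s i))"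

lemma norm_steps:
  "(\<And>i. i \<in> set L \<Longrightarrow> 0 \<le> s i) \<Longrightarrow> norm (steps a b s L z) = norm z + sum_list (map s L)"
  by (induction L arbitrary: z) (simp_all add: norm_step)

lemma steps_act:
  "steps (\<lambda>i. a i + c) (\<lambda>i. b i + d) s L (act c d z) = act c d (steps a b s L z)"
  by (induction L arbitrary: z) (simp_all add: step_act)

lemma steps_uniform:
  assumes "\<epsilon> > 0"
  shows "\<exists>\<delta>>0. \<forall>a b s a' b' s' (z :: quat) z'. norm z \<le> M \<longrightarrow> norm z' \<le> M \<longrightarrow> norm (z - z') < \<delta> \<longrightarrow>
    (\<forall>i \<in> set L. near \<delta> (a i) (b i) (s i) (a' i) (b' i) (s' i)) \<longrightarrow>
    norm (steps a b s L z - steps a' b' s' L z') < \<epsilon>"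
proof (induction L arbitrary: M)
  case Nil
  show ?case using assms by (intro exI[of _ \<epsilon>]) simp
next
  case (Cons i L)
  \<comment> \<open>A step raises the norm by its weight, at most 1, hence the bound
    \<open>M + 1\<close> for the rest of the list.\<close>
  obtain \<delta>1 where \<delta>1: "\<delta>1 > 0" "\<And>a b s a' b' s' (z :: quat) z'. norm z \<le> M + 1 \<Longrightarrow> norm z' \<le> M + 1 \<Longrightarrow> norm (z - z') < \<delta>1 \<Longrightarrow>
      (\<forall>i \<in> set L. near \<delta>1 (a i) (b i) (s i) (a' i) (b' i) (s' i)) \<Longrightarrow>
      norm (steps a b s L z - steps a' b' s' L z') < \<epsilon>"
    using Cons[of "M + 1"] by blast
  obtain \<delta>2 where \<delta>2: "\<delta>2 > 0" "\<And>a b a' b' (z :: quat) z' s s'. norm z \<le> M \<Longrightarrow> norm z' \<le> M \<Longrightarrow> norm (z - z') < \<delta>2 \<Longrightarrow>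
      near \<delta>2 a b s a' b' s' \<Longrightarrow> norm (step a b z s - step a' b' z' s') < \<delta>1"
    using step_uniform[OF \<delta>1(1), of M] by blast
  show ?case
  proof (intro exI[of _ "min \<delta>1 \<delta>2"] conjI allI impI)
    show "min \<delta>1 \<delta>2 > 0" using \<delta>1(1) \<delta>2(1) by simp
    fix a b :: "'a \<Rightarrow> nat" and s :: "'a \<Rightarrow> real" and a' b' :: "'a \<Rightarrow> nat" and s' :: "'a \<Rightarrow> real" and z z' :: quat
    assume z: "norm z \<le> M" "norm z' \<le> M" "norm (z - z') < min \<delta>1 \<delta>2"
      and near: "\<forall>i \<in> set (i # L). near (min \<delta>1 \<delta>2) (a i) (b i) (s i) (a' i) (b' i) (s' i)"
    have "near \<delta>2 (a i) (b i) (s i) (a' i) (b' i) (s' i)"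
      using near near_mono[of "min \<delta>1 \<delta>2" _ _ _ _ _ _ \<delta>2] by auto
    then have "norm (step (a i) (b i) z (s i) - step (a' i) (b' i) z' (s' i)) < \<delta>1"
      using z by (intro \<delta>2(2)) auto
    moreover have "\<forall>i \<in> set L. near \<delta>1 (a i) (b i) (s i) (a' i) (b' i) (s' i)"
      using near near_mono[of "min \<delta>1 \<delta>2" _ _ _ _ _ _ \<delta>1] by auto
    moreover have "0 \<le> s i" "s i \<le> 1" "0 \<le> s' i" "s' i \<le> 1" using near by (auto simp: near_def)
    ultimately show "norm (steps a b s (i # L) z - steps a' b' s' (i # L) z') < \<epsilon>"
      using z by (simp, intro \<delta>1(2)) (simp_all add: norm_step)
  qed
qed

end

section \<open>Colouring pairs of words boundedly\<close>

definition window_count :: "nat \<Rightarrow> nat \<Rightarrow> (nat \<Rightarrow> nat) \<Rightarrow> nat \<Rightarrow> nat" where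
  "window_count l k x g = card {i \<in> {k * l..<k * l + l}. x i = g}"

text \<open>If no letter has the majority in the window, then \<open>majority\<close> is an arbitrary letter, but \<open>weight\<close> is 0.\<close>

definition majority :: "nat \<Rightarrow> nat \<Rightarrow> (nat \<Rightarrow> nat) \<Rightarrow> nat" where
  "majority l k x = (SOME g. l < 2 * window_count l k x g)"

definition weight :: "nat \<Rightarrow> nat \<Rightarrow> (nat \<Rightarrow> nat) \<Rightarrow> real" where
  "weight l k x = max 0 (2 * real (window_count l k x (majority l k x)) / real l - 1)"

lemma majority_unique:
  assumes "l < 2 * window_count l k x g" "l < 2 * window_count l k x h"
  shows "g = h"
proof (rule ccontr)
  assume "g \<noteq> h"
  let ?A = "\<lambda>g. {i \<in> {k * l..<k * l + l}. x i = g}"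
  have "card (?A g) + card (?A h) = card (?A g \<union> ?A h)"
    using \<open>g \<noteq> h\<close> by (intro card_Un_disjoint[symmetric]) auto
  also have "\<dots> \<le> card {k * l..<k * l + l}"
    by (rule card_mono) auto
  finally show False
    using assms by (simp add: window_count_def)
qed

lemma majority_eq: "l < 2 * window_count l k x g \<Longrightarrow> majority l k x = g"
  unfolding majority_def by (rule some_equality) (auto intro: majority_unique)

lemma weight_pos_iff:
  assumes "0 < l"
  shows "0 < weight l k x \<longleftrightarrow> l < 2 * window_count l k x (majority l k x)"
proof -
  define c where "c = window_count l k x (majority l k x)"
  have "0 < weight l k x \<longleftrightarrow> 1 < 2 * real c / real l"
    by (simp add: weight_def c_def less_max_iff_disj)
  also have "\<dots> \<longleftrightarrow> real l < real (2 * c)"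
    using assms by (simp add: less_divide_eq)
  also have "\<dots> \<longleftrightarrow> l < 2 * c"
    by (rule of_nat_less_iff)
  finally show ?thesis by (simp add: c_def)
qed

lemma window_count_le: "window_count l k x g \<le> l"
proof -
  have "window_count l k x g \<le> card {k * l..<k * l + l}"
    unfolding window_count_def by (rule card_mono) auto
  then show ?thesis by simp
qed

lemma weight_bounds: "0 \<le> weight l k x" "weight l k x \<le> 1"
  using window_count_le[of l k x "majority l k x"] by (auto simp: weight_def divide_simps)

lemma window_subset:
  fixes k K l :: nat
  assumes "k < K" shows "{k * l..<k * l + l} \<subseteq> {..<K * l}"
proof -
  have "Suc k * l \<le> K * l" using assms by (intro mult_le_mono) auto
  then show ?thesis by auto
qed

lemma window_count_hamming:
  assumes "k < K"
  shows "window_count l k x g \<le> window_count l k y g + hamming (K * l) x y"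
proof -
  have "window_count l k x g \<le> card ({i \<in> {k * l..<k * l + l}. y i = g} \<union> {i. i < K * l \<and> x i \<noteq> y i})"
    unfolding window_count_def using window_subset[OF assms, of l] by (intro card_mono) auto
  also have "\<dots> \<le> window_count l k y g + hamming (K * l) x y"
    unfolding window_count_def hamming_def by (rule card_Un_le)
  finally show ?thesis .
qed

text \<open>The majority letter of x has no majority in y, so its count in x exceeds half the window
  by at most r. Thus the majority changes only where the weight is small, as the join
  permits.\<close>

lemma weight_le_small:
  assumes "0 < l" "k < K" "hamming (K * l) x y \<le> r" "majority l k x \<noteq> majority l k y"
  shows "weight l k x \<le> 2 * real r / real l"
proof (cases "0 < weight l k x")
  case True
  define g where "g = majority l k x"
  have "\<not> l < 2 * window_count l k y g"
    using majority_eq[of l k y g] assms(4) by (auto simp: g_def)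
  then have "2 * window_count l k x g \<le> l + 2 * r"
    using window_count_hamming[OF assms(2), of l x g y] assms(3) by linarith
  then have "2 * real (window_count l k x g) \<le> real l + 2 * real r"
    by (metis of_nat_add of_nat_le_iff of_nat_mult of_nat_numeral)
  then show ?thesis
    using assms(1) divide_right_mono[of "2 * real (window_count l k x g)" "real l + 2 * real r" "real l"]
    by (simp add: weight_def g_def[symmetric] add_divide_distrib)
next
  case False
  moreover have "0 \<le> 2 * real r / real l" by simp
  ultimately show ?thesis by linarith
qed

lemma weight_hamming:
  assumes "0 < l" "k < K" "hamming (K * l) x y \<le> r"
  shows "\<bar>weight l k x - weight l k y\<bar> \<le> 2 * real r / real l"
proof (cases "majority l k x = majority l k y")
  case True
  define a b where "a = window_count l k x (majority l k x)" and "b = window_count l k y (majority l k x)"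
  have "a \<le> b + r" "b \<le> a + r"
    using window_count_hamming[OF assms(2), of l x "majority l k x" y]
      window_count_hamming[OF assms(2), of l y "majority l k x" x] assms(3)
    unfolding a_def b_def hamming_commute[of "K * l" y x] by linarith+
  then have "\<bar>2 * real a - 2 * real b\<bar> \<le> 2 * real r"
    by (simp add: abs_le_iff of_nat_le_iff[symmetric, where 'a = real] del: of_nat_le_iff)
  then have "\<bar>2 * real a / real l - 2 * real b / real l\<bar> \<le> 2 * real r / real l"
    using assms(1) by (simp add: diff_divide_distrib[symmetric] abs_divide divide_right_mono)
  then show ?thesis
    unfolding weight_def True[symmetric] a_def b_def by (simp add: max_def abs_le_iff split: if_splits)
next
  case False
  have "hamming (K * l) y x \<le> r" using assms(3) by (simp add: hamming_commute)
  then have "weight l k x \<le> 2 * real r / real l" "weight l k y \<le> 2 * real r / real l"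
    using weight_le_small[OF assms False] weight_le_small[OF assms(1,2), of y x r] False by auto
  then show ?thesis
    using weight_bounds[of l k x] weight_bounds[of l k y] by linarith
qed

lemma window_count_shift:
  assumes "x \<in> words p (K * l)" "k < K" "g < p"
  shows "window_count l k ((shift p (K * l) ^^ c) x) ((g + c) mod p) = window_count l k x g"
proof -
  have "(x i + c) mod p = (g + c) mod p \<longleftrightarrow> x i = g" if "i \<in> {k * l..<k * l + l}" for i
  proof -
    have "x i < p" using assms(1) window_subset[OF assms(2), of l] that by (auto simp: words_def)
    then have "(x i + c) mod p = (g + c) mod p \<longleftrightarrow> x i mod p = g mod p"
      by (metis cong_add_rcancel_nat cong_def)
    then show ?thesis using \<open>x i < p\<close> assms(3) by simp
  qed
  then show ?thesis
    unfolding window_count_def shift_funpow[OF assms(1)] using window_subset[OF assms(2), of l]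
    by (intro arg_cong[of _ _ card]) auto
qed

lemma weight_shift:
  assumes x: "x \<in> words p (K * l)" and k: "k < K" and "0 < l"
  shows "weight l k ((shift p (K * l) ^^ c) x) = weight l k x \<and>
    (0 < weight l k x \<longrightarrow> majority l k ((shift p (K * l) ^^ c) x) = (majority l k x + c) mod p)"
proof -
  define y where "y = (shift p (K * l) ^^ c) x"
  have less: "g < p" if "0 < window_count l k x g" for g
  proof -
    have "{i \<in> {k * l..<k * l + l}. x i = g} \<noteq> {}"
      using that unfolding window_count_def by (metis card.empty less_irrefl)
    then show ?thesis
      using x window_subset[OF k, of l] by (auto simp: words_def)
  qed
  show ?thesis
  proof (cases "0 < weight l k x")
    case True
    define g where "g = majority l k x"
    have g: "l < 2 * window_count l k x g" using True weight_pos_iff[OF assms(3)] by (simp add: g_def)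
    then have "g < p" by (intro less) simp
    then have cnt: "window_count l k y ((g + c) mod p) = window_count l k x g"
      unfolding y_def by (rule window_count_shift[OF x k])
    then have maj: "majority l k y = (g + c) mod p" using g by (intro majority_eq) simp
    then have "weight l k y = weight l k x"
      unfolding weight_def maj cnt by (simp add: g_def)
    then show ?thesis using maj by (simp add: y_def g_def)
  next
    case False
    have "\<not> 0 < weight l k y"
    proof
      assume "0 < weight l k y"
      then have h: "l < 2 * window_count l k y (majority l k y)" using weight_pos_iff[OF assms(3)] by simp
      then have "{i \<in> {k * l..<k * l + l}. y i = majority l k y} \<noteq> {}"
        unfolding window_count_def by (metis card.empty mult_0_right not_less0)
      then obtain i where i: "i \<in> {k * l..<k * l + l}" "y i = majority l k y" by auto
      then have "i < K * l" using window_subset[OF k, of l] by auto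
      then have y: "majority l k y = (x i + c) mod p" and xi: "x i < p"
        using x i(2) by (auto simp: y_def shift_funpow[OF x] words_def)
      have "l < 2 * window_count l k x (x i)"
        using h unfolding y unfolding y_def window_count_shift[OF x k xi, of c] .
      then have "0 < weight l k x"
        using majority_eq[of l k x "x i"] weight_pos_iff[OF assms(3)] by simp
      then show False using False by simp
    qed
    then show ?thesis
      using False weight_bounds(1)[of l k x] weight_bounds(1)[of l k y] by (simp add: y_def)
  qed
qed

text \<open>There are m + 1 windows and at most m jumps, each charged to the window of its left end.
  A window without a charge is constant.\<close>

lemma ex_constant_window:
  assumes x: "x \<in> base_verts p (Suc m * l) m" and "0 < l"
  shows "\<exists>k < Suc m. weight l k x = 1"
proof (rule ccontr)
  assume no: "\<not> ?thesis"
  have ex: "\<exists>i \<in> jumps (Suc m * l) x. i div l = k" if k: "k < Suc m" for k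
  proof (rule ccontr)
    assume no_jump: "\<not> ?thesis"
    have const: "j < l \<Longrightarrow> x (k * l + j) = x (k * l)" for j
    proof (induction j)
      case (Suc j)
      have "k * l + Suc j \<in> {..<Suc m * l}"
        using subsetD[OF window_subset[OF k, of l], of "k * l + Suc j"] Suc.prems by simp
      moreover have "(k * l + j) div l = k"
        using Suc.prems by simp
      ultimately have "x (k * l + j) = x (Suc (k * l + j))"
        using no_jump unfolding jumps_def by auto
      then show ?case using Suc by simp
    qed simp
    have "x i = x (k * l)" if "i \<in> {k * l..<k * l + l}" for i
      using const[of "i - k * l"] that by auto
    then have "{i \<in> {k * l..<k * l + l}. x i = x (k * l)} = {k * l..<k * l + l}" by blast
    then have cnt: "window_count l k x (x (k * l)) = l" by (simp add: window_count_def)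
    then have "majority l k x = x (k * l)" using assms(2) by (intro majority_eq) simp
    then have "weight l k x = 1"
      using cnt assms(2) by (simp add: weight_def)
    then show False using no k by blast
  qed
  then have "{..<Suc m} \<subseteq> (\<lambda>i. i div l) ` jumps (Suc m * l) x"
    by blast
  then have "card {..<Suc m} \<le> card (jumps (Suc m * l) x)"
    by (meson card_image_le card_mono finite_imageI finite_jumps order_trans)
  then show False using x by (simp add: base_verts_def)
qed

lemma norm_normalise_diff:
  fixes v w :: "'a::real_normed_vector"
  assumes "1 \<le> norm v" "1 \<le> norm w"
  shows "norm (v /\<^sub>R norm v - w /\<^sub>R norm w) \<le> 2 * norm (v - w)"
proof -
  have "v /\<^sub>R norm v - w /\<^sub>R norm w = (v - w) /\<^sub>R norm w + (inverse (norm v) - inverse (norm w)) *\<^sub>R v"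
    by (simp add: algebra_simps)
  also have "norm \<dots> \<le> norm (v - w) / norm w + \<bar>inverse (norm v) - inverse (norm w)\<bar> * norm v"
    by (rule norm_triangle_le) (simp add: divide_inverse mult.commute)
  also have "\<bar>inverse (norm v) - inverse (norm w)\<bar> * norm v = \<bar>(inverse (norm v) - inverse (norm w)) * norm v\<bar>"
    by (simp add: abs_mult)
  also have "(inverse (norm v) - inverse (norm w)) * norm v = (norm w - norm v) / norm w"
  proof -
    have "norm v \<noteq> 0" "norm w \<noteq> 0" using assms by linarith+
    then show ?thesis by (simp add: field_simps)
  qed
  also have "\<bar>(norm w - norm v) / norm w\<bar> \<le> norm (v - w) / norm w"
    using norm_triangle_ineq3[of v w] by (simp add: abs_divide divide_right_mono abs_minus_commute)
  also have "norm (v - w) / norm w + norm (v - w) / norm w \<le> 2 * norm (v - w)"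
    using assms(2) mult_left_mono[OF assms(2), of "norm (v - w)"] by (simp add: divide_simps)
  finally show ?thesis by simp
qed

lemma ex_small_cells:
  fixes S :: "'a::metric_space set"
  assumes "compact S" "e > 0"
  shows "\<exists>(col :: 'a \<Rightarrow> nat) C. (\<forall>z \<in> S. col z < C) \<and> (\<forall>z \<in> S. \<forall>w \<in> S. col z = col w \<longrightarrow> dist z w < e)"
proof -
  obtain k where k: "finite k" "S \<subseteq> (\<Union>x\<in>k. ball x (e / 2))"
    using assms compact_eq_totally_bounded[of S] by (metis half_gt_zero)
  obtain f :: "'a \<Rightarrow> nat" and N where f: "f ` k = {i. i < N}" "inj_on f k"
    using finite_imp_inj_to_nat_seg[OF k(1)] by blast
  define cen where "cen z = (SOME x. x \<in> k \<and> z \<in> ball x (e / 2))" for z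
  have cen: "cen z \<in> k" "dist (cen z) z < e / 2" if "z \<in> S" for z
  proof -
    have "\<exists>x. x \<in> k \<and> z \<in> ball x (e / 2)" using that k(2) by blast
    then have "cen z \<in> k \<and> z \<in> ball (cen z) (e / 2)" unfolding cen_def by (rule someI_ex)
    then show "cen z \<in> k" "dist (cen z) z < e / 2" by auto
  qed
  have "dist z w < e" if "z \<in> S" "w \<in> S" "f (cen z) = f (cen w)" for z w
  proof -
    have "cen z = cen w" using that cen(1) f(2) by (auto dest: inj_onD)
    then show ?thesis
      using cen(2)[OF that(1)] cen(2)[OF that(2)] by (metis dist_triangle_half_r)
  qed
  moreover have "f (cen z) < N" if "z \<in> S" for z
    using f(1) cen(1)[OF that] by auto
  ultimately show ?thesis
    by (intro exI[of _ "\<lambda>z. f (cen z)"] exI[of _ N]) auto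
qed

lemma ex_root_of_unity:
  assumes "0 < q"
  shows "\<exists>\<zeta>. \<zeta> ^ q = 1 \<and> cmod \<zeta> = 1 \<and> (\<forall>d. \<not> q dvd d \<longrightarrow> \<zeta> ^ d \<noteq> 1)"
proof -
  define \<zeta> where "\<zeta> = cis (2 * pi / real q)"
  have "real q * (2 * pi / real q) = 2 * pi" using assms by simp
  moreover have "\<zeta> ^ q = cis (real q * (2 * pi / real q))" unfolding \<zeta>_def by (rule Complex.DeMoivre)
  ultimately have "\<zeta> ^ q = 1" by (simp only: cis_2pi)
  moreover have "q dvd d" if "\<zeta> ^ d = 1" for d
  proof -
    have "cos (real d * (2 * pi / real q)) = 1"
      using arg_cong[OF that, of Re] by (simp add: \<zeta>_def Complex.DeMoivre)
    then obtain n :: int where "real d * (2 * pi / real q) = of_int n * 2 * pi"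
      unfolding cos_one_2pi_int by blast
    then have "real d = of_int n * real q"
      using assms by (simp add: field_simps)
    then have "int d = n * int q"
      by (metis of_int_eq_iff of_int_mult of_int_of_nat_eq)
    then show ?thesis by (metis dvd_triv_right int_dvd_int_iff)
  qed
  moreover have "cmod \<zeta> = 1" by (simp add: \<zeta>_def)
  ultimately show ?thesis by blast
qed

text \<open>The cells of the sphere are chosen before m: a larger m adds join coordinates but
  changes neither the sphere nor the displacement \<open>e\<close>.\<close>

theorem product_bounded:
  fixes q :: nat
  assumes "odd q"
  shows "\<exists>C. \<forall>m. \<exists>n c0. m < n \<and>
    (\<forall>x \<in> base_verts 2 n m. \<forall>y \<in> base_verts q n m. c0 x y < (C :: nat)) \<and>
    (\<forall>x \<in> base_verts 2 n m. \<forall>y \<in> base_verts q n m. \<forall>x' \<in> base_verts 2 n m. \<forall>y' \<in> base_verts q n m. \<forall>c d.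
      hamming n x' ((shift 2 n ^^ c) x) \<le> 3 * m \<longrightarrow> hamming n y' ((shift q n ^^ d) y) \<le> 3 * m \<longrightarrow>
      odd c \<longrightarrow> \<not> q dvd d \<longrightarrow> c0 x y \<noteq> c0 x' y')"
proof -
  have q: "0 < q" using assms by (simp add: odd_pos)
  obtain \<zeta> where \<zeta>: "\<zeta> ^ q = 1" "cmod \<zeta> = 1" "\<And>d. \<not> q dvd d \<Longrightarrow> \<zeta> ^ d \<noteq> 1"
    using ex_root_of_unity[OF q] by blast
  have "cnj \<zeta> * \<zeta> = 1"
    using complex_norm_square[of \<zeta>] \<zeta>(2) by (simp add: mult.commute)
  then obtain F :: "quat \<Rightarrow> quat" where F: "continuous_on (cball 0 1) F \<and> (\<forall>z \<in> cball 0 1. norm (F z) = 1) \<and>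
      (\<forall>z. norm z = 1 \<longrightarrow> F (- fst z, snd z) = (- fst (F z), snd (F z)) \<and>
      F (fst z, \<zeta> * snd z) = (fst (F z), \<zeta> * snd (F z)))"
    using exE[OF equivariant_extension[OF assms \<zeta>(1)]] by metis
  interpret equivariant_filling F \<zeta> q
  proof
    show "continuous_on (cball 0 1) F" using F by (rule conjunct1)
    show "norm (F z) = 1" if "norm z \<le> 1" for z using F that by simp
    show "F (- fst z, snd z) = (- fst (F z), snd (F z))" "F (fst z, \<zeta> * snd z) = (fst (F z), \<zeta> * snd (F z))"
      if "norm z = 1" for z using F that by blast+
  qed (fact \<zeta>)+
  \<comment> \<open>A lower bound for how far elements nontrivial in both factors move unit vectors:
    the sign contributes the factor 2 on the first coordinate, the root of unity |\<zeta>^d - 1| on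
    the second.\<close>
  define e where "e = Min (insert 2 ((\<lambda>d. cmod (\<zeta> ^ d - 1)) ` {d. d < q \<and> \<not> q dvd d}))"
  have ed: "e \<le> cmod (\<zeta> ^ d - 1)" if "\<not> q dvd d" for d
  proof -
    have fin: "finite (insert 2 ((\<lambda>d. cmod (\<zeta> ^ d - 1)) ` {d. d < q \<and> \<not> q dvd d}))" by simp
    have "\<zeta> ^ (d mod q) = \<zeta> ^ d"
      by (metis \<zeta>(1) mod_mult_div_eq mult.right_neutral power_add power_mult power_one)
    moreover have "d mod q < q" "\<not> q dvd d mod q" using that q by (simp_all add: dvd_mod_iff)
    ultimately show "e \<le> cmod (\<zeta> ^ d - 1)"
      unfolding e_def using fin by (intro Min_le) (auto intro!: image_eqI[of _ _ "d mod q"])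
  qed
  have e0: "0 < e" "e \<le> 2"
  proof -
    have fin: "finite (insert 2 ((\<lambda>d. cmod (\<zeta> ^ d - 1)) ` {d. d < q \<and> \<not> q dvd d}))" by simp
    show "0 < e" unfolding e_def using \<zeta>(3) by (subst Min_gr_iff[OF fin]) auto
    show "e \<le> 2" unfolding e_def using fin by (intro Min_le) auto
  qed
  have free: "e * norm z \<le> norm (act c d z - z)" if "odd c" "\<not> q dvd d" for c d z
  proof -
    obtain u v where z: "z = (u, v)" by (cases z)
    have "act c d z - z = (- 2 * u, (\<zeta> ^ d - 1) * v)"
      using that(1) by (simp add: act_def z algebra_simps)
    then have "norm (act c d z - z) = sqrt ((2 * cmod u)\<^sup>2 + (cmod (\<zeta> ^ d - 1) * cmod v)\<^sup>2)"
      by (simp add: norm_Pair norm_mult)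
    moreover have "(e * cmod u)\<^sup>2 \<le> (2 * cmod u)\<^sup>2" "(e * cmod v)\<^sup>2 \<le> (cmod (\<zeta> ^ d - 1) * cmod v)\<^sup>2"
      using e0 ed[OF that(2)] by (intro power_mono mult_right_mono mult_nonneg_nonneg; simp)+
    moreover have "e * norm z = sqrt ((e * cmod u)\<^sup>2 + (e * cmod v)\<^sup>2)"
      using e0 by (simp add: z norm_Pair power_mult_distrib real_sqrt_mult flip: distrib_left)
    ultimately show ?thesis by simp
  qed
  obtain col :: "quat \<Rightarrow> nat" and C where "\<forall>z \<in> sphere 0 1. col z < C"
      "\<forall>z \<in> sphere 0 1. \<forall>w \<in> sphere 0 1. col z = col w \<longrightarrow> dist z w < e / 2"
    using ex_small_cells[of "sphere (0 :: quat) 1" "e / 2"] half_gt_zero[OF e0(1)] compact_sphere by blast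
  then have col: "\<And>z. norm z = 1 \<Longrightarrow> col z < C"
      "\<And>z w. norm z = 1 \<Longrightarrow> norm w = 1 \<Longrightarrow> col z = col w \<Longrightarrow> dist z w < e / 2"
    by simp_all
  show ?thesis
  proof (rule exI[of _ C], rule allI)
    fix m :: nat
    define L where "L = List.product [0..<Suc m] [0..<Suc m]"
    obtain \<delta> where \<delta>: "\<delta> > 0" "\<And>a b s a' b' s' (z :: quat) z'. norm z \<le> 0 \<Longrightarrow> norm z' \<le> 0 \<Longrightarrow> norm (z - z') < \<delta> \<Longrightarrow>
        (\<forall>i \<in> set L. near \<delta> (a i) (b i) (s i) (a' i) (b' i) (s' i)) \<Longrightarrow>
        norm (steps a b s L z - steps a' b' s' L z') < e / 4"
      using steps_uniform[of "e / 4" 0 L] e0 by auto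
    \<comment> \<open>Changing 3m letters alters a weight by at most 6m/l, hence a product of two
      weights by at most 12m/l.\<close>
    obtain l where l: "12 * real m / \<delta> < real l" using reals_Archimedean2 by blast
    moreover have "0 \<le> 12 * real m / \<delta>" using \<delta>(1) by simp
    ultimately have "0 < real l" by linarith
    then have "0 < l" by simp
    define n where "n = Suc m * l"
    \<comment> \<open>The product vanishes as soon as one of the windows has no majority, which is
      where the group element would be arbitrary.\<close>
    define s where "s x y i = weight l (fst i) x * weight l (snd i) y" for x y and i :: "nat \<times> nat"
    define P where "P x y = steps (\<lambda>i. majority l (fst i) x) (\<lambda>i. majority l (snd i) y) (s x y) L 0" for x y
    have small: "2 * real (3 * m) / real l + 2 * real (3 * m) / real l < \<delta>"
      using l \<delta>(1) \<open>0 < l\<close> by (simp add: field_simps)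
    have small': "2 * real (3 * m) / real l < \<delta>"
    proof -
      have "0 \<le> 2 * real (3 * m) / real l" by simp
      then show ?thesis using small by linarith
    qed
    \<comment> \<open>Two constant windows give a coordinate of weight 1, and the norm of P is the
      total weight. So P can be normalised safely.\<close>
    have normP: "1 \<le> norm (P x y)" if x: "x \<in> base_verts 2 n m" and y: "y \<in> base_verts q n m" for x y
    proof -
      obtain k k' where k: "k < Suc m" "weight l k x = 1" "k' < Suc m" "weight l k' y = 1"
        using ex_constant_window[OF x[unfolded n_def] \<open>0 < l\<close>] ex_constant_window[OF y[unfolded n_def] \<open>0 < l\<close>] by blast
      have nonneg: "0 \<le> s x y i" for i
        by (simp add: s_def weight_bounds)
      have mem: "(k, k') \<in> set L" using k by (simp add: L_def del: upt_Suc)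
      have "1 = s x y (k, k')" by (simp add: s_def k)
      also have "\<dots> \<le> sum_list (map (s x y) L)"
        using mem nonneg by (intro member_le_sum_list) auto
      also have "\<dots> = norm (P x y)"
        unfolding P_def using nonneg by (simp add: norm_steps)
      finally show ?thesis .
    qed
    have nearP: "norm (P x' y' - act c d (P x y)) < e / 4"
      if xy: "x \<in> base_verts 2 n m" "y \<in> base_verts q n m"
        and h: "hamming n x' ((shift 2 n ^^ c) x) \<le> 3 * m" "hamming n y' ((shift q n ^^ d) y) \<le> 3 * m"
      for x y x' y' c d
    proof -
      have "act c d (P x y) = steps (\<lambda>i. majority l (fst i) x + c) (\<lambda>i. majority l (snd i) y + d) (s x y) L 0"
        using steps_act[of "\<lambda>i. majority l (fst i) x" c "\<lambda>i. majority l (snd i) y" d "s x y" L 0]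
        by (simp add: P_def)
      moreover have nr: "near \<delta> (majority l (fst i) x') (majority l (snd i) y') (s x' y' i)
          (majority l (fst i) x + c) (majority l (snd i) y + d) (s x y i)" if "i \<in> set L" for i
      proof -
        obtain k k' where i: "i = (k, k')" and k: "k < Suc m" "k' < Suc m"
          using \<open>i \<in> set L\<close> by (auto simp: L_def simp del: upt_Suc)
        define x1 y1 where "x1 = (shift 2 n ^^ c) x" and "y1 = (shift q n ^^ d) y"
        have wx: "weight l k x1 = weight l k x" "0 < weight l k x \<longrightarrow> majority l k x1 = (majority l k x + c) mod 2"
          using weight_shift[of x 2 "Suc m" l k c] xy k \<open>0 < l\<close> by (auto simp: x1_def n_def base_verts_def)
        have wy: "weight l k' y1 = weight l k' y" "0 < weight l k' y \<longrightarrow> majority l k' y1 = (majority l k' y + d) mod q"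
          using weight_shift[of y q "Suc m" l k' d] xy k \<open>0 < l\<close> by (auto simp: y1_def n_def base_verts_def)
        let ?r = "2 * real (3 * m) / real l"
        have hx: "\<bar>weight l k x' - weight l k x\<bar> \<le> ?r"
          using weight_hamming[OF \<open>0 < l\<close> k(1) h(1)[unfolded n_def]] wx(1) by (simp add: x1_def n_def)
        have hy: "\<bar>weight l k' y' - weight l k' y\<bar> \<le> ?r"
          using weight_hamming[OF \<open>0 < l\<close> k(2) h(2)[unfolded n_def]] wy(1) by (simp add: y1_def n_def)
        note b = weight_bounds[of l k x] weight_bounds[of l k x'] weight_bounds[of l k' y] weight_bounds[of l k' y']
        have "s x' y' i - s x y i = (weight l k x' - weight l k x) * weight l k' y' + weight l k x * (weight l k' y' - weight l k' y)"
          by (simp add: s_def i algebra_simps)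
        moreover have "\<bar>(weight l k x' - weight l k x) * weight l k' y'\<bar> \<le> ?r"
          using mult_mono[OF hx b(8)] b by (simp add: abs_mult)
        moreover have "\<bar>weight l k x * (weight l k' y' - weight l k' y)\<bar> \<le> ?r"
          using mult_mono[OF b(2) hy] b by (simp add: abs_mult)
        ultimately have diff: "\<bar>s x' y' i - s x y i\<bar> < \<delta>"
          using small by linarith
        have prod_le: "s u v i \<le> weight l k u" "s u v i \<le> weight l k' v" for u v
          using weight_bounds[of l k u] weight_bounds[of l k' v]
          by (simp_all add: s_def i mult_left_le mult_left_le_one_le mult.commute)
        have bounds: "0 \<le> s u v i \<and> s u v i \<le> 1" for u v
          using weight_bounds[of l k u] weight_bounds[of l k' v] prod_le(1)[of u v] by (simp add: s_def i)
        have "majority l k x' mod 2 = (majority l k x + c) mod 2 \<and> majority l k' y' mod q = (majority l k' y + d) mod q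
          \<or> s x' y' i < \<delta> \<and> s x y i < \<delta>"
        proof (cases "majority l k x' = majority l k x1 \<and> majority l k' y' = majority l k' y1")
          case True
          show ?thesis
          proof (cases "0 < weight l k x \<and> 0 < weight l k' y")
            case True
            then show ?thesis
              using wx wy \<open>majority l k x' = majority l k x1 \<and> _\<close> by simp
          next
            case False
            then have "s x y i = 0"
              using b by (auto simp: s_def i less_le)
            then show ?thesis using diff \<delta>(1) by (simp add: abs_less_iff)
          qed
        next
          case False
          have "s x' y' i \<le> ?r \<and> s x y i \<le> ?r"
          proof (cases "majority l k x' = majority l k x1")
            case True
            with False have ne: "majority l k' y' \<noteq> majority l k' y1" by simp
            have "weight l k' y' \<le> ?r" "weight l k' y1 \<le> ?r"
              using weight_le_small[OF \<open>0 < l\<close> k(2) h(2)[unfolded n_def]] ne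
                weight_le_small[OF \<open>0 < l\<close> k(2), of y1 y' "3 * m"] h(2)
              by (simp_all add: y1_def n_def hamming_commute)
            then show ?thesis
              using prod_le(2)[of x' y'] prod_le(2)[of x y] wy(1) by linarith
          next
            case False
            have "weight l k x' \<le> ?r" "weight l k x1 \<le> ?r"
              using weight_le_small[OF \<open>0 < l\<close> k(1) h(1)[unfolded n_def]] False
                weight_le_small[OF \<open>0 < l\<close> k(1), of x1 x' "3 * m"] h(1)
              by (simp_all add: x1_def n_def hamming_commute)
            then show ?thesis
              using prod_le(1)[of x' y'] prod_le(1)[of x y] wx(1) by linarith
          qed
          then show ?thesis using small' by linarith
        qed
        then show ?thesis
          unfolding near_def using diff bounds by (simp add: i)
      qed
      ultimately show ?thesis
        unfolding P_def[of x' y'] by (elim ssubst, intro \<delta>(2) ballI) (use nr \<delta>(1) in simp_all)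
    qed
    define c0 where "c0 x y = col (P x y /\<^sub>R norm (P x y))" for x y
    have unit: "norm (P x y /\<^sub>R norm (P x y)) = 1" if "x \<in> base_verts 2 n m" "y \<in> base_verts q n m" for x y
      using normP[OF that] by (auto simp: divide_simps)
    have "c0 x y \<noteq> c0 x' y'"
      if xy: "x \<in> base_verts 2 n m" "y \<in> base_verts q n m" "x' \<in> base_verts 2 n m" "y' \<in> base_verts q n m"
        and h: "hamming n x' ((shift 2 n ^^ c) x) \<le> 3 * m" "hamming n y' ((shift q n ^^ d) y) \<le> 3 * m"
        and cd: "odd c" "\<not> q dvd d" for x y x' y' c d
    proof
      assume "c0 x y = c0 x' y'"
      let ?u = "P x y /\<^sub>R norm (P x y)" and ?u' = "P x' y' /\<^sub>R norm (P x' y')"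
      have 1: "norm (?u' - ?u) < e / 2"
        using col(2)[OF unit unit] xy \<open>c0 x y = c0 x' y'\<close> by (simp add: c0_def dist_norm norm_minus_commute)
      \<comment> \<open>Normalising at most doubles the distance, hence the accuracy e/4 for P.
        Equal colours would put \<open>?u'\<close> within e/2 of both \<open>?u\<close> and its
        translate, which are at least e apart.\<close>
      have "norm (?u' - act c d (P x y) /\<^sub>R norm (act c d (P x y))) \<le> 2 * norm (P x' y' - act c d (P x y))"
        using normP xy by (intro norm_normalise_diff) auto
      then have 2: "norm (?u' - act c d ?u) < e / 2"
        using nearP[OF xy(1,2) h] by (simp add: act_scaleR)
      have "e * norm ?u \<le> norm (act c d ?u - ?u)" by (rule free[OF cd])
      also have "\<dots> \<le> norm (?u' - ?u) + norm (?u' - act c d ?u)"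
        using norm_triangle_ineq4[of "?u' - ?u" "?u' - act c d ?u"] by simp
      finally show False using 1 2 unit[OF xy(1,2)] by simp
    qed
    moreover have "m < n"
    proof -
      have "Suc m * 1 \<le> n" unfolding n_def using \<open>0 < l\<close> by (intro mult_le_mono) auto
      then show ?thesis by simp
    qed
    moreover have "c0 x y < C" if "x \<in> base_verts 2 n m" "y \<in> base_verts q n m" for x y
      using col(1)[OF unit[OF that]] by (simp add: c0_def)
    ultimately show "\<exists>n c0. m < n \<and>
      (\<forall>x \<in> base_verts 2 n m. \<forall>y \<in> base_verts q n m. c0 x y < C) \<and>
      (\<forall>x \<in> base_verts 2 n m. \<forall>y \<in> base_verts q n m. \<forall>x' \<in> base_verts 2 n m. \<forall>y' \<in> base_verts q n m. \<forall>c d.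
      hamming n x' ((shift 2 n ^^ c) x) \<le> 3 * m \<longrightarrow> hamming n y' ((shift q n ^^ d) y) \<le> 3 * m \<longrightarrow>
      odd c \<longrightarrow> \<not> q dvd d \<longrightarrow> c0 x y \<noteq> c0 x' y')"
      by blast
  qed
qed

section \<open>A local four-colouring of the diagonal grid\<close>

type_synonym grid = "int \<times> int"

text \<open>Comparing two positions builds in translation invariance, so that the rule can be
  evaluated on a patch instead of the whole grid.\<close>

definition depends_locally :: "int \<Rightarrow> ((grid \<Rightarrow> 'a) \<Rightarrow> grid \<Rightarrow> 'b) \<Rightarrow> bool" where
  "depends_locally R \<Phi> \<longleftrightarrow> (\<forall>f f' p p'.
     (\<forall>d. \<bar>fst d\<bar> \<le> R \<longrightarrow> \<bar>snd d\<bar> \<le> R \<longrightarrow> f (p + d) = f' (p' + d)) \<longrightarrow> \<Phi> f p = \<Phi> f' p')"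

lemma depends_locallyD:
  "depends_locally R \<Phi> \<Longrightarrow> (\<And>d. \<bar>fst d\<bar> \<le> R \<Longrightarrow> \<bar>snd d\<bar> \<le> R \<Longrightarrow> f (p + d) = f' (p' + d)) \<Longrightarrow> \<Phi> f p = \<Phi> f' p'"
  unfolding depends_locally_def by blast

lemma depends_locally_mono: "depends_locally R \<Phi> \<Longrightarrow> R \<le> R' \<Longrightarrow> depends_locally R' \<Phi>"
  unfolding depends_locally_def by (meson order_trans)

lemma depends_locally_comp:
  assumes "depends_locally R \<Phi>" "depends_locally R \<Psi>"
    and G: "\<And>a a' b b' p p'. (\<And>d. \<bar>fst d\<bar> \<le> S \<Longrightarrow> \<bar>snd d\<bar> \<le> S \<Longrightarrow> a (p + d) = a' (p' + d)) \<Longrightarrow>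
      (\<And>d. \<bar>fst d\<bar> \<le> S \<Longrightarrow> \<bar>snd d\<bar> \<le> S \<Longrightarrow> b (p + d) = b' (p' + d)) \<Longrightarrow> G a b p = G a' b' p'"
  shows "depends_locally (R + S) (\<lambda>f. G (\<Phi> f) (\<Psi> f))"
  unfolding depends_locally_def
proof (intro allI impI)
  fix f f' :: "grid \<Rightarrow> 'a" and p p'
  assume eq: "\<forall>d. \<bar>fst d\<bar> \<le> R + S \<longrightarrow> \<bar>snd d\<bar> \<le> R + S \<longrightarrow> f (p + d) = f' (p' + d)"
  have "f ((p + d) + d') = f' ((p' + d) + d')"
    if "\<bar>fst d\<bar> \<le> S" "\<bar>snd d\<bar> \<le> S" "\<bar>fst d'\<bar> \<le> R" "\<bar>snd d'\<bar> \<le> R" for d d'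
    using spec[OF eq, of "d + d'"] that by (simp add: add.assoc)
  then show "G (\<Phi> f) (\<Psi> f) p = G (\<Phi> f') (\<Psi> f') p'"
    by (intro G depends_locallyD[OF assms(1)] depends_locallyD[OF assms(2)])
qed

section \<open>Greedy reduction to five colours\<close>

definition nbrs :: "grid set" where
  "nbrs = {(1, 1), (1, -1), (-1, 1), (-1, -1)}"

definition proper :: "(grid \<Rightarrow> nat) \<Rightarrow> bool" where
  "proper g \<longleftrightarrow> (\<forall>p. \<forall>d \<in> nbrs. g p \<noteq> g (p + d))"

lemma card_nbrs: "card nbrs = 4" "finite nbrs"
  by (simp_all add: nbrs_def)

lemma uminus_nbrs: "d \<in> nbrs \<Longrightarrow> - d \<in> nbrs"
  by (auto simp: nbrs_def)

definition recolour :: "nat \<Rightarrow> (grid \<Rightarrow> nat) \<Rightarrow> grid \<Rightarrow> nat" where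
  "recolour \<gamma> g p = (if g p = \<gamma> then LEAST c. \<forall>d \<in> nbrs. c \<noteq> g (p + d) else g p)"

lemma free_colour:
  fixes g :: "grid \<Rightarrow> nat" and p d :: grid
  shows "\<exists>c\<le>4. \<forall>d \<in> nbrs. c \<noteq> g (p + d)"
proof -
  have "card ((\<lambda>d. g (p + d)) ` nbrs) < card {..4 :: nat}"
    using card_image_le[OF card_nbrs(2), of "\<lambda>d. g (p + d)"] by (simp add: card_nbrs)
  then have "\<not> {..4} \<subseteq> (\<lambda>d. g (p + d)) ` nbrs"
    by (meson card_mono card_nbrs(2) finite_imageI linorder_not_less)
  then show ?thesis by auto
qed

lemma least_free:
  fixes g :: "grid \<Rightarrow> nat" and p d :: grid
  defines "c \<equiv> LEAST c. \<forall>d \<in> nbrs. c \<noteq> g (p + d)"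
  shows "d \<in> nbrs \<Longrightarrow> c \<noteq> g (p + d)" "c \<le> 4" "c' < c \<Longrightarrow> \<exists>d \<in> nbrs. c' = g (p + d)"
proof -
  obtain k where k: "k \<le> 4" "\<forall>d \<in> nbrs. k \<noteq> g (p + d)" using free_colour by blast
  have "\<forall>d \<in> nbrs. c \<noteq> g (p + d)" unfolding c_def by (rule LeastI) (rule k(2))
  then show "d \<in> nbrs \<Longrightarrow> c \<noteq> g (p + d)" by blast
  have "c \<le> k" unfolding c_def by (rule Least_le) (rule k(2))
  then show "c \<le> 4" using k(1) by simp
  show "c' < c \<Longrightarrow> \<exists>d \<in> nbrs. c' = g (p + d)" unfolding c_def using not_less_Least by blast
qed

text \<open>A colour class is independent, so two neighbours are never recoloured
  simultaneously.\<close>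

lemma proper_recolour:
  assumes "proper g" shows "proper (recolour \<gamma> g)"
  unfolding proper_def
proof (intro allI ballI)
  fix p d assume d: "d \<in> nbrs"
  have "g p \<noteq> g (p + d)" using assms d unfolding proper_def by blast
  moreover have "(LEAST c. \<forall>e \<in> nbrs. c \<noteq> g ((p + d) + e)) \<noteq> g ((p + d) + (- d))"
    using least_free(1)[OF uminus_nbrs[OF d], of g "p + d"] .
  ultimately show "recolour \<gamma> g p \<noteq> recolour \<gamma> g (p + d)"
    using least_free(1)[OF d, of g p] by (auto simp: recolour_def)
qed

lemma fold_recolour:
  assumes "proper g"
  shows "proper (fold recolour L g) \<and> range (fold recolour L g) \<subseteq> {..4} \<union> (range g - set L)"
  using assms
proof (induction L arbitrary: g)
  case (Cons \<gamma> L)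
  have pr: "proper (recolour \<gamma> g)" using Cons.prems by (intro proper_recolour)
  have r: "range (recolour \<gamma> g) \<subseteq> {..4} \<union> (range g - {\<gamma>})"
    using least_free(2)[of g] by (auto simp: recolour_def)
  have "range (fold recolour L (recolour \<gamma> g)) \<subseteq> {..4} \<union> (range g - set (\<gamma> # L))"
  proof -
    have "range (fold recolour L (recolour \<gamma> g)) \<subseteq> {..4} \<union> (range (recolour \<gamma> g) - set L)"
      using Cons.IH[OF pr] by blast
    then show ?thesis using r by auto
  qed
  then show ?case using Cons.IH[OF pr] by simp
qed auto

text \<open>The last round treats colour 4 itself: a position ends up with 4 only if its four
  neighbours carry 0, 1, 2 and 3, each once.\<close>

definition five_colour :: "nat \<Rightarrow> (grid \<Rightarrow> nat) \<Rightarrow> grid \<Rightarrow> nat" where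
  "five_colour C f = recolour 4 (fold recolour [5..<C] f)"

lemma five_colour:
  assumes "proper f" "\<And>p. f p < C"
  shows "proper (five_colour C f)" "five_colour C f p \<le> 4"
    and "five_colour C f p = 4 \<Longrightarrow> inj_on (\<lambda>d. five_colour C f (p + d)) nbrs"
    and "five_colour C f p = 4 \<Longrightarrow> d \<in> nbrs \<Longrightarrow> five_colour C f (p + d) < 4"
proof -
  define h where "h = fold recolour [5..<C] f"
  have h: "proper h" using fold_recolour[OF assms(1)] by (simp add: h_def)
  have h4: "h p \<le> 4" for p
  proof -
    have "h p \<in> {..4} \<union> (range f - set [5..<C])"
      using fold_recolour[OF assms(1), of "[5..<C]"] unfolding h_def by blast
    then show ?thesis using assms(2) by fastforce
  qed
  have g: "five_colour C f = recolour 4 h" by (simp add: five_colour_def h_def)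
  show "proper (five_colour C f)" unfolding g by (rule proper_recolour[OF h])
  show "five_colour C f p \<le> 4" using h4 least_free(2)[of h] by (simp add: g recolour_def)
  assume 4: "five_colour C f p = 4"
  then have hp: "h p = 4" and least: "(LEAST c. \<forall>d \<in> nbrs. c \<noteq> h (p + d)) = 4"
    by (auto simp: g recolour_def split: if_splits)
  have hn: "h (p + d) \<noteq> 4" if "d \<in> nbrs" for d
    using h that hp[symmetric] unfolding proper_def by metis
  have gh: "five_colour C f (p + d) = h (p + d)" if "d \<in> nbrs" for d
    using hn[OF that] by (simp add: g recolour_def)
  then show "d \<in> nbrs \<Longrightarrow> five_colour C f (p + d) < 4"
    using hn[of d] h4[of "p + d"] by simp
  have "{..<4} \<subseteq> (\<lambda>d. h (p + d)) ` nbrs"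
    using least_free(3)[of _ h p] least by auto
  then have "card {..<4 :: nat} \<le> card ((\<lambda>d. h (p + d)) ` nbrs)"
    by (intro card_mono) (simp_all add: card_nbrs)
  then have "card ((\<lambda>d. h (p + d)) ` nbrs) = card nbrs"
    using card_image_le[OF card_nbrs(2), of "\<lambda>d. h (p + d)"] by (simp add: card_nbrs)
  then have "inj_on (\<lambda>d. h (p + d)) nbrs"
    by (rule eq_card_imp_inj_on[OF card_nbrs(2)])
  then show "inj_on (\<lambda>d. five_colour C f (p + d)) nbrs"
    using gh by (simp add: inj_on_def)
qed

section \<open>Recolouring 4-cycles of the grid\<close>

definition block :: "grid set" where
  "block = {(0, 0), (1, 1), (1, -1), (2, 0)}"

definition block_colouring :: "(grid \<Rightarrow> nat) \<Rightarrow> (grid \<Rightarrow> nat) \<Rightarrow> bool" where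
  "block_colouring u \<nu> \<longleftrightarrow> (\<forall>d \<in> block. \<nu> d < 4 \<and>
     (\<forall>e \<in> nbrs. \<nu> d \<noteq> (if d + e \<in> block then \<nu> (d + e) else u (d + e))))"

lemma ex_two_free: "\<exists>a b. a \<noteq> b \<and> a < 4 \<and> b < 4 \<and> a \<noteq> x \<and> a \<noteq> y \<and> b \<noteq> x \<and> b \<noteq> (y :: nat)"
proof -
  have "card {x, y} \<le> 2" by (simp add: card_insert_if)
  then have "2 \<le> card ({..<4} - {x, y})"
    using diff_card_le_card_Diff[of "{x, y}" "{..<4}"] by simp
  then obtain S where "S \<subseteq> {..<4} - {x, y}" "card S = 2" by (meson obtain_subset_with_card_n)
  then show ?thesis by (auto simp: card_2_iff)
qed

text \<open>A 4-cycle is 2-choosable, and every vertex of a block has two neighbours outside it.\<close>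

lemma cycle_choosable:
  assumes "a1 \<noteq> a2" "b1 \<noteq> b2" "c1 \<noteq> c2" "d1 \<noteq> d2"
  shows "\<exists>a b c d. (a = a1 \<or> a = a2) \<and> (b = b1 \<or> b = b2) \<and> (c = c1 \<or> c = c2) \<and> (d = d1 \<or> d = d2) \<and>
    a \<noteq> b \<and> a \<noteq> c \<and> d \<noteq> b \<and> d \<noteq> c"
proof -
  have choose: "\<exists>x. (x = u \<or> x = v) \<and> x \<noteq> b \<and> x \<noteq> c" if "u \<noteq> v" "{b, c} \<noteq> {u, v}" for u v b c :: 'a
    using that by (auto simp: doubleton_eq_iff)
  have "\<exists>b c. (b = b1 \<or> b = b2) \<and> (c = c1 \<or> c = c2) \<and> {b, c} \<noteq> {a1, a2} \<and> {b, c} \<noteq> {d1, d2}"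
  proof (cases "{b1, b2} \<inter> {c1, c2} = {}")
    case False
    then obtain x where x: "x = b1 \<or> x = b2" "x = c1 \<or> x = c2" by auto
    have "{x, x} \<noteq> {a1, a2}" "{x, x} \<noteq> {d1, d2}"
      using assms(1,4) by (auto simp: doubleton_eq_iff)
    then show ?thesis using x by blast
  next
    case True
    then have "{b1, c1} \<noteq> {b1, c2}" "{b1, c1} \<noteq> {b2, c1}" "{b1, c2} \<noteq> {b2, c1}"
      using assms by (auto simp: doubleton_eq_iff)
    then consider "{b1, c1} \<noteq> {a1, a2}" "{b1, c1} \<noteq> {d1, d2}" | "{b1, c2} \<noteq> {a1, a2}" "{b1, c2} \<noteq> {d1, d2}"
      | "{b2, c1} \<noteq> {a1, a2}" "{b2, c1} \<noteq> {d1, d2}"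
      by metis
    then show ?thesis by cases blast+
  qed
  then obtain b c where bc: "b = b1 \<or> b = b2" "c = c1 \<or> c = c2" "{b, c} \<noteq> {a1, a2}" "{b, c} \<noteq> {d1, d2}"
    by blast
  show ?thesis
    using choose[OF assms(1) bc(3)] choose[OF assms(4) bc(4)] bc(1,2) by blast
qed

lemma ex_block_colouring: "\<exists>\<nu>. block_colouring u \<nu>"
proof -
  obtain a1 a2 where a: "a1 \<noteq> a2" "a1 < 4" "a2 < 4" "a1 \<noteq> u (-1, 1)" "a1 \<noteq> u (-1, -1)" "a2 \<noteq> u (-1, 1)" "a2 \<noteq> u (-1, -1)"
    using ex_two_free by metis
  obtain b1 b2 where b: "b1 \<noteq> b2" "b1 < 4" "b2 < 4" "b1 \<noteq> u (2, 2)" "b1 \<noteq> u (0, 2)" "b2 \<noteq> u (2, 2)" "b2 \<noteq> u (0, 2)"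
    using ex_two_free by metis
  obtain c1 c2 where c: "c1 \<noteq> c2" "c1 < 4" "c2 < 4" "c1 \<noteq> u (2, -2)" "c1 \<noteq> u (0, -2)" "c2 \<noteq> u (2, -2)" "c2 \<noteq> u (0, -2)"
    using ex_two_free by metis
  obtain d1 d2 where d: "d1 \<noteq> d2" "d1 < 4" "d2 < 4" "d1 \<noteq> u (3, 1)" "d1 \<noteq> u (3, -1)" "d2 \<noteq> u (3, 1)" "d2 \<noteq> u (3, -1)"
    using ex_two_free by metis
  obtain x y z w where x: "x = a1 \<or> x = a2" and y: "y = b1 \<or> y = b2" and z: "z = c1 \<or> z = c2" and w: "w = d1 \<or> w = d2"
    and ne: "x \<noteq> y" "x \<noteq> z" "w \<noteq> y" "w \<noteq> z"
    using cycle_choosable[OF a(1) b(1) c(1) d(1)] by blast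
  have ok: "x < 4" "y < 4" "z < 4" "w < 4" "x \<noteq> u (-1, 1)" "x \<noteq> u (-1, -1)" "y \<noteq> u (2, 2)" "y \<noteq> u (0, 2)"
      "z \<noteq> u (2, -2)" "z \<noteq> u (0, -2)" "w \<noteq> u (3, 1)" "w \<noteq> u (3, -1)"
    using x y z w a b c d by auto
  show ?thesis
    by (rule exI[of _ "\<lambda>d. if d = (0, 0) then x else if d = (1, 1) then y else if d = (1, -1) then z else w"])
      (use ok ne in \<open>simp add: block_colouring_def block_def nbrs_def zero_prod_def\<close>)
qed

definition fill :: "(grid \<Rightarrow> nat) \<Rightarrow> grid \<Rightarrow> nat" where
  "fill u = (SOME \<nu>. block_colouring u \<nu>)"

lemma block_colouring_fill: "block_colouring u (fill u)"
  unfolding fill_def by (rule someI_ex[OF ex_block_colouring])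

text \<open>The predicate \<open>block_colouring u\<close> reads u only at outer neighbours of the
  block, within distance 3, and equal predicates lead to equal choices.\<close>

lemma fill_cong:
  assumes "\<And>d. \<bar>fst d\<bar> \<le> 3 \<Longrightarrow> \<bar>snd d\<bar> \<le> 3 \<Longrightarrow> u d = u' d"
  shows "fill u = fill u'"
proof -
  have "block_colouring u \<nu> = block_colouring u' \<nu>" for \<nu>
    unfolding block_colouring_def by (intro ball_cong conj_cong refl if_cong arg_cong2[of _ _ _ _ "(\<noteq>)"])
      (auto simp: block_def nbrs_def intro!: assms)
  then show ?thesis by (simp add: fill_def)
qed

text \<open>A position labelled t is the corner (0, 0) of a block to be refilled. For separated
  labels the choice of d is unique.\<close>

definition refill :: "'l \<Rightarrow> (grid \<Rightarrow> 'l option) \<Rightarrow> (grid \<Rightarrow> nat) \<Rightarrow> grid \<Rightarrow> nat" where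
  "refill t lab col v = (if \<exists>d \<in> block. lab (v - d) = Some t
     then let d = (SOME d. d \<in> block \<and> lab (v - d) = Some t) in fill (\<lambda>x. col (v - d + x)) d
     else col v)"

text \<open>The differences of distinct corners whose blocks would meet (e = 0) or be
  adjacent.\<close>

definition conflicts :: "grid set" where
  "conflicts = {w. w \<noteq> 0 \<and> (\<exists>d \<in> block. \<exists>d' \<in> block. \<exists>e \<in> insert 0 nbrs. w = d + e - d')}"

definition separated :: "'l \<Rightarrow> (grid \<Rightarrow> 'l option) \<Rightarrow> bool" where
  "separated t lab \<longleftrightarrow> (\<forall>p w. lab p = Some t \<longrightarrow> lab (p + w) = Some t \<longrightarrow> w \<notin> conflicts)"

lemma refill_block:
  assumes sep: "separated t lab" and "d \<in> block" "lab p = Some t"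
  shows "refill t lab col (p + d) = fill (\<lambda>x. col (p + x)) d"
proof -
  have "d' = d" if "d' \<in> block" "lab (p + d - d') = Some t" for d'
  proof (rule ccontr)
    assume "d' \<noteq> d"
    then have "d - d' \<in> conflicts"
      using assms(2) that(1) unfolding conflicts_def
      by (intro CollectI conjI bexI[of _ d] bexI[of _ d'] bexI[of _ 0]) simp_all
    moreover have "lab (p + (d - d')) = Some t" using that(2) by (simp add: algebra_simps)
    ultimately show False using sep assms(3) unfolding separated_def by blast
  qed
  moreover have "lab (p + d - d) = Some t" using assms(3) by simp
  ultimately have "(SOME d'. d' \<in> block \<and> lab (p + d - d') = Some t) = d"
    using assms(2) by (intro some_equality) auto
  then show ?thesis
    using assms(2,3) by (auto simp: refill_def Let_def intro!: bexI[of _ d])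
qed

lemma refill_other: "(\<And>d. d \<in> block \<Longrightarrow> lab (v - d) \<noteq> Some t) \<Longrightarrow> refill t lab col v = col v"
  by (auto simp: refill_def)

lemma refill_lt4:
  assumes "separated t lab" "d \<in> block" "lab p = Some t"
  shows "refill t lab col (p + d) < 4"
  using refill_block[OF assms] block_colouring_fill[of "\<lambda>x. col (p + x)"] assms(2)
  by (simp add: block_colouring_def)

lemma refill_values:
  assumes "separated t lab"
  shows "refill t lab col v < 4 \<or> refill t lab col v = col v"
proof (cases "\<exists>d \<in> block. lab (v - d) = Some t")
  case True
  then obtain d where "d \<in> block" "lab (v - d) = Some t" by blast
  then show ?thesis using refill_lt4[OF assms, of d "v - d" col] by simp
next
  case False
  then show ?thesis using refill_other[of lab v t col] by blast
qed

text \<open>Blocks with the same label neither meet nor touch, so an edge lies within one block,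
  leaves one block, or avoids all of them.\<close>

lemma proper_refill:
  assumes sep: "separated t lab" and pr: "proper col"
  shows "proper (refill t lab col)"
  unfolding proper_def
proof (intro allI ballI)
  fix v e assume e: "e \<in> nbrs"
  have boundary: "refill t lab col v \<noteq> refill t lab col (v + e)"
    if e: "e \<in> nbrs" and d: "d \<in> block" "lab (v - d) = Some t"
      and w: "\<forall>d \<in> block. lab (v + e - d) \<noteq> Some t" for v e d
  proof -
    have "d + e \<notin> block"
    proof
      assume "d + e \<in> block"
      then have "lab (v + e - (d + e)) \<noteq> Some t" using w by blast
      then show False using d(2) by simp
    qed
    then have "fill (\<lambda>x. col (v - d + x)) d \<noteq> col (v - d + (d + e))"
      using block_colouring_fill[of "\<lambda>x. col (v - d + x)"] e d(1) unfolding block_colouring_def by metis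
    moreover have "refill t lab col v = fill (\<lambda>x. col (v - d + x)) d"
      using refill_block[OF sep d, of col] by simp
    moreover have "refill t lab col (v + e) = col (v + e)"
      using w by (intro refill_other) blast
    ultimately show ?thesis by (simp add: algebra_simps)
  qed
  show "refill t lab col v \<noteq> refill t lab col (v + e)"
  proof (cases "\<exists>d \<in> block. lab (v - d) = Some t")
    case True
    then obtain d where d: "d \<in> block" "lab (v - d) = Some t" by blast
    show ?thesis
    proof (cases "\<exists>d' \<in> block. lab (v + e - d') = Some t")
      case True
      then obtain d' where d': "d' \<in> block" "lab (v + e - d') = Some t" by blast
      have "d + e - d' = 0"
      proof (rule ccontr)
        assume "d + e - d' \<noteq> 0"
        then have "d + e - d' \<in> conflicts"
          using d(1) d'(1) e unfolding conflicts_def by auto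
        moreover have "lab (v - d + (d + e - d')) = Some t" using d'(2) by (simp add: algebra_simps)
        ultimately show False using sep d(2) unfolding separated_def by blast
      qed
      then have d'_eq: "d' = d + e" by simp
      have "fill (\<lambda>x. col (v - d + x)) d \<noteq> fill (\<lambda>x. col (v - d + x)) (d + e)"
        using block_colouring_fill[of "\<lambda>x. col (v - d + x)"] d(1) d'(1) e
        unfolding block_colouring_def d'_eq by metis
      moreover have "refill t lab col (v - d + d) = fill (\<lambda>x. col (v - d + x)) d"
        by (rule refill_block[OF sep d])
      moreover have "refill t lab col (v - d + (d + e)) = fill (\<lambda>x. col (v - d + x)) (d + e)"
        using d'(1) by (intro refill_block[OF sep _ d(2)]) (simp add: d'_eq)
      ultimately show ?thesis by (simp add: algebra_simps)
    next
      case False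
      then show ?thesis using boundary[OF e d] by blast
    qed
  next
    case no_v: False
    show ?thesis
    proof (cases "\<exists>d' \<in> block. lab (v + e - d') = Some t")
      case True
      then obtain d' where d': "d' \<in> block" "lab (v + e - d') = Some t" by blast
      have "refill t lab col (v + e) \<noteq> refill t lab col (v + e + - e)"
        using no_v by (intro boundary[OF uminus_nbrs[OF e] d']) simp
      then show ?thesis by simp
    next
      case False
      then have "refill t lab col v = col v" "refill t lab col (v + e) = col (v + e)"
        using no_v by (auto intro!: refill_other)
      then show ?thesis using pr e unfolding proper_def by metis
    qed
  qed
qed

text \<open>The radius is 5 = 2 + 3: a block reaches 2 from its corner, and filling it reads up to 3
  from there.\<close>

lemma refill_cong:
  assumes lab: "\<And>d. \<bar>fst d\<bar> \<le> 5 \<Longrightarrow> \<bar>snd d\<bar> \<le> 5 \<Longrightarrow> lab (p + d) = lab' (p' + d)"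
    and col: "\<And>d. \<bar>fst d\<bar> \<le> 5 \<Longrightarrow> \<bar>snd d\<bar> \<le> 5 \<Longrightarrow> col (p + d) = col' (p' + d)"
  shows "refill t lab col p = refill t lab' col' p'"
proof -
  have bd: "\<bar>fst d\<bar> \<le> 2 \<and> \<bar>snd d\<bar> \<le> 2" if "d \<in> block" for d using that by (auto simp: block_def)
  have 1: "lab (p - d) = lab' (p' - d)" if "d \<in> block" for d
    using lab[of "- d"] bd[OF that] by simp
  then have 2: "(SOME d. d \<in> block \<and> lab (p - d) = Some t) = (SOME d. d \<in> block \<and> lab' (p' - d) = Some t)"
    by (intro arg_cong[of _ _ Eps] ext) auto
  have 3: "fill (\<lambda>x. col (p - d + x)) = fill (\<lambda>x. col' (p' - d + x))" if "d \<in> block" for d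
  proof (rule fill_cong)
    fix x :: grid assume "\<bar>fst x\<bar> \<le> 3" "\<bar>snd x\<bar> \<le> 3"
    then have "\<bar>fst (x - d)\<bar> \<le> 5" "\<bar>snd (x - d)\<bar> \<le> 5" using bd[OF that] by auto
    then show "col (p - d + x) = col' (p' - d + x)"
      using col[of "x - d"] by (simp add: algebra_simps)
  qed
  have 4: "(SOME d. d \<in> block \<and> lab (p - d) = Some t) \<in> block" if "\<exists>d \<in> block. lab (p - d) = Some t"
    using someI_ex[of "\<lambda>d. d \<in> block \<and> lab (p - d) = Some t"] that by blast
  show ?thesis
    using 1 3[OF 4] col[of 0] unfolding refill_def Let_def 2[symmetric] by (simp cong: bex_cong)
qed

text \<open>Two positions with the same label have disjoint and nonadjacent blocks: the value of \<open>f\<close> excludes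
  that they differ by an odd step, and the colours of the neighbours exclude even differences.\<close>

definition label :: "(grid \<Rightarrow> nat) \<Rightarrow> (grid \<Rightarrow> nat) \<Rightarrow> grid \<Rightarrow> nat list option" where
  "label f g p = (if g p = 4 then Some [f p, g (p + (1, 1)), g (p + (1, -1)), g (p + (-1, 1)), g (p + (-1, -1))] else None)"

text \<open>The labels remain those of the five-colouring while the colours change. Their entries
  are values of f, below C, or colours at most 4, so the list runs through all labels.\<close>

definition four_colour :: "nat \<Rightarrow> (grid \<Rightarrow> nat) \<Rightarrow> grid \<Rightarrow> nat" where
  "four_colour C f = fold (\<lambda>t. refill t (label f (five_colour C f))) (List.n_lists 5 [0..<max C 5]) (five_colour C f)"

definition odd_steps :: "grid set" where
  "odd_steps = {1, -1, 3, -3} \<times> {1, -1, 3, -3}"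

text \<open>Steps by 3 arise from a diagonal of a block followed by an edge, such as (2, 0) + (1,
  1).\<close>

lemma conflicts_cases:
  assumes "w \<in> conflicts"
  shows "w \<in> odd_steps \<or> w \<in> {(2, 0), (-2, 0), (0, 2), (0, -2), (2, 2), (-2, -2), (2, -2), (-2, 2)}"
  using assms unfolding conflicts_def block_def nbrs_def odd_steps_def
  by (elim CollectE conjE bexE insertE emptyE) (simp_all add: zero_prod_def)

lemma separated_label:
  assumes f: "\<And>p w. w \<in> odd_steps \<Longrightarrow> f p \<noteq> f (p + w)"
    and g: "\<And>p. g p = 4 \<Longrightarrow> inj_on (\<lambda>d. g (p + d)) nbrs"
  shows "separated t (label f g)"
  unfolding separated_def
proof (intro allI impI)
  fix p w assume p: "label f g p = Some t" and pw: "label f g (p + w) = Some t"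
  show "w \<notin> conflicts"
  proof
    assume "w \<in> conflicts"
    have eq: "f p = f (p + w)" "g (p + (1, 1)) = g (p + w + (1, 1))" "g (p + (1, -1)) = g (p + w + (1, -1))"
        "g (p + (-1, 1)) = g (p + w + (-1, 1))" "g (p + (-1, -1)) = g (p + w + (-1, -1))" and "g p = 4"
      using p pw by (auto simp: label_def split: if_splits)
    have inj: "a = b" if "g (p + a) = g (p + b)" "a \<in> nbrs" "b \<in> nbrs" for a b
      using inj_onD[OF g[OF \<open>g p = 4\<close>]] that by blast
    from conflicts_cases[OF \<open>w \<in> conflicts\<close>] show False
    proof
      assume "w \<in> odd_steps"
      then show False using f eq(1) by blast
    next
      assume "w \<in> {(2, 0), (-2, 0), (0, 2), (0, -2), (2, 2), (-2, -2), (2, -2), (-2, 2)}"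
      \<comment> \<open>The two positions share a neighbour that occupies different places in their
        labels. Equal labels thus give two neighbours of p the same colour.\<close>
      then show False
        using eq(2-5) inj[of "(1, 1)" "(1, -1)"] inj[of "(1, 1)" "(-1, 1)"] inj[of "(1, 1)" "(-1, -1)"]
          inj[of "(1, -1)" "(-1, 1)"] inj[of "(1, -1)" "(-1, -1)"] inj[of "(-1, 1)" "(-1, -1)"]
        by (auto simp: nbrs_def add.assoc)
    qed
  qed
qed

text \<open>No round creates colour 4, and the round of t removes it from all positions labelled t,
  as they lie in their own blocks. So colour 4 survives only at labels still to come.\<close>

lemma fold_refill:
  assumes sep: "\<And>t. separated t lab" and "proper col" "\<And>p. col p \<le> 4"
    and "\<And>p. col p = 4 \<Longrightarrow> \<exists>t \<in> set L. lab p = Some t"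
  shows "proper (fold (\<lambda>t. refill t lab) L col) \<and> (\<forall>p. fold (\<lambda>t. refill t lab) L col p < 4)"
  using assms(2-)
proof (induction L arbitrary: col)
  case Nil
  then show ?case using le_neq_implies_less by fastforce
next
  case (Cons t L)
  have z: "(0, 0) \<in> block" by (simp add: block_def)
  have "proper (refill t lab col)" by (rule proper_refill[OF sep Cons.prems(1)])
  moreover have "refill t lab col p \<le> 4" for p
    using refill_values[OF sep, of t col p] Cons.prems(2)[of p] by auto
  moreover have "\<exists>t' \<in> set L. lab p = Some t'" if "refill t lab col p = 4" for p
  proof -
    have "col p = 4" using refill_values[OF sep, of t col p] that by auto
    moreover have "lab p \<noteq> Some t"
      using refill_lt4[OF sep z, of p t col] that by (auto simp: zero_prod_def[symmetric])
    ultimately show ?thesis using Cons.prems(3)[of p] by auto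
  qed
  ultimately show ?case using Cons.IH by simp
qed

lemma four_colour_proper:
  assumes "\<And>p. f p < C" and f: "\<And>p w. w \<in> odd_steps \<Longrightarrow> f p \<noteq> f (p + w)"
  shows "proper (four_colour C f)" "four_colour C f p < 4"
proof -
  have "nbrs \<subseteq> odd_steps" by (auto simp: nbrs_def odd_steps_def)
  then have pf: "proper f" using f by (auto simp: proper_def)
  note g = five_colour[OF pf assms(1)]
  have "proper (four_colour C f) \<and> (\<forall>p. four_colour C f p < 4)"
    unfolding four_colour_def
  proof (rule fold_refill)
    show "separated t (label f (five_colour C f))" for t
      by (rule separated_label[OF f g(3)])
    fix p assume p: "five_colour C f p = 4"
    have "five_colour C f (p + d) < max C 5" for d
      using g(2)[of "p + d"] by simp
    then show "\<exists>t \<in> set (List.n_lists 5 [0..<max C 5]). label f (five_colour C f) p = Some t"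
      using p assms(1)[of p] by (auto simp: label_def set_n_lists less_max_iff_disj)
  qed (use g in auto)
  then show "proper (four_colour C f)" "four_colour C f p < 4" by blast+
qed

lemma depends_locally_recolour:
  assumes "depends_locally R \<Phi>"
  shows "depends_locally (R + 1) (\<lambda>f. recolour \<gamma> (\<Phi> f))"
proof (rule depends_locally_comp[OF assms assms, where G = "\<lambda>a b. recolour \<gamma> a"])
  fix a a' :: "grid \<Rightarrow> nat" and p p'
  assume eq: "\<And>d. \<bar>fst d\<bar> \<le> 1 \<Longrightarrow> \<bar>snd d\<bar> \<le> 1 \<Longrightarrow> a (p + d) = a' (p' + d)"
  have "a (p + d) = a' (p' + d)" if "d \<in> nbrs" for d
    using that by (intro eq) (auto simp: nbrs_def)
  moreover have "a p = a' p'" using eq[of 0] by simp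
  ultimately show "recolour \<gamma> a p = recolour \<gamma> a' p'"
    by (simp add: recolour_def cong: ball_cong)
qed

text \<open>The number of rounds depends on C alone, and each of them adds a constant to the
  radius.\<close>

lemma four_colour_local: "\<exists>R\<ge>0. depends_locally R (four_colour C)"
proof -
  have id: "depends_locally 0 (\<lambda>f :: grid \<Rightarrow> nat. f)"
    unfolding depends_locally_def by (metis abs_zero add.right_neutral fst_zero order_refl snd_zero)
  have rec: "\<exists>R\<ge>0. depends_locally R (\<lambda>f. fold recolour L (\<Phi> f))" if "depends_locally R \<Phi>" "R \<ge> 0" for R L and \<Phi> :: "(grid \<Rightarrow> nat) \<Rightarrow> grid \<Rightarrow> nat"
    using that
  proof (induction L arbitrary: R \<Phi>)
    case (Cons \<gamma> L)
    then show ?case using Cons.IH[OF depends_locally_recolour[OF Cons.prems(1), of \<gamma>]] by simp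
  qed auto
  obtain R1 where R1: "R1 \<ge> 0" "depends_locally R1 (\<lambda>f. fold recolour [5..<C] f)"
    using rec[OF id, of "[5..<C]"] by auto
  have R2: "depends_locally (R1 + 1) (five_colour C)"
    using depends_locally_recolour[OF R1(2), of 4] by (simp add: five_colour_def[abs_def])
  have "depends_locally (R1 + 1 + 1) (\<lambda>f. label f (five_colour C f))"
  proof (rule depends_locally_comp[OF depends_locally_mono[OF id] R2])
    show "0 \<le> R1 + 1" using R1(1) by simp
    fix a a' b b' :: "grid \<Rightarrow> nat" and p p'
    assume a: "\<And>d. \<bar>fst d\<bar> \<le> 1 \<Longrightarrow> \<bar>snd d\<bar> \<le> 1 \<Longrightarrow> a (p + d) = a' (p' + d)"
      and b: "\<And>d. \<bar>fst d\<bar> \<le> 1 \<Longrightarrow> \<bar>snd d\<bar> \<le> 1 \<Longrightarrow> b (p + d) = b' (p' + d)"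
    show "label a b p = label a' b' p'"
      using a[of 0] b[of 0] b[of "(1, 1)"] b[of "(1, -1)"] b[of "(-1, 1)"] b[of "(-1, -1)"]
      by (simp add: label_def)
  qed
  then have R3: "depends_locally (R1 + 2) (\<lambda>f. label f (five_colour C f))"
    by (simp add: add.assoc)
  have "\<exists>R\<ge>0. depends_locally R (\<lambda>f. fold (\<lambda>t. refill t (label f (five_colour C f))) L (\<Phi> f))"
    if "depends_locally R \<Phi>" "R \<ge> R1 + 2" for R L and \<Phi> :: "(grid \<Rightarrow> nat) \<Rightarrow> grid \<Rightarrow> nat"
    using that
  proof (induction L arbitrary: R \<Phi>)
    case Nil
    then show ?case using R1(1) by (auto intro!: exI[of _ R])
  next
    case (Cons t L)
    have "depends_locally (R + 5) (\<lambda>f. refill t (label f (five_colour C f)) (\<Phi> f))"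
      by (rule depends_locally_comp[OF depends_locally_mono[OF R3 Cons.prems(2)] Cons.prems(1)])
        (rule refill_cong)
    then show ?case using Cons.IH[of "R + 5"] Cons.prems(2) by simp
  qed
  from this[OF depends_locally_mono[OF R2], of "R1 + 2"] show ?thesis
    unfolding four_colour_def[abs_def] by simp
qed

section \<open>Graphs of walks\<close>

text \<open>L counts vertices, so L = 1 gives back the digraph.\<close>

definition walks :: "'v set \<Rightarrow> ('v \<Rightarrow> 'v \<Rightarrow> bool) \<Rightarrow> nat \<Rightarrow> 'v list set" where
  "walks V A L = {w. length w = L \<and> set w \<subseteq> V \<and> successively A w}"

definition walk_arc :: "'v set \<Rightarrow> ('v \<Rightarrow> 'v \<Rightarrow> bool) \<Rightarrow> nat \<Rightarrow> 'v list \<Rightarrow> 'v list \<Rightarrow> bool" where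
  "walk_arc V A L w w' \<longleftrightarrow> (\<exists>u \<in> walks V A (Suc L). w = butlast u \<and> w' = tl u)"

definition walk_graph :: "'v set \<Rightarrow> ('v \<Rightarrow> 'v \<Rightarrow> bool) \<Rightarrow> nat \<Rightarrow> 'v list pair_pre_digraph" where
  "walk_graph V A L = \<lparr> pverts = walks V A L, parcs = {(w, w'). walk_arc V A L w w' \<or> walk_arc V A L w' w} \<rparr>"

lemma walks_butlast: "u \<in> walks V A (Suc L) \<Longrightarrow> butlast u \<in> walks V A L"
  by (cases u rule: rev_cases) (auto simp: walks_def successively_append_iff)

lemma walks_tl: "u \<in> walks V A (Suc L) \<Longrightarrow> tl u \<in> walks V A L"
  by (cases u) (auto simp: walks_def successively_Cons)

lemma walk_arc_walks: "walk_arc V A L w w' \<Longrightarrow> w \<in> walks V A L \<and> w' \<in> walks V A L"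
  using walks_butlast walks_tl unfolding walk_arc_def by blast

lemma pair_graph_walk_graph:
  assumes "finite V" "0 < L" and irrefl: "\<And>x. \<not> A x x"
  shows "pair_graph (walk_graph V A L)"
  unfolding pair_graph_iff
proof (intro conjI)
  have "walks V A L \<subseteq> {w. set w \<subseteq> V \<and> length w = L}" by (auto simp: walks_def)
  then show "finite (pverts (walk_graph V A L))"
    using finite_lists_length_eq[OF assms(1)] by (simp add: walk_graph_def finite_subset)
  show "parcs (walk_graph V A L) \<subseteq> pverts (walk_graph V A L) \<times> pverts (walk_graph V A L)"
    using walk_arc_walks by (fastforce simp: walk_graph_def)
  show "sym (parcs (walk_graph V A L))"
    by (auto simp: walk_graph_def sym_def)
  have "\<not> walk_arc V A L w w" for w
  proof
    assume "walk_arc V A L w w"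
    then obtain u where u: "u \<in> walks V A (Suc L)" "butlast u = tl u" unfolding walk_arc_def by metis
    then obtain x y t where "u = x # y # t"
      using assms(2) by (cases u rule: remdups_adj.cases) (auto simp: walks_def)
    then show False using u irrefl by (auto simp: walks_def split: if_splits)
  qed
  then show "irrefl (parcs (walk_graph V A L))"
    by (auto simp: walk_graph_def irrefl_def)
qed

definition walk_colouring :: "'v set \<Rightarrow> ('v \<Rightarrow> 'v \<Rightarrow> bool) \<Rightarrow> nat \<Rightarrow> nat \<Rightarrow> ('v list \<Rightarrow> nat) \<Rightarrow> bool" where
  "walk_colouring V A L k c \<longleftrightarrow> (\<forall>w \<in> walks V A L. c w < k) \<and> (\<forall>w w'. walk_arc V A L w w' \<longrightarrow> c w \<noteq> c w')"

text \<open>The walks with \<open>L + 1\<close> vertices are the vertices of the arc graph of the walks with \<open>L\<close> vertices: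
  colour a walk by the set of colours of its one-step continuations.\<close>

lemma walk_colouring_shorten:
  assumes c: "walk_colouring V A (Suc L) k c" and "0 < L"
  shows "\<exists>c'. walk_colouring V A L (2 ^ k) c'"
proof -
  define S where "S w = {c u | u. u \<in> walks V A (Suc L) \<and> butlast u = w}" for w
  have sub: "S w \<subseteq> {..<k}" for w using c by (auto simp: S_def walk_colouring_def)
  then have fin: "finite (S w)" for w using finite_subset by blast
  have "set_encode (S w) < 2 ^ k" for w
  proof -
    have "set_encode (S w) \<le> (\<Sum>i<k. 2 ^ i)"
      unfolding set_encode_def using sub by (intro sum_mono2) auto
    also have "\<dots> < 2 ^ k" by (induction k) auto
    finally show ?thesis .
  qed
  moreover have "set_encode (S w) \<noteq> set_encode (S w')" if arc: "walk_arc V A L w w'" for w w'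
  proof
    assume "set_encode (S w) = set_encode (S w')"
    then have eq: "S w = S w'" using set_encode_eq fin by blast
    obtain u where u: "u \<in> walks V A (Suc L)" "w = butlast u" "w' = tl u"
      using arc unfolding walk_arc_def by blast
    then have "c u \<in> S w'" using eq by (auto simp: S_def)
    then obtain u' where u': "u' \<in> walks V A (Suc L)" "butlast u' = w'" "c u' = c u"
      by (auto simp: S_def)
    obtain x t where ut: "u = x # t" using u(1) by (cases u) (auto simp: walks_def)
    obtain z s y where us: "u' = z # s @ [y]"
      using u'(1) \<open>0 < L\<close> by (cases u' rule: remdups_adj.cases; cases "tl u'" rule: rev_cases) (auto simp: walks_def)
    have t: "t = z # s" using u(3) u'(2) by (simp add: ut us butlast_append)
    have "x # u' \<in> walks V A (Suc (Suc L))"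
      using u(1) u'(1) by (auto simp: walks_def ut us t successively_Cons)
    then have "walk_arc V A (Suc L) u u'"
      unfolding walk_arc_def by (intro bexI[of _ "x # u'"]) (simp_all add: ut us t butlast_append)
    then show False using c u'(3) unfolding walk_colouring_def by metis
  qed
  ultimately show ?thesis
    by (intro exI[of _ "\<lambda>w. set_encode (S w)"]) (simp add: walk_colouring_def)
qed

lemma walk_colouring_base:
  "walk_colouring V A (Suc j) k c \<Longrightarrow> \<exists>c'. walk_colouring V A 1 (((\<lambda>k. 2 ^ k) ^^ j) k) c'"
proof (induction j arbitrary: k c)
  case (Suc j)
  obtain c' where "walk_colouring V A (Suc j) (2 ^ k) c'"
    using walk_colouring_shorten[OF Suc.prems] by auto
  from Suc.IH[OF this] show ?case by (simp add: funpow_swap1)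
qed auto

lemma base_arc_irrefl: "m < n \<Longrightarrow> 1 < p \<Longrightarrow> \<not> base_arc p n m x x"
proof
  assume "m < n" and p: "1 < p" and arc: "base_arc p n m x x"
  then have "x \<in> words p n" by (simp add: base_arc_def base_verts_def)
  have "Suc a mod p \<noteq> a" if "a < p" for a
    using that p by (auto simp: mod_Suc)
  then have "{i. i < n \<and> x i \<noteq> shift p n x i} = {..<n}"
    using \<open>x \<in> words p n\<close> by (force simp: shift_def words_def)
  then have "hamming n x (shift p n x) = n"
    by (simp add: hamming_def)
  then show False using arc \<open>m < n\<close> by (simp add: base_arc_def)
qed

text \<open>With fewer than N colours, shortening the walks j times would colour the base digraph
  with the j-fold exponential of N many colours, against \<open>base_not_colourable\<close>.\<close>

lemma chromatic_number_walk_graph: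
  assumes "prime p" "of_nat p = (0 :: 'r::comm_ring_1)" "m < n"
    and m: "(((\<lambda>k. 2 ^ k) ^^ j) N) ^ p \<le> m"
  shows "N \<le> chromatic_number (walk_graph (base_verts p n m) (base_arc p n m) (Suc j))" (is "N \<le> chromatic_number ?G")
proof (rule ccontr)
  let ?V = "base_verts p n m" and ?A = "base_arc p n m"
  assume less: "\<not> N \<le> chromatic_number ?G"
  have p: "1 < p" using assms(1) by (rule prime_gt_1_nat)
  have "pair_graph ?G"
    using base_arc_irrefl[of m n p] p assms(3) by (intro pair_graph_walk_graph finite_base_verts) auto
  then obtain c where c: "proper_colouring ?G (chromatic_number ?G) c"
    using proper_colouring_chromatic_number by blast
  have "walk_colouring ?V ?A (Suc j) N c"
    using c less unfolding proper_colouring_def walk_colouring_def walk_graph_def by fastforce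
  then obtain c' where c': "walk_colouring ?V ?A 1 (((\<lambda>k. 2 ^ k) ^^ j) N) c'"
    using walk_colouring_base by blast
  show False
  proof (rule base_not_colourable[OF assms(1,2) m])
    show "c' [x] < ((\<lambda>k. 2 ^ k) ^^ j) N" if "x \<in> ?V" for x
      using c' that by (auto simp: walk_colouring_def walks_def)
    show "c' [x] \<noteq> c' [y]" if "base_arc p n m x y" for x y
    proof -
      have "walk_arc ?V ?A 1 [x] [y]"
        unfolding walk_arc_def using that
        by (intro bexI[of _ "[x, y]"]) (auto simp: walks_def base_arc_def)
      then show ?thesis using c' unfolding walk_colouring_def by blast
    qed
  qed
qed

section \<open>Doubly infinite walks\<close>

lemma hamming_shift_funpow:
  "x \<in> words p n \<Longrightarrow> y \<in> words p n \<Longrightarrow> hamming n ((shift p n ^^ k) x) ((shift p n ^^ k) y) = hamming n x y"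
  by (induction k) (simp_all add: hamming_shift shift_funpow_words)

text \<open>Every word has an arc to its exact shift. So a walk continues forward by shifting and
  backward by shifting p - 1 times, which inverts the shift. The rules above act on colourings of
  the whole grid and need such extensions.\<close>

lemma extend_walk:
  assumes w: "w \<in> walks (base_verts p n m) (base_arc p n m) L" and "0 < L" "0 < p"
  shows "\<exists>X :: int \<Rightarrow> nat \<Rightarrow> nat. (\<forall>i. base_arc p n m (X i) (X (i + 1))) \<and> (\<forall>i<L. X (int i) = w ! i)"
proof -
  let ?\<sigma> = "shift p n" and ?V = "base_verts p n m"
  define X where "X i = (if i < 0 then (?\<sigma> ^^ (nat (- i) * (p - 1))) (w ! 0)
    else if i < int L then w ! nat i else (?\<sigma> ^^ (nat i + 1 - L)) (w ! (L - 1)))" for i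
  have V: "w ! i \<in> ?V" if "i < L" for i
    using w that by (auto simp: walks_def subset_iff)
  have arc: "base_arc p n m x (?\<sigma> x)" if "x \<in> ?V" for x
    using that shift_base_verts by (simp add: base_arc_def)
  have "base_arc p n m (X i) (X (i + 1))" for i
  proof -
    consider "i < 0" | "0 \<le> i" "i + 1 < int L" | "0 \<le> i" "int L \<le> i + 1" by linarith
    then show ?thesis
    proof cases
      case 1
      define k where "k = nat (- i) - 1"
      have k: "nat (- i) = Suc k" "nat (- (i + 1)) = k" using 1 by (auto simp: k_def)
      have "?\<sigma> (X i) = (?\<sigma> ^^ (Suc (Suc k * (p - 1)))) (w ! 0)"
        using 1 by (simp add: X_def k)
      also have "Suc (Suc k * (p - 1)) = k * (p - 1) + p"
        using assms(3) by (cases p) (simp_all add: algebra_simps)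
      also have "(?\<sigma> ^^ (k * (p - 1) + p)) (w ! 0) = (?\<sigma> ^^ (k * (p - 1))) (w ! 0)"
        using V[OF assms(2)] shift_funpow_p by (simp add: funpow_add base_verts_def)
      also have "\<dots> = X (i + 1)"
      proof (cases "i + 1 < 0")
        case True
        then show ?thesis by (simp add: X_def k(2)[symmetric])
      next
        case False
        then have "i + 1 = 0" "k = 0" using 1 by (auto simp: k_def)
        then show ?thesis using assms(2) by (simp add: X_def)
      qed
      finally have "X (i + 1) = ?\<sigma> (X i)" by simp
      moreover have "X i \<in> ?V" using 1 V[OF assms(2)] by (simp add: X_def shift_funpow_base_verts)
      ultimately show ?thesis using arc by simp
    next
      case 2
      then have "successively (base_arc p n m) w" "length w = L" "Suc (nat i) < L"
        using w by (auto simp: walks_def)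
      then have "base_arc p n m (w ! nat i) (w ! Suc (nat i))"
        by (simp add: successively_conv_nth)
      moreover have "nat (i + 1) = Suc (nat i)" using 2 by simp
      ultimately show ?thesis using 2 by (simp add: X_def)
    next
      case 3
      have "X i = (?\<sigma> ^^ (nat i + 1 - L)) (w ! (L - 1))"
        using 3 assms(2) by (cases "i < int L") (auto simp: X_def intro!: arg_cong[of _ _ "(!) w"])
      moreover have "X (i + 1) = (?\<sigma> ^^ (Suc (nat i + 1 - L))) (w ! (L - 1))"
      proof -
        have "nat (i + 1) + 1 - L = Suc (nat i + 1 - L)" using 3 by simp
        then show ?thesis using 3 by (simp add: X_def)
      qed
      moreover have "(?\<sigma> ^^ (nat i + 1 - L)) (w ! (L - 1)) \<in> ?V"
        using V[of "L - 1"] assms(2) by (simp add: shift_funpow_base_verts)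
      ultimately show ?thesis using arc by simp
    qed
  qed
  moreover have "X (int i) = w ! i" if "i < L" for i using that by (simp add: X_def)
  ultimately show ?thesis by blast
qed

text \<open>Every arc deviates from the shift by at most m, and the shift preserves Hamming
  distance, so the errors add up. Exponents being natural, a step back is written as p - 1
  shifts.\<close>

lemma walk_hamming:
  assumes X: "\<And>i. base_arc p n m (X i) (X (i + 1))" and "0 < p" and a: "\<bar>a :: int\<bar> \<le> 3"
  shows "hamming n (X (i + a)) ((shift p n ^^ (if 0 \<le> a then nat a else nat (- a) * (p - 1))) (X i)) \<le> 3 * m"
proof -
  let ?\<sigma> = "shift p n"
  have V: "X i \<in> words p n" for i using X[of i] by (simp add: base_arc_def base_verts_def)
  have fwd: "hamming n (X (i + int k)) ((?\<sigma> ^^ k) (X i)) \<le> k * m" for i k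
  proof (induction k)
    case (Suc k)
    have "hamming n (X (i + int (Suc k))) ((?\<sigma> ^^ Suc k) (X i)) \<le>
        hamming n (X (i + int k + 1)) (?\<sigma> (X (i + int k))) + hamming n (?\<sigma> (X (i + int k))) (?\<sigma> ((?\<sigma> ^^ k) (X i)))"
      using hamming_triangle[of n "X (i + int (Suc k))" "(?\<sigma> ^^ Suc k) (X i)" "?\<sigma> (X (i + int k))"]
      by (simp add: algebra_simps)
    also have "\<dots> \<le> m + k * m"
      using X[of "i + int k"] Suc V by (intro add_mono) (simp_all add: base_arc_def hamming_shift shift_funpow_words)
    finally show ?case by simp
  qed simp
  show ?thesis
  proof (cases "0 \<le> a")
    case True
    have "nat a * m \<le> 3 * m" using a True by (intro mult_le_mono) auto
    moreover have "hamming n (X (i + a)) ((?\<sigma> ^^ nat a) (X i)) \<le> nat a * m"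
      using True fwd[of i "nat a"] by simp
    ultimately have "hamming n (X (i + a)) ((?\<sigma> ^^ nat a) (X i)) \<le> 3 * m" by (rule le_trans[rotated])
    then show ?thesis using True by simp
  next
    case False
    define k where "k = nat (- a)"
    have k: "a = - int k" "k \<le> 3" using False a by (auto simp: k_def)
    have "hamming n (X (i + a)) ((?\<sigma> ^^ (k * (p - 1))) (X i)) =
        hamming n ((?\<sigma> ^^ k) (X (i + a))) ((?\<sigma> ^^ k) ((?\<sigma> ^^ (k * (p - 1))) (X i)))"
      using V by (simp add: hamming_shift_funpow shift_funpow_words)
    also have "(?\<sigma> ^^ k) ((?\<sigma> ^^ (k * (p - 1))) (X i)) = (?\<sigma> ^^ (k * p)) (X i)"
    proof -
      have "k + k * (p - 1) = k * p" using assms(2) by (cases p) simp_all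
      then show ?thesis by (metis comp_apply funpow_add)
    qed
    also have "(?\<sigma> ^^ (k * p)) (X i) = X i"
      using V[of i] by (auto simp: shift_funpow words_def fun_eq_iff)
    also have "hamming n ((?\<sigma> ^^ k) (X (i + a))) (X i) \<le> k * m"
      using fwd[of "i + a" k] by (simp add: k(1) hamming_commute)
    also have "k * m \<le> 3 * m" using k(2) by (rule mult_le_mono1)
    finally show ?thesis using False by (simp add: k_def)
  qed
qed

text \<open>An arc is itself a walk with L + 1 vertices, so both its ends are windows of one doubly
  infinite walk. Adjacent vertices of the product thereby read the same grid colouring at diagonal
  neighbours.\<close>

lemma adjacent_walks:
  assumes "(w, u) \<in> parcs (walk_graph (base_verts p n m) (base_arc p n m) L)" "0 < L" "0 < p"
  shows "\<exists>X s t. (\<forall>i. base_arc p n m (X i) (X (i + 1))) \<and> (\<forall>i<L. w ! i = X (s + int i)) \<and>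
    (\<forall>i<L. u ! i = X (t + int i)) \<and> (t - s = 1 \<or> t - s = -1)"
proof -
  let ?V = "base_verts p n m" and ?A = "base_arc p n m"
  have *: "\<exists>X. (\<forall>i. ?A (X i) (X (i + 1))) \<and> (\<forall>i<L. w ! i = X (int i)) \<and> (\<forall>i<L. u ! i = X (1 + int i))"
    if arc: "walk_arc ?V ?A L w u" for w u
  proof -
    obtain v where v: "v \<in> walks ?V ?A (Suc L)" "w = butlast v" "u = tl v"
      using arc unfolding walk_arc_def by blast
    have len: "length v = Suc L" using v(1) by (simp add: walks_def)
    obtain X where X: "\<forall>i. ?A (X i) (X (i + 1))" "\<forall>i<Suc L. X (int i) = v ! i"
      using extend_walk[OF v(1)] assms(3) by auto
    have "w ! i = X (int i)" if "i < L" for i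
      using X(2) that len by (simp add: v(2) nth_butlast)
    moreover have "u ! i = X (1 + int i)" if "i < L" for i
      using spec[OF X(2), of "Suc i"] that len by (simp add: v(3) nth_tl)
    ultimately show ?thesis using X(1) by blast
  qed
  have "walk_arc ?V ?A L w u \<or> walk_arc ?V ?A L u w" using assms(1) by (simp add: walk_graph_def)
  then show ?thesis
  proof
    assume "walk_arc ?V ?A L w u"
    from *[OF this] obtain X where "\<forall>i. ?A (X i) (X (i + 1))" "\<forall>i<L. w ! i = X (int i)" "\<forall>i<L. u ! i = X (1 + int i)"
      by blast
    then show ?thesis by (intro exI[of _ X] exI[of _ 0] exI[of _ 1]) simp
  next
    assume "walk_arc ?V ?A L u w"
    from *[OF this] obtain X where "\<forall>i. ?A (X i) (X (i + 1))" "\<forall>i<L. u ! i = X (int i)" "\<forall>i<L. w ! i = X (1 + int i)"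
      by blast
    then show ?thesis by (intro exI[of _ X] exI[of _ 1] exI[of _ 0]) simp
  qed
qed

theorem theorem1p1:
  fixes n :: nat
  shows "poljak_rodl n \<le> 4"
proof -
  obtain C where C: "\<forall>m. \<exists>n c0. m < n \<and>
    (\<forall>x \<in> base_verts 2 n m. \<forall>y \<in> base_verts 5 n m. c0 x y < (C :: nat)) \<and>
    (\<forall>x \<in> base_verts 2 n m. \<forall>y \<in> base_verts 5 n m. \<forall>x' \<in> base_verts 2 n m. \<forall>y' \<in> base_verts 5 n m. \<forall>c d.
      hamming n x' ((shift 2 n ^^ c) x) \<le> 3 * m \<longrightarrow> hamming n y' ((shift 5 n ^^ d) y) \<le> 3 * m \<longrightarrow>
      odd c \<longrightarrow> \<not> 5 dvd d \<longrightarrow> c0 x y \<noteq> c0 x' y')"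
    using product_bounded[of 5] by auto
  obtain R where R: "R \<ge> 0" "depends_locally R (four_colour C)"
    using four_colour_local by blast
  define r where "r = nat R"
  define M :: nat where "M = ((\<lambda>k. 2 ^ k) ^^ (2 * r)) n"
  \<comment> \<open>Large enough for both primes: M is the number of colours left after shortening
    the walks, and both M^2 and M^5 have to be at most m.\<close>
  define m :: nat where "m = M ^ 2 + M ^ 5"
  obtain l c0 where "m < l" and c0: "\<And>x y. x \<in> base_verts 2 l m \<Longrightarrow> y \<in> base_verts 5 l m \<Longrightarrow> c0 x y < C"
    and c0_neq: "\<And>x y x' y' c d. x \<in> base_verts 2 l m \<Longrightarrow> y \<in> base_verts 5 l m \<Longrightarrow> x' \<in> base_verts 2 l m \<Longrightarrow>
      y' \<in> base_verts 5 l m \<Longrightarrow> hamming l x' ((shift 2 l ^^ c) x) \<le> 3 * m \<Longrightarrow> hamming l y' ((shift 5 l ^^ d) y) \<le> 3 * m \<Longrightarrow>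
      odd c \<Longrightarrow> \<not> 5 dvd d \<Longrightarrow> c0 x y \<noteq> c0 x' y'"
    using spec[OF C, of m] by blast
  let ?G = "\<lambda>p. walk_graph (base_verts p l m) (base_arc p l m) (Suc (2 * r))"
  have graph: "pair_graph (?G p)" if "1 < p" for p
    using base_arc_irrefl[of m l p] that \<open>m < l\<close> by (intro pair_graph_walk_graph finite_base_verts) auto
  have "prime (5 :: nat)" by simp
  \<comment> \<open>The numeral types 2 and 5 serve as coefficient rings of characteristic 2 and
    5.\<close>
  have chi: "n \<le> chromatic_number (?G 2)" "n \<le> chromatic_number (?G 5)"
    using chromatic_number_walk_graph[of 2, where 'r = 2] chromatic_number_walk_graph[of 5, where 'r = 5] \<open>m < l\<close>
    by (simp_all add: m_def M_def)
  \<comment> \<open>A vertex of the product sees a square of side 2r + 1 around (r, r), where the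
    rule is evaluated; the default 0 occurs only beyond its radius.\<close>
  define patch where "patch w v q = (if 0 \<le> fst q \<and> fst q \<le> 2 * int r \<and> 0 \<le> snd q \<and> snd q \<le> 2 * int r
    then c0 (w ! nat (fst q)) (v ! nat (snd q)) else 0)" for w v and q :: grid
  define col where "col wv = four_colour C (patch (fst wv) (snd wv)) (int r, int r)" for wv
  define f where "f X Y q = c0 (X (fst q)) (Y (snd q))" for X Y :: "int \<Rightarrow> nat \<Rightarrow> nat" and q :: grid
  have f_less: "f X Y q < C" and f_neq: "d \<in> odd_steps \<Longrightarrow> f X Y q \<noteq> f X Y (q + d)"
    if X: "\<And>i. base_arc 2 l m (X i) (X (i + 1))" and Y: "\<And>i. base_arc 5 l m (Y i) (Y (i + 1))" for X Y q d
  proof -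
    have V: "X i \<in> base_verts 2 l m" "Y i \<in> base_verts 5 l m" for i
      using X[of i] Y[of i] by (simp_all add: base_arc_def)
    then show "f X Y q < C" by (simp add: f_def c0)
    assume d: "d \<in> odd_steps"
    obtain a b where ab: "d = (a, b)" "a \<in> {1, -1, 3, -3}" "b \<in> {1, -1, 3, -3}"
      using d by (auto simp: odd_steps_def)
    have a3: "\<bar>a\<bar> \<le> 3" "\<bar>b\<bar> \<le> 3" using ab by auto
    show "f X Y q \<noteq> f X Y (q + d)"
      unfolding f_def
    proof (rule c0_neq)
      show "hamming l (X (fst (q + d))) ((shift 2 l ^^ (if 0 \<le> a then nat a else nat (- a) * (2 - 1))) (X (fst q))) \<le> 3 * m"
        using walk_hamming[of 2 l m X a "fst q", OF X _ a3(1)] by (simp add: ab)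
      show "hamming l (Y (snd (q + d))) ((shift 5 l ^^ (if 0 \<le> b then nat b else nat (- b) * (5 - 1))) (Y (snd q))) \<le> 3 * m"
        using walk_hamming[of 5 l m Y b "snd q", OF Y _ a3(2)] by (simp add: ab)
      \<comment> \<open>Steps back are multiplied by 1 and by 4, respectively: 1 and 3 are odd, and
        none of 1, 3, 4, 12 is divisible by 5.\<close>
      show "odd (if 0 \<le> a then nat a else nat (- a) * (2 - 1))" using ab(2) by auto
      show "\<not> 5 dvd (if 0 \<le> b then nat b else nat (- b) * (5 - 1))" using ab(3) by auto
    qed (rule V)+
  qed
  \<comment> \<open>The patch and the whole grid look alike within distance R of their centres, so
    the rule yields the same colour on both.\<close>
  have col_eq: "col (w, v) = four_colour C (f X Y) (s + int r, t + int r)"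
    if w: "\<forall>i<Suc (2 * r). w ! i = X (s + int i)" and v: "\<forall>i<Suc (2 * r). v ! i = Y (t + int i)"
    for w v X Y s t
    unfolding col_def
  proof (rule depends_locallyD[OF R(2)])
    fix d :: grid assume "\<bar>fst d\<bar> \<le> R" "\<bar>snd d\<bar> \<le> R"
    then have d: "\<bar>fst d\<bar> \<le> int r" "\<bar>snd d\<bar> \<le> int r" using R(1) by (simp_all add: r_def)
    have "w ! nat (int r + fst d) = X (s + (int r + fst d))" "v ! nat (int r + snd d) = Y (t + (int r + snd d))"
      using spec[OF w, of "nat (int r + fst d)"] spec[OF v, of "nat (int r + snd d)"] d by auto
    moreover have "0 \<le> int r + fst d" "int r + fst d \<le> 2 * int r" "0 \<le> int r + snd d" "int r + snd d \<le> 2 * int r"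
      using d by linarith+
    ultimately show "patch (fst (w, v)) (snd (w, v)) ((int r, int r) + d) = f X Y ((s + int r, t + int r) + d)"
      by (simp add: patch_def f_def add.assoc)
  qed
  have "proper_colouring (tensor_product (?G 2) (?G 5)) 4 col"
    unfolding proper_colouring_def
  proof (intro conjI ballI, goal_cases)
    case (1 wv)
    then obtain w v where wv: "wv = (w, v)" "w \<in> walks (base_verts 2 l m) (base_arc 2 l m) (Suc (2 * r))"
        "v \<in> walks (base_verts 5 l m) (base_arc 5 l m) (Suc (2 * r))"
      by (auto simp: tensor_product_def walk_graph_def)
    obtain X where X: "\<forall>i. base_arc 2 l m (X i) (X (i + 1))" "\<forall>i<Suc (2 * r). X (int i) = w ! i"
      using extend_walk[OF wv(2)] by auto
    obtain Y where Y: "\<forall>i. base_arc 5 l m (Y i) (Y (i + 1))" "\<forall>i<Suc (2 * r). Y (int i) = v ! i"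
      using extend_walk[OF wv(3)] by auto
    have "col wv = four_colour C (f X Y) (0 + int r, 0 + int r)"
      unfolding wv(1) using X(2) Y(2) by (intro col_eq) simp_all
    also have "\<dots> < 4"
      using X(1) Y(1) by (intro four_colour_proper(2) f_less f_neq) auto
    finally show ?case .
  next
    case (2 e)
    then obtain w v w' v' where e: "e = ((w, v), (w', v'))" "(w, w') \<in> parcs (?G 2)" "(v, v') \<in> parcs (?G 5)"
      by (auto simp: tensor_product_def)
    obtain X s s' where X: "\<forall>i. base_arc 2 l m (X i) (X (i + 1))" "\<forall>i<Suc (2 * r). w ! i = X (s + int i)"
        "\<forall>i<Suc (2 * r). w' ! i = X (s' + int i)" "s' - s = 1 \<or> s' - s = -1"
      using adjacent_walks[OF e(2)] by auto
    obtain Y t t' where Y: "\<forall>i. base_arc 5 l m (Y i) (Y (i + 1))" "\<forall>i<Suc (2 * r). v ! i = Y (t + int i)"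
        "\<forall>i<Suc (2 * r). v' ! i = Y (t' + int i)" "t' - t = 1 \<or> t' - t = -1"
      using adjacent_walks[OF e(3)] by auto
    have "proper (four_colour C (f X Y))"
      using X(1) Y(1) by (intro four_colour_proper(1) f_less f_neq) auto
    moreover have "(s' - s, t' - t) \<in> nbrs" using X(4) Y(4) by (auto simp: nbrs_def)
    ultimately have "four_colour C (f X Y) (s + int r, t + int r) \<noteq>
        four_colour C (f X Y) ((s + int r, t + int r) + (s' - s, t' - t))"
      unfolding proper_def by blast
    moreover have "(s + int r, t + int r) + (s' - s, t' - t) = (s' + int r, t' + int r)" by simp
    ultimately have "four_colour C (f X Y) (s + int r, t + int r) \<noteq> four_colour C (f X Y) (s' + int r, t' + int r)"
      by metis
    then have "col (w, v) \<noteq> col (w', v')"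
      using col_eq[OF X(2) Y(2)] col_eq[OF X(3) Y(3)] by simp
    then show ?case by (simp add: e(1))
  qed
  then have "chromatic_number (tensor_product (?G 2) (?G 5)) \<le> 4"
    by (rule chromatic_number_le)
  moreover have "poljak_rodl n \<le> chromatic_number (tensor_product (?G 2) (?G 5))"
    using graph chi by (intro poljak_rodl_le) auto
  ultimately show ?thesis by simp
qed

end
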